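(* Let $u_0$ be a continuous function in $\overline\Omega$ with $u_0|_{\partial\Omega}=0$. Then there exists a unique viscosity solution to $$\begin{cases}b(\partial_tu)\partial_tu=\Delta u&\text{in }\Omega\times(0,+\infty),\\ u=0&\text{on }\partial\Omega\times(0,+\infty),\\ u(\cdot,0)=u_0&\text{in }\Omega.\end{cases}$$ This solution is continuous in $\overline\Omega\times[0,T]$ for every $T>0$. Moreover, a comparison principle holds: for $T>0$, if $\overline u$ is a viscosity supersolution and $\underline u$ is a viscosity subsolution to the equation $b(\partial_tu)\partial_tu=\Delta u$ in $\Omega\times(0,T)$ such that $\overline u\ge\underline u$ at the parabolic boundary $\Gamma_T=(\Omega\times\{0\})\cup(\partial\Omega\times(0,T))$, then $\overline u\ge\underline u$ in the whole $\overline\Omega\times[0,T]$.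
   Context: $\Omega\subset\mathbb{R}^N$, $N\ge1$, is a bounded smooth domain, $b^+>b^->0$, and $b(s)=b^-$ if $s<0$, $b(s)=b^+$ if $s\ge0$. A bounded upper (resp. lower) semicontinuous function $u:\overline\Omega\times[0,T]\to\mathbb{R}$ is a viscosity subsolution (resp. supersolution) of the equation $b(\partial_tu)\partial_tu=\Delta u$ in $\Omega\times(0,T)$ if for every smooth function $\phi$, at every maximum (resp. minimum) point $(x_0,t_0)\in\Omega\times(0,T)$ of $u-\phi$ in $B_\delta(x_0)\times(t_0-\delta,t_0+\delta)\subseteq\Omega\times(0,T)$ for some $\delta>0$, one has $b(\partial_t\phi)\partial_t\phi(x_0,t_0)-\Delta\phi(x_0,t_0)\le0$ (resp. $\ge0$). It is a subsolution (resp. supersolution) of the initial-boundary value problem on $(0,T)$ if in addition $u\le0$ (resp. $\ge0$) on $\partial\Omega\times(0,T)$ and $u(x,0)\le u_0(x)$ (resp. $\ge$) in $\Omega$. A viscosity solution is a continuous function $u:\overline\Omega\times[0,\infty)\to\mathbb{R}$ which is, for every $T>0$, both a subsolution and a supersolution of the initial-boundary value problem on $(0,T)$.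
   Formalization: Comparison is concluded on (Ω×(0,T))∪Γ_T, and at the corners ∂Ω×{0} and at t=T only at points where both functions are continuous: for semicontinuous functions it fails there (subsolution equal to 1 at t=T and 0 elsewhere, supersolution 0). *)

theory Defs
  imports "HOL-Analysis.Analysis"
begin

text \<open>Intended for open \<open>S\<close>: all iterated directional derivatives up to order \<open>k\<close>
  exist on \<open>S\<close> and are Frechet differentiable, resp. continuous at order \<open>k\<close>.\<close>

fun Ck_on :: "nat \<Rightarrow> 'a::euclidean_space set \<Rightarrow> ('a \<Rightarrow> real) \<Rightarrow> bool" where
  "Ck_on 0 S f \<longleftrightarrow> continuous_on S f"
| "Ck_on (Suc k) S f \<longleftrightarrow> (\<forall>x\<in>S. f differentiable (at x)) \<and>
     (\<forall>v. Ck_on k S (\<lambda>x. frechet_derivative f (at x) v))"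

definition smooth_on :: "'a::euclidean_space set \<Rightarrow> ('a \<Rightarrow> real) \<Rightarrow> bool" where
  "smooth_on S f \<longleftrightarrow> (\<forall>k. Ck_on k S f)"

text \<open>Near each boundary point the domain is, in suitably rotated coordinates, the open region
  strictly above the graph of a smooth function of the remaining \<open>N - 1\<close> coordinates. The height
  direction is the unit vector \<open>\<nu>\<close>; a function on the orthogonal complement of \<open>\<nu>\<close> is
  represented by a function \<open>\<gamma>\<close> on the whole space evaluated at the orthogonal projection.
  For \<open>N = 1\<close> the complement is trivial and the boundary consists of endpoints of intervals
  lying locally on one side.\<close>

definition smooth_boundary :: "'a::euclidean_space set \<Rightarrow> bool" where
  "smooth_boundary \<Omega> \<longleftrightarrow> (\<forall>x0\<in>frontier \<Omega>. \<exists>r>0. \<exists>\<nu> \<gamma>. norm \<nu> = 1 \<and> smooth_on UNIV \<gamma> \<and>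
     \<Omega> \<inter> ball x0 r = {x \<in> ball x0 r. x \<bullet> \<nu> > \<gamma> (x - (x \<bullet> \<nu>) *\<^sub>R \<nu>)})"

definition bounded_smooth_domain :: "'a::euclidean_space set \<Rightarrow> bool" where
  "bounded_smooth_domain \<Omega> \<longleftrightarrow>
     \<Omega> \<noteq> {} \<and> open \<Omega> \<and> connected \<Omega> \<and> bounded \<Omega> \<and> smooth_boundary \<Omega>"

definition usc_on :: "'a::topological_space set \<Rightarrow> ('a \<Rightarrow> real) \<Rightarrow> bool" where
  "usc_on S u \<longleftrightarrow> (\<forall>p\<in>S. \<forall>c>u p. \<forall>\<^sub>F q in at p within S. u q < c)"

definition lsc_on :: "'a::topological_space set \<Rightarrow> ('a \<Rightarrow> real) \<Rightarrow> bool" where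
  "lsc_on S u \<longleftrightarrow> (\<forall>p\<in>S. \<forall>c<u p. \<forall>\<^sub>F q in at p within S. c < u q)"

definition laplacian :: "('a::euclidean_space \<Rightarrow> real) \<Rightarrow> 'a \<Rightarrow> real" where
  "laplacian f x =
     (\<Sum>i\<in>Basis. frechet_derivative (\<lambda>y. frechet_derivative f (at y) i) (at x) i)"

definition time_deriv :: "('a \<times> real \<Rightarrow> real) \<Rightarrow> 'a \<Rightarrow> real \<Rightarrow> real" where
  "time_deriv \<phi> x t = deriv (\<lambda>s. \<phi> (x, s)) t"

definition space_laplacian :: "('a::euclidean_space \<times> real \<Rightarrow> real) \<Rightarrow> 'a \<Rightarrow> real \<Rightarrow> real" where
  "space_laplacian \<phi> x t = laplacian (\<lambda>y. \<phi> (y, t)) x"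

definition b_coeff :: "real \<Rightarrow> real \<Rightarrow> real \<Rightarrow> real" where
  "b_coeff bm bp s = (if s < 0 then bm else bp)"

definition local_max_at ::
  "'a::euclidean_space set \<Rightarrow> real \<Rightarrow> ('a \<times> real \<Rightarrow> real) \<Rightarrow> 'a \<Rightarrow> real \<Rightarrow> bool" where
  "local_max_at \<Omega> T w x0 t0 \<longleftrightarrow> (\<exists>\<delta>>0.
     ball x0 \<delta> \<times> {t0 - \<delta><..<t0 + \<delta>} \<subseteq> \<Omega> \<times> {0<..<T} \<and>
     (\<forall>p \<in> ball x0 \<delta> \<times> {t0 - \<delta><..<t0 + \<delta>}. w p \<le> w (x0, t0)))"

definition local_min_at ::
  "'a::euclidean_space set \<Rightarrow> real \<Rightarrow> ('a \<times> real \<Rightarrow> real) \<Rightarrow> 'a \<Rightarrow> real \<Rightarrow> bool" where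
  "local_min_at \<Omega> T w x0 t0 \<longleftrightarrow> (\<exists>\<delta>>0.
     ball x0 \<delta> \<times> {t0 - \<delta><..<t0 + \<delta>} \<subseteq> \<Omega> \<times> {0<..<T} \<and>
     (\<forall>p \<in> ball x0 \<delta> \<times> {t0 - \<delta><..<t0 + \<delta>}. w (x0, t0) \<le> w p))"

definition viscosity_subsolution ::
  "real \<Rightarrow> real \<Rightarrow> 'a::euclidean_space set \<Rightarrow> real \<Rightarrow> ('a \<times> real \<Rightarrow> real) \<Rightarrow> bool" where
  "viscosity_subsolution bm bp \<Omega> T u \<longleftrightarrow>
     bounded (u ` (closure \<Omega> \<times> {0..T})) \<and> usc_on (closure \<Omega> \<times> {0..T}) u \<and>
     (\<forall>\<phi>. smooth_on (\<Omega> \<times> {0<..<T}) \<phi> \<longrightarrow>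
       (\<forall>x0\<in>\<Omega>. \<forall>t0\<in>{0<..<T}. local_max_at \<Omega> T (\<lambda>p. u p - \<phi> p) x0 t0 \<longrightarrow>
          b_coeff bm bp (time_deriv \<phi> x0 t0) * time_deriv \<phi> x0 t0 - space_laplacian \<phi> x0 t0 \<le> 0))"

definition viscosity_supersolution ::
  "real \<Rightarrow> real \<Rightarrow> 'a::euclidean_space set \<Rightarrow> real \<Rightarrow> ('a \<times> real \<Rightarrow> real) \<Rightarrow> bool" where
  "viscosity_supersolution bm bp \<Omega> T u \<longleftrightarrow>
     bounded (u ` (closure \<Omega> \<times> {0..T})) \<and> lsc_on (closure \<Omega> \<times> {0..T}) u \<and>
     (\<forall>\<phi>. smooth_on (\<Omega> \<times> {0<..<T}) \<phi> \<longrightarrow>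
       (\<forall>x0\<in>\<Omega>. \<forall>t0\<in>{0<..<T}. local_min_at \<Omega> T (\<lambda>p. u p - \<phi> p) x0 t0 \<longrightarrow>
          b_coeff bm bp (time_deriv \<phi> x0 t0) * time_deriv \<phi> x0 t0 - space_laplacian \<phi> x0 t0 \<ge> 0))"

definition ibvp_subsolution ::
  "real \<Rightarrow> real \<Rightarrow> 'a::euclidean_space set \<Rightarrow> ('a \<Rightarrow> real) \<Rightarrow> real \<Rightarrow> ('a \<times> real \<Rightarrow> real) \<Rightarrow> bool" where
  "ibvp_subsolution bm bp \<Omega> u0 T u \<longleftrightarrow> viscosity_subsolution bm bp \<Omega> T u \<and>
     (\<forall>x\<in>frontier \<Omega>. \<forall>t\<in>{0<..<T}. u (x, t) \<le> 0) \<and> (\<forall>x\<in>\<Omega>. u (x, 0) \<le> u0 x)"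

definition ibvp_supersolution ::
  "real \<Rightarrow> real \<Rightarrow> 'a::euclidean_space set \<Rightarrow> ('a \<Rightarrow> real) \<Rightarrow> real \<Rightarrow> ('a \<times> real \<Rightarrow> real) \<Rightarrow> bool" where
  "ibvp_supersolution bm bp \<Omega> u0 T u \<longleftrightarrow> viscosity_supersolution bm bp \<Omega> T u \<and>
     (\<forall>x\<in>frontier \<Omega>. \<forall>t\<in>{0<..<T}. u (x, t) \<ge> 0) \<and> (\<forall>x\<in>\<Omega>. u (x, 0) \<ge> u0 x)"

text \<open>The values of \<open>u\<close> outside \<open>closure \<Omega> \<times> {0..}\<close> are irrelevant.\<close>

definition viscosity_solution ::
  "real \<Rightarrow> real \<Rightarrow> 'a::euclidean_space set \<Rightarrow> ('a \<Rightarrow> real) \<Rightarrow> ('a \<times> real \<Rightarrow> real) \<Rightarrow> bool" where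
  "viscosity_solution bm bp \<Omega> u0 u \<longleftrightarrow> continuous_on (closure \<Omega> \<times> {0..}) u \<and>
     (\<forall>T>0. ibvp_subsolution bm bp \<Omega> u0 T u \<and> ibvp_supersolution bm bp \<Omega> u0 T u)"

text \<open>Contains neither the corners \<open>frontier \<Omega> \<times> {0}\<close> nor anything at \<open>t = T\<close>. The values that
  a discontinuous sub- or supersolution takes there are not constrained by the equation: the
  indicator function of \<open>t = T\<close> is a subsolution lying below the supersolution \<open>0\<close> on this set.\<close>

definition parabolic_boundary :: "'a::euclidean_space set \<Rightarrow> real \<Rightarrow> ('a \<times> real) set" where
  "parabolic_boundary \<Omega> T = (\<Omega> \<times> {0}) \<union> (frontier \<Omega> \<times> {0<..<T})"

end

theory Submission
  imports Defs "HOL-Probability.Probability"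
begin

text \<open>Since \<open>b(s) s = max (b\<^sup>- s) (b\<^sup>+ s)\<close> is convex, a subsolution of the equation is exactly a
  subsolution of both heat equations \<open>b\<^sup>\<plusminus> u\<^sub>t = \<Delta>u\<close>. These are linear, so a subsolution can be
  regularised without doubling variables and without Jensen's lemma: its sup-convolution is a
  Lipschitz subsolution; comparing it with its own heat flow gives a mean value inequality for
  Gaussian means, which survives mollification and there yields the classical inequality. Comparing
  a \<open>C\<^sup>2\<close> subsolution with a semicontinuous supersolution is then the elementary maximum principle.
  In the limit, the difference of a sub- and a supersolution stays below every \<open>C\<^sup>2\<close> supersolution of
  both heat equations that dominates it at the boundary and at the initial time.

  Nothing is assumed about sub- and supersolutions at the corners \<open>\<partial>\<Omega> \<times> {0}\<close>. There
  the difference is dominated by multiples of \<open>h = t\<^bsup>-\<alpha>\<^esup> exp (- k Q / t)\<close>, where \<open>Q \<ge> 0\<close> vanishes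
  quadratically on a piece of the boundary. Since \<open>h \<ge> \<delta>\<^bsup>-\<alpha>\<^esup> e\<^bsup>-k\<^esup>\<close> at time \<open>\<delta>\<close> where \<open>Q \<le> \<delta>\<close>, a
  factor of order \<open>\<delta>\<^sup>\<alpha>\<close> suffices near the boundary if \<open>h\<close>, at its own time \<open>\<delta>\<close>, is inserted at a
  very small actual time, when the difference is still small away from the boundary. This factor
  tends to \<open>0\<close> with \<open>\<delta>\<close>.

  Existence follows by Perron's method; the data are attained because of barriers built from
  exterior balls at boundary points and from \<open>\<bar>x - z\<bar>\<^sup>2 + C t\<close> at initial points.\<close>

section \<open>Second order calculus and viscosity subsolutions\<close>

text \<open>Only the subsolution is regularised. The flux b(s) s is convex, so averaging keeps
  subsolutions but need not keep supersolutions; the supersolution stays semicontinuous and is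
  merely tested. The nonlinearity enters at one place: if a smooth U satisfies both linear
  inequalities b U_t <= lap U and psi satisfies both inequalities lap psi <= b psi_t, then w = U -
  psi satisfies b(w_t) w_t <= lap w, since the left side is the larger of the two linear
  expressions. Hence psi must serve both diffusivities, and so must one and the same U.

  A viscosity inequality cannot be integrated, for it speaks only of touching points. The Gaussian
  bound f(x, t + h) <= mean + O(h^2) speaks of every point and is linear in f, so it can be
  averaged; its error is o(h) and disappears once the smooth average is differentiated in time.

  At the corners the difference of the two functions may jump, so smallness cannot come from the
  data. It comes from the smallness of the region near the corner, against which only the
  boundedness of the difference is set.\<close>

definition D2on :: "'a::euclidean_space set \<Rightarrow> ('a \<Rightarrow> real) \<Rightarrow> ('a \<Rightarrow> 'a) \<Rightarrow> ('a \<Rightarrow> 'a \<Rightarrow> 'a) \<Rightarrow> bool"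
  where "D2on W \<phi> g H \<longleftrightarrow>
    (\<forall>p\<in>W. (\<phi> has_derivative (\<lambda>k. g p \<bullet> k)) (at p) \<and> (g has_derivative H p) (at p))"

definition lap :: "('a::euclidean_space \<times> real \<Rightarrow> 'a \<times> real) \<Rightarrow> real"
  where "lap A = (\<Sum>i\<in>Basis. A (i, 0) \<bullet> (i, 0))"

definition quad :: "real \<Rightarrow> 'a::euclidean_space \<Rightarrow> ('a \<Rightarrow> 'a) \<Rightarrow> 'a \<Rightarrow> 'a \<Rightarrow> real"
  where "quad c a A p q = c + a \<bullet> (q - p) + A (q - p) \<bullet> (q - p) / 2"

text \<open>\<open>vsub F W u\<close> says that \<open>F (u\<^sub>t) \<le> \<Delta>u\<close> holds on \<open>W\<close> in the viscosity sense, tested with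
  quadratic polynomials in space and time only.\<close>

definition vsub :: "(real \<Rightarrow> real) \<Rightarrow> ('a::euclidean_space \<times> real) set \<Rightarrow> ('a \<times> real \<Rightarrow> real) \<Rightarrow> bool"
  where "vsub F W u \<longleftrightarrow> (\<forall>p\<in>W. \<forall>a A. linear A \<longrightarrow>
    (\<forall>\<^sub>F q in nhds p. u q \<le> quad (u p) a A p q) \<longrightarrow> F (snd a) \<le> lap A)"

section \<open>Spatial traces and the calculus of twice differentiable functions\<close>

lemma lap_add: "lap (\<lambda>k. A k + B k) = lap A + lap B"
  by (simp add: lap_def inner_add_left sum.distrib)

lemma lap_scaleR: "lap (\<lambda>k. c *\<^sub>R A k) = c * lap A"
  by (simp add: lap_def sum_distrib_left)

lemma lap_minus: "lap (\<lambda>k. - A k) = - lap A"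
  by (simp add: lap_def sum_negf)

lemma lap_diff: "lap (\<lambda>k. A k - B k) = lap A - lap B"
  by (simp add: lap_def inner_diff_left sum_subtractf)

lemma lap_scaleR_id: "lap (\<lambda>k::'a::euclidean_space \<times> real. c *\<^sub>R k) = c * DIM('a)"
  by (simp add: lap_def sum_distrib_left inner_Basis mult.commute)

lemma sum_inner_Basis_sq: "(\<Sum>i\<in>Basis. (x \<bullet> i) * (y \<bullet> i)) = x \<bullet> (y::'a::euclidean_space)"
  by (subst (3) euclidean_inner) simp

lemma lap_outer: "lap (\<lambda>k. (a \<bullet> k) *\<^sub>R c) = fst a \<bullet> fst c"
proof -
  have "lap (\<lambda>k. (a \<bullet> k) *\<^sub>R c) = (\<Sum>i\<in>Basis. (fst a \<bullet> i) * (fst c \<bullet> i))"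
    unfolding lap_def by (intro sum.cong) (auto simp: inner_prod_def)
  then show ?thesis by (simp add: sum_inner_Basis_sq)
qed

lemma D2on_subset: "D2on W \<phi> g H \<Longrightarrow> V \<subseteq> W \<Longrightarrow> D2on V \<phi> g H"
  by (auto simp: D2on_def)

lemma D2on_linear: "D2on W \<phi> g H \<Longrightarrow> p \<in> W \<Longrightarrow> linear (H p)"
  by (auto simp: D2on_def dest!: has_derivative_linear)

lemma D2on_continuous: "D2on W \<phi> g H \<Longrightarrow> continuous_on W \<phi>"
  by (auto simp: D2on_def intro!: continuous_at_imp_continuous_on dest!: has_derivative_continuous)

lemma D2on_const: "D2on W (\<lambda>p. c) (\<lambda>p. 0) (\<lambda>p k. 0)"
  by (auto simp: D2on_def intro!: derivative_eq_intros)

lemma D2on_inner: "D2on W (\<lambda>p. c \<bullet> p) (\<lambda>p. c) (\<lambda>p k. 0)"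
  by (auto simp: D2on_def intro!: derivative_eq_intros)

lemma D2on_sq: "D2on W (\<lambda>p. (norm (p - c))\<^sup>2) (\<lambda>p. 2 *\<^sub>R (p - c)) (\<lambda>p k. 2 *\<^sub>R k)"
  unfolding D2on_def power2_norm_eq_inner
  by (auto intro!: derivative_eq_intros simp: inner_commute)

lemma D2on_add:
  assumes "D2on W \<phi> g H" "D2on W \<psi> g' H'"
  shows "D2on W (\<lambda>p. \<phi> p + \<psi> p) (\<lambda>p. g p + g' p) (\<lambda>p k. H p k + H' p k)"
  using assms unfolding D2on_def
  by (auto intro!: derivative_eq_intros simp: inner_add_left)

lemma D2on_mult:
  assumes "D2on W \<phi> g H" "D2on W \<psi> g' H'"
  shows "D2on W (\<lambda>p. \<phi> p * \<psi> p) (\<lambda>p. \<phi> p *\<^sub>R g' p + \<psi> p *\<^sub>R g p)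
    (\<lambda>p k. ((g p \<bullet> k) *\<^sub>R g' p + (g' p \<bullet> k) *\<^sub>R g p) + (\<phi> p *\<^sub>R H' p k + \<psi> p *\<^sub>R H p k))"
  unfolding D2on_def
proof (intro ballI conjI)
  fix p assume p: "p \<in> W"
  note [derivative_intros] = assms[unfolded D2on_def, rule_format, OF p, THEN conjunct1]
    assms[unfolded D2on_def, rule_format, OF p, THEN conjunct2]
  show "((\<lambda>p. \<phi> p * \<psi> p) has_derivative (\<bullet>) (\<phi> p *\<^sub>R g' p + \<psi> p *\<^sub>R g p)) (at p)"
    by (auto intro!: derivative_eq_intros simp: inner_add_left)
  show "((\<lambda>p. \<phi> p *\<^sub>R g' p + \<psi> p *\<^sub>R g p) has_derivative
    (\<lambda>k. ((g p \<bullet> k) *\<^sub>R g' p + (g' p \<bullet> k) *\<^sub>R g p) + (\<phi> p *\<^sub>R H' p k + \<psi> p *\<^sub>R H p k))) (at p)"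
    by (auto intro!: derivative_eq_intros simp: algebra_simps)
qed

lemma D2on_cmult:
  assumes "D2on W \<phi> g H"
  shows "D2on W (\<lambda>p. c * \<phi> p) (\<lambda>p. c *\<^sub>R g p) (\<lambda>p k. c *\<^sub>R H p k)"
  using D2on_mult[OF D2on_const[of W c] assms] by simp

lemma D2on_minus:
  assumes "D2on W \<phi> g H"
  shows "D2on W (\<lambda>p. - \<phi> p) (\<lambda>p. - g p) (\<lambda>p k. - H p k)"
  using D2on_cmult[OF assms, of "-1"] by simp

lemma D2on_diff:
  assumes "D2on W \<phi> g H" "D2on W \<psi> g' H'"
  shows "D2on W (\<lambda>p. \<phi> p - \<psi> p) (\<lambda>p. g p - g' p) (\<lambda>p k. H p k - H' p k)"
  using D2on_add[OF assms(1) D2on_minus[OF assms(2)]] by simp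

lemma D2on_sum:
  assumes "finite I" "\<And>i. i \<in> I \<Longrightarrow> D2on W (\<phi> i) (g i) (H i)"
  shows "D2on W (\<lambda>p. \<Sum>i\<in>I. \<phi> i p) (\<lambda>p. \<Sum>i\<in>I. g i p) (\<lambda>p k. \<Sum>i\<in>I. H i p k)"
  using assms by (induction I rule: finite_induct) (auto simp: D2on_const intro!: D2on_add)

lemma D2on_compose:
  fixes r r' r'' :: "real \<Rightarrow> real"
  assumes "D2on W \<phi> g H" "\<And>p. p \<in> W \<Longrightarrow> (r has_real_derivative r' (\<phi> p)) (at (\<phi> p))"
    "\<And>p. p \<in> W \<Longrightarrow> (r' has_real_derivative r'' (\<phi> p)) (at (\<phi> p))"
  shows "D2on W (\<lambda>p. r (\<phi> p)) (\<lambda>p. r' (\<phi> p) *\<^sub>R g p)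
    (\<lambda>p k. r'' (\<phi> p) *\<^sub>R ((g p \<bullet> k) *\<^sub>R g p) + r' (\<phi> p) *\<^sub>R H p k)"
  unfolding D2on_def
proof (intro ballI conjI)
  fix p assume p: "p \<in> W"
  note d = assms(1)[unfolded D2on_def, rule_format, OF p, THEN conjunct1]
    assms(1)[unfolded D2on_def, rule_format, OF p, THEN conjunct2]
  have 1: "((\<lambda>p. r (\<phi> p)) has_derivative (\<lambda>k. r' (\<phi> p) * (g p \<bullet> k))) (at p)"
    using has_derivative_compose[OF d(1) assms(2)[OF p, unfolded has_field_derivative_def]] by simp
  have 2: "((\<lambda>p. r' (\<phi> p)) has_derivative (\<lambda>k. r'' (\<phi> p) * (g p \<bullet> k))) (at p)"
    using has_derivative_compose[OF d(1) assms(3)[OF p, unfolded has_field_derivative_def]] by simp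
  show "((\<lambda>p. r (\<phi> p)) has_derivative (\<bullet>) (r' (\<phi> p) *\<^sub>R g p)) (at p)"
    by (rule has_derivative_eq_rhs[OF 1]) (simp add: fun_eq_iff)
  show "((\<lambda>p. r' (\<phi> p) *\<^sub>R g p) has_derivative
    (\<lambda>k. r'' (\<phi> p) *\<^sub>R ((g p \<bullet> k) *\<^sub>R g p) + r' (\<phi> p) *\<^sub>R H p k)) (at p)"
    by (auto intro!: derivative_eq_intros 2 d simp: algebra_simps)
qed

lemma D2on_fst:
  assumes "D2on W \<phi> g H"
  shows "D2on (W \<times> UNIV) (\<lambda>p::'a::euclidean_space \<times> real. \<phi> (fst p)) (\<lambda>p. (g (fst p), 0))
    (\<lambda>p k. (H (fst p) (fst k), 0))"
  unfolding D2on_def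
proof (intro ballI conjI)
  fix p :: "'a \<times> real" assume "p \<in> W \<times> UNIV"
  then have p: "fst p \<in> W" by auto
  note d = assms(1)[unfolded D2on_def, rule_format, OF p, THEN conjunct1]
    assms(1)[unfolded D2on_def, rule_format, OF p, THEN conjunct2]
  have f: "(fst has_derivative fst) (at p)" by (auto intro!: derivative_eq_intros)
  show "((\<lambda>p. \<phi> (fst p)) has_derivative (\<bullet>) (g (fst p), 0)) (at p)"
    using has_derivative_compose[OF f d(1)] by (simp add: inner_prod_def[abs_def])
  show "((\<lambda>p. (g (fst p), 0)) has_derivative (\<lambda>k. (H (fst p) (fst k), 0))) (at p)"
    using has_derivative_compose[OF f d(2)] by (auto intro!: derivative_eq_intros)
qed

lemma lap_fst: "lap (\<lambda>k. (A (fst k), 0)) = (\<Sum>i\<in>Basis. A i \<bullet> i)"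
  by (simp add: lap_def)

lemma D2on_snd:
  fixes r r' r'' :: "real \<Rightarrow> real"
  assumes "\<And>s. s \<in> S \<Longrightarrow> (r has_real_derivative r' s) (at s)"
    "\<And>s. s \<in> S \<Longrightarrow> (r' has_real_derivative r'' s) (at s)"
  shows "D2on (UNIV \<times> S) (\<lambda>p::'a::euclidean_space \<times> real. r (snd p)) (\<lambda>p. (0, r' (snd p)))
    (\<lambda>p k. (0, r'' (snd p) * snd k))"
proof -
  have i: "D2on (UNIV \<times> S) (\<lambda>p::'a \<times> real. snd p) (\<lambda>p. (0, 1)) (\<lambda>p k. 0)"
    using D2on_inner[of "UNIV \<times> S" "(0::'a, 1::real)"] by (simp add: inner_prod_def)
  show ?thesis
    using D2on_compose[OF i, of r r' r''] assms by (auto simp: inner_prod_def zero_prod_def)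
qed

lemma lap_snd: "lap (\<lambda>k. (0, c * snd k)) = 0"
  by (simp add: lap_def)

lemma quad_pert: "quad c a A p q + e * (norm (q - p))\<^sup>2 = quad c a (\<lambda>k. A k + (2 * e) *\<^sub>R k) p q"
  by (simp add: quad_def inner_add_left power2_norm_eq_inner add_divide_distrib del: scaleR_diff_right)

lemma linear_pert: "linear A \<Longrightarrow> linear (\<lambda>k. A k + c *\<^sub>R k)"
  by (auto intro!: linear_compose_add linear_compose_scale_right linear_id[unfolded id_def])

lemma lap_pert: "lap (\<lambda>k::'a::euclidean_space \<times> real. A k + c *\<^sub>R k) = lap A + c * DIM('a)"
  by (simp add: lap_add lap_scaleR_id)

text \<open>\<open>A\<close> is an arbitrary linear map, of which the form sees only the symmetric
  part; hence the adjoint in gradient and Hessian. The trace does not notice the symmetrisation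
  (\<open>lap_adjoint\<close>).\<close>

lemma D2on_quad:
  assumes "linear A"
  shows "D2on W (quad c a A p) (\<lambda>q. a + (1/2) *\<^sub>R (A (q - p) + adjoint A (q - p)))
     (\<lambda>q k. (1/2) *\<^sub>R (A k + adjoint A k))"
  unfolding D2on_def
proof (intro ballI conjI)
  fix q
  have l: "bounded_linear A" "bounded_linear (adjoint A)"
    using assms adjoint_linear linear_conv_bounded_linear by blast+
  have s: "adjoint A k \<bullet> x = A x \<bullet> k" for k x
    using adjoint_works[OF assms, of x k] by (simp add: inner_commute)
  note [derivative_intros] = bounded_linear.has_derivative[OF l(1)] bounded_linear.has_derivative[OF l(2)]
  have "(quad c a A p has_derivative (\<lambda>k. a \<bullet> k + (A (q - p) \<bullet> k + A k \<bullet> (q - p)) / 2)) (at q)"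
    unfolding quad_def by (auto intro!: derivative_eq_intros)
  then show "(quad c a A p has_derivative (\<bullet>) (a + (1/2) *\<^sub>R (A (q - p) + adjoint A (q - p)))) (at q)"
    by (rule has_derivative_eq_rhs) (simp add: fun_eq_iff inner_add_left s del: scaleR_add_right)
  show "((\<lambda>q. a + (1/2) *\<^sub>R (A (q - p) + adjoint A (q - p))) has_derivative
      (\<lambda>k. (1/2) *\<^sub>R (A k + adjoint A k))) (at q)"
    by (auto intro!: derivative_eq_intros)
qed

lemma lap_adjoint:
  assumes "linear A"
  shows "lap (\<lambda>k. (1/2) *\<^sub>R (A k + adjoint A k)) = lap A"
proof -
  have s: "adjoint A k \<bullet> x = A x \<bullet> k" for k x
    using adjoint_works[OF assms, of x k] by (simp add: inner_commute)
  show ?thesis by (simp add: lap_def inner_add_left s)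
qed

text \<open>The mean value theorem along the segment from \<open>p\<close> to \<open>q\<close>
  reduces the second-order remainder of \<phi> to the first-order remainder of its gradient at
  \<open>p\<close>.\<close>

lemma Peano:
  assumes W: "open W" "p \<in> W" and d: "D2on W \<phi> g H" and e: "e > 0"
  shows "\<forall>\<^sub>F q in nhds p. \<bar>\<phi> q - quad (\<phi> p) (g p) (H p) p q\<bar> \<le> e * (norm (q - p))\<^sup>2"
proof -
  have lin: "linear (H p)" by (rule D2on_linear[OF d W(2)])
  have "(g has_derivative H p) (at p)" using d W by (auto simp: D2on_def)
  then obtain d1 where d1: "d1 > 0"
    and gd: "\<And>q. norm (q - p) < d1 \<Longrightarrow> norm (g q - g p - H p (q - p)) \<le> e * norm (q - p)"
    unfolding has_derivative_at_alt using e by blast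
  obtain d2 where d2: "d2 > 0" "ball p d2 \<subseteq> W" using W open_contains_ball by blast
  define r where "r = min d1 d2"
  have r: "r > 0" using d1 d2 by (simp add: r_def)
  have "\<bar>\<phi> q - quad (\<phi> p) (g p) (H p) p q\<bar> \<le> e * (norm (q - p))\<^sup>2" if q: "q \<in> ball p r" for q
  proof -
    define k where "k = q - p"
    have nk: "norm k < r" using q by (simp add: k_def dist_norm norm_minus_commute)
    \<comment> \<open>The segment restriction with its quadratic Taylor part removed, so that \<psi>
      1 - \<psi> 0 is exactly the remainder at \<open>q\<close>.\<close>
    define \<psi> where "\<psi> = (\<lambda>\<theta>. \<phi> (p + \<theta> *\<^sub>R k) - \<theta> * (g p \<bullet> k) - \<theta>\<^sup>2 * (H p k \<bullet> k) / 2)"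
    define \<psi>' where "\<psi>' = (\<lambda>\<theta>. g (p + \<theta> *\<^sub>R k) \<bullet> k - g p \<bullet> k - \<theta> * (H p k \<bullet> k))"
    have inW: "p + \<theta> *\<^sub>R k \<in> W" and nrm: "norm (p + \<theta> *\<^sub>R k - p) < d1" if "0 \<le> \<theta>" "\<theta> \<le> 1" for \<theta>
    proof -
      have "norm (\<theta> *\<^sub>R k) \<le> norm k" using that by (simp add: mult_left_le_one_le)
      then have "norm (\<theta> *\<^sub>R k) < r" using nk by simp
      then show "p + \<theta> *\<^sub>R k \<in> W" "norm (p + \<theta> *\<^sub>R k - p) < d1"
        using d2 by (auto simp: r_def dist_norm subset_iff)
    qed
    have der: "(\<psi> has_real_derivative \<psi>' \<theta>) (at \<theta>)" if "0 \<le> \<theta>" "\<theta> \<le> 1" for \<theta>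
    proof -
      have "(\<phi> has_derivative (\<lambda>h. g (p + \<theta> *\<^sub>R k) \<bullet> h)) (at (p + \<theta> *\<^sub>R k))"
        using d inW[OF that] by (auto simp: D2on_def)
      moreover have "((\<lambda>\<theta>. p + \<theta> *\<^sub>R k) has_derivative (\<lambda>h. h *\<^sub>R k)) (at \<theta>)"
        by (auto intro!: derivative_eq_intros)
      ultimately have "((\<lambda>\<theta>. \<phi> (p + \<theta> *\<^sub>R k)) has_derivative (\<lambda>h. g (p + \<theta> *\<^sub>R k) \<bullet> (h *\<^sub>R k))) (at \<theta>)"
        using has_derivative_compose by blast
      then have "((\<lambda>\<theta>. \<phi> (p + \<theta> *\<^sub>R k)) has_real_derivative (g (p + \<theta> *\<^sub>R k) \<bullet> k)) (at \<theta>)"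
        by (simp add: has_field_derivative_def mult.commute[of _ "g (p + \<theta> *\<^sub>R k) \<bullet> k"])
      from this show ?thesis unfolding \<psi>_def \<psi>'_def
        by (auto intro!: derivative_eq_intros)
    qed
    obtain \<theta> where \<theta>: "0 < \<theta>" "\<theta> < 1" "\<psi> 1 - \<psi> 0 = (1 - 0) * \<psi>' \<theta>"
      using MVT2[of 0 1 \<psi> \<psi>'] der by auto
    have "\<psi>' \<theta> = (g (p + \<theta> *\<^sub>R k) - g p - H p (p + \<theta> *\<^sub>R k - p)) \<bullet> k"
      by (simp add: \<psi>'_def inner_diff_left linear_cmul[OF lin])
    then have "\<bar>\<psi>' \<theta>\<bar> \<le> norm (g (p + \<theta> *\<^sub>R k) - g p - H p (p + \<theta> *\<^sub>R k - p)) * norm k"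
      by (simp add: Cauchy_Schwarz_ineq2)
    also have "\<dots> \<le> (e * norm (p + \<theta> *\<^sub>R k - p)) * norm k"
      using gd[OF nrm] \<theta> by (intro mult_right_mono) auto
    also have "\<dots> = \<theta> * (e * (norm k)\<^sup>2)" using \<theta> by (simp add: power2_eq_square)
    also have "\<dots> \<le> e * (norm k)\<^sup>2" using \<theta> e by (intro mult_left_le_one_le) auto
    finally have "\<bar>\<psi>' \<theta>\<bar> \<le> e * (norm k)\<^sup>2" .
    moreover have "\<psi>' \<theta> = \<phi> q - quad (\<phi> p) (g p) (H p) p q"
      using \<theta>(3) by (simp add: \<psi>_def quad_def k_def)
    ultimately show ?thesis by (simp add: k_def)
  qed
  then show ?thesis
    using r by (auto simp: eventually_nhds intro!: exI[of _ "ball p r"])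
qed

section \<open>Viscosity subsolutions and their test functions\<close>

lemma vsub_mono: "vsub F W u \<Longrightarrow> V \<subseteq> W \<Longrightarrow> (\<And>s. G s \<le> F s) \<Longrightarrow> vsub G V u"
  unfolding vsub_def by (meson order_trans subsetD)

lemma vsub_add_const: "vsub F W (\<lambda>p. u p + c) \<longleftrightarrow> vsub F W u"
  by (simp add: vsub_def quad_def add.assoc add.commute[of c] add.left_commute[of c])

lemma vsub_local_cong:
  assumes "open W" "\<And>p. p \<in> W \<Longrightarrow> u p = v p" "vsub F W u"
  shows "vsub F W v"
  unfolding vsub_def
proof (intro ballI allI impI)
  fix p a and A :: "'a \<times> real \<Rightarrow> 'a \<times> real"
  assume p: "p \<in> W" and A: "linear A" and t: "\<forall>\<^sub>F q in nhds p. v q \<le> quad (v p) a A p q"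
  have "\<forall>\<^sub>F q in nhds p. u q \<le> quad (u p) a A p q"
    using t eventually_nhds_in_open[OF assms(1) p] by eventually_elim (use assms(2) p in auto)
  then show "F (snd a) \<le> lap A" using assms(3) p A unfolding vsub_def by blast
qed

text \<open>By \<open>Peano\<close> the Taylor polynomial plus a small multiple of the squared
  distance still touches \<open>u\<close> from above, and it is a legitimate quadratic test. Letting
  the multiple tend to 0 gives the inequality for \<phi> itself.\<close>

lemma vsub_test:
  assumes F: "continuous_on UNIV F" and v: "vsub F W u" and p: "p \<in> W" "open V" "p \<in> V"
    and d: "D2on V \<phi> g H" and m: "\<forall>\<^sub>F q in nhds p. u q - \<phi> q \<le> u p - \<phi> p"
  shows "F (snd (g p)) \<le> lap (H p)"
proof (rule field_le_epsilon)
  fix e :: real assume e: "e > 0"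
  \<comment> \<open>The extra term \<open>e' * (norm (q - p))\<^sup>2\<close> raises the spatial
    trace by \<open>2 * e' * DIM('a)\<close>, which is to be \<open>e\<close>.\<close>
  define e' where "e' = e / (2 * DIM('a))"
  have e': "e' > 0" using e by (simp add: e'_def)
  have lin: "linear (H p)" by (rule D2on_linear[OF d p(3)])
  have "\<forall>\<^sub>F q in nhds p. u q \<le> quad (u p) (g p) (\<lambda>k. H p k + (2 * e') *\<^sub>R k) p q"
    using m Peano[OF p(2,3) d e']
  proof eventually_elim
    case (elim q)
    then have "u q \<le> u p + (quad (\<phi> p) (g p) (H p) p q - \<phi> p) + e' * (norm (q - p))\<^sup>2" by simp
    also have "\<dots> = quad (u p) (g p) (H p) p q + e' * (norm (q - p))\<^sup>2" by (simp add: quad_def)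
    finally show ?case by (simp add: quad_pert)
  qed
  then have "F (snd (g p)) \<le> lap (\<lambda>k. H p k + (2 * e') *\<^sub>R k)"
    using v p lin unfolding vsub_def by (blast intro: linear_pert)
  then show "F (snd (g p)) \<le> lap (H p) + e" by (simp add: lap_pert e'_def)
qed

text \<open>Where a quadratic touches \<phi> from above, first derivatives agree and the Hessian of
  \<phi> is below \<open>A\<close> as a quadratic form; the trace is monotone in the form.\<close>

lemma classical_vsub:
  assumes W: "open W" and d: "D2on W \<phi> g H" and le: "\<And>p. p \<in> W \<Longrightarrow> F (snd (g p)) \<le> lap (H p)"
  shows "vsub F W \<phi>"
  unfolding vsub_def
proof (intro ballI allI impI)
  fix p a and A :: "'a \<times> real \<Rightarrow> 'a \<times> real"
  assume p: "p \<in> W" and A: "linear A" and t: "\<forall>\<^sub>F q in nhds p. \<phi> q \<le> quad (\<phi> p) a A p q"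
  have lin: "linear (H p)" by (rule D2on_linear[OF d p])
  have dd: "D2on W (\<lambda>q. quad (\<phi> p) a A p q - \<phi> q) (\<lambda>q. (a + (1/2) *\<^sub>R (A (q - p) + adjoint A (q - p))) - g q)
     (\<lambda>q k. (1/2) *\<^sub>R (A k + adjoint A k) - H q k)"
    by (intro D2on_diff D2on_quad A d)
  have adj: "linear (adjoint A)" using A adjoint_linear by blast
  have "((\<lambda>q. quad (\<phi> p) a A p q - \<phi> q) has_derivative (\<lambda>k. (a - g p) \<bullet> k)) (at p)"
    using dd p A adj by (auto simp: D2on_def linear_0)
  moreover have "\<forall>\<^sub>F q in nhds p. quad (\<phi> p) a A p p - \<phi> p \<le> quad (\<phi> p) a A p q - \<phi> q"
    using t by (simp add: quad_def)
  then obtain S where "open S" "p \<in> S" "\<forall>q\<in>S. quad (\<phi> p) a A p p - \<phi> p \<le> quad (\<phi> p) a A p q - \<phi> q"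
    by (auto simp: eventually_nhds)
  ultimately have "(\<lambda>k. (a - g p) \<bullet> k) = (\<lambda>k. 0)"
    by (intro differential_zero_maxmin[of p S "\<lambda>q. quad (\<phi> p) a A p q - \<phi> q"]) auto
  then have "(a - g p) \<bullet> (a - g p) = 0" by meson
  then have ag: "a = g p" by simp
  have hess: "H p k \<bullet> k \<le> A k \<bullet> k" for k
  proof (rule field_le_epsilon)
    fix e :: real assume e: "e > 0"
    \<comment> \<open>The summand 1 only keeps the denominator positive when \<open>k\<close> is 0.
      The comparison is made at one point of the ray p + \<theta> k and divided by the square of
      \<theta>.\<close>
    define e' where "e' = e / (2 * (norm k)\<^sup>2 + 1)"
    have e': "e' > 0" unfolding e'_def using e by (intro divide_pos_pos) (auto intro: add_nonneg_pos)
    have "\<forall>\<^sub>F q in nhds p. quad 0 0 (H p) p q \<le> quad 0 0 A p q + e' * (norm (q - p))\<^sup>2"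
      using t Peano[OF W p d e'] by eventually_elim (auto simp: quad_def ag)
    moreover have "((\<lambda>\<theta>. p + \<theta> *\<^sub>R k) \<longlongrightarrow> p + 0 *\<^sub>R k) (at_right (0::real))"
      by (intro tendsto_intros)
    ultimately have "\<forall>\<^sub>F \<theta> in at_right 0. quad 0 0 (H p) p (p + \<theta> *\<^sub>R k) \<le> quad 0 0 A p (p + \<theta> *\<^sub>R k)
        + e' * (norm ((p + \<theta> *\<^sub>R k) - p))\<^sup>2"
      by (auto simp: filterlim_iff)
    moreover have "\<forall>\<^sub>F \<theta>::real in at_right 0. 0 < \<theta>" by (simp add: eventually_at_right_less)
    ultimately have "\<forall>\<^sub>F \<theta>::real in at_right 0. 0 < \<theta> \<and> quad 0 0 (H p) p (p + \<theta> *\<^sub>R k) \<le> quad 0 0 A p (p + \<theta> *\<^sub>R k)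
        + e' * (norm ((p + \<theta> *\<^sub>R k) - p))\<^sup>2" by eventually_elim auto
    from eventually_happens'[OF trivial_limit_at_right_real this] obtain \<theta> :: real where \<theta>: "0 < \<theta>" "quad 0 0 (H p) p (p + \<theta> *\<^sub>R k) \<le> quad 0 0 A p (p + \<theta> *\<^sub>R k)
        + e' * (norm ((p + \<theta> *\<^sub>R k) - p))\<^sup>2"
      by blast
    have "\<theta>\<^sup>2 * (H p k \<bullet> k) \<le> \<theta>\<^sup>2 * (A k \<bullet> k + 2 * e' * (norm k)\<^sup>2)"
      using \<theta> by (simp add: quad_def linear_cmul[OF lin] linear_cmul[OF A] power2_eq_square algebra_simps)
    then have "H p k \<bullet> k \<le> A k \<bullet> k + 2 * e' * (norm k)\<^sup>2" using \<theta> by simp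
    also have "2 * e' * (norm k)\<^sup>2 = e * ((2 * (norm k)\<^sup>2) / (2 * (norm k)\<^sup>2 + 1))" by (simp add: e'_def)
    also have "\<dots> \<le> e * 1" using e
      by (intro mult_left_mono) (auto simp: divide_le_eq_1 intro: add_nonneg_pos)
    finally show "H p k \<bullet> k \<le> A k \<bullet> k + e" by simp
  qed
  have "F (snd a) \<le> lap (H p)" using le[OF p] ag by simp
  also have "\<dots> \<le> lap A" unfolding lap_def by (intro sum_mono hess)
  finally show "F (snd a) \<le> lap A" .
qed

section \<open>Maximum principles\<close>

lemma usc_onD: "usc_on S u \<Longrightarrow> p \<in> S \<Longrightarrow> c > u p \<Longrightarrow> \<exists>e>0. \<forall>q\<in>S. dist q p < e \<longrightarrow> u q < c"
  unfolding usc_on_def eventually_at by (metis dist_self)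

lemma usc_onI: "(\<And>p c. p \<in> S \<Longrightarrow> u p < c \<Longrightarrow> \<exists>e>0. \<forall>q\<in>S. dist q p < e \<longrightarrow> u q < c) \<Longrightarrow> usc_on S (u :: 'a::metric_space \<Rightarrow> real)"
  unfolding usc_on_def eventually_at by metis

lemma lsc_iff: "lsc_on S u \<longleftrightarrow> usc_on S (\<lambda>p. - u p)"
  unfolding lsc_on_def usc_on_def
proof (intro ball_cong refl iffI allI impI)
  fix p c assume "\<forall>c<u p. \<forall>\<^sub>F q in at p within S. c < u q" "- u p < c"
  then have "\<forall>\<^sub>F q in at p within S. - c < u q" by (metis minus_less_iff)
  then show "\<forall>\<^sub>F q in at p within S. - u q < c" by eventually_elim simp
next
  fix p c assume "\<forall>c>- u p. \<forall>\<^sub>F q in at p within S. - u q < c" "c < u p"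
  then have "\<forall>\<^sub>F q in at p within S. - u q < - c" by (metis neg_less_iff_less)
  then show "\<forall>\<^sub>F q in at p within S. c < u q" by eventually_elim simp
qed

lemma usc_on_subset: "usc_on S u \<Longrightarrow> T \<subseteq> S \<Longrightarrow> usc_on T (u :: 'a::metric_space \<Rightarrow> real)"
  by (rule usc_onI) (meson usc_onD subsetD)

lemma usc_on_continuous: "continuous_on S u \<Longrightarrow> usc_on S (u :: 'a::metric_space \<Rightarrow> real)"
  unfolding usc_on_def continuous_on_def by (auto dest: order_tendstoD(2))

lemma usc_on_cong: "(\<And>p. p \<in> S \<Longrightarrow> u p = v p) \<Longrightarrow> usc_on S u \<longleftrightarrow> usc_on S (v :: 'a::metric_space \<Rightarrow> real)"
  by (intro iffI; rule usc_onI) (metis usc_onD)+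

lemma usc_on_add:
  fixes u v :: "'a::metric_space \<Rightarrow> real"
  assumes "usc_on S u" "usc_on S v"
  shows "usc_on S (\<lambda>p. u p + v p)"
proof (rule usc_onI)
  fix p c assume p: "p \<in> S" "u p + v p < c"
  define d where "d = (c - (u p + v p)) / 2"
  have d: "d > 0" using p by (simp add: d_def)
  obtain e1 where e1: "e1 > 0" "\<forall>q\<in>S. dist q p < e1 \<longrightarrow> u q < u p + d"
    using usc_onD[OF assms(1) p(1), of "u p + d"] d by auto
  obtain e2 where e2: "e2 > 0" "\<forall>q\<in>S. dist q p < e2 \<longrightarrow> v q < v p + d"
    using usc_onD[OF assms(2) p(1), of "v p + d"] d by auto
  have "u q + v q < c" if "q \<in> S" "dist q p < min e1 e2" for q
  proof -
    have "u q < u p + d" "v q < v p + d" using that e1 e2 by auto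
    then show ?thesis unfolding d_def by argo
  qed
  then show "\<exists>e>0. \<forall>q\<in>S. dist q p < e \<longrightarrow> u q + v q < c"
    using e1 e2 by (intro exI[of _ "min e1 e2"]) auto
qed

lemma usc_on_diff:
  fixes u v :: "'a::metric_space \<Rightarrow> real"
  assumes "usc_on S u" "continuous_on S v"
  shows "usc_on S (\<lambda>p. u p - v p)"
  using usc_on_add[OF assms(1) usc_on_continuous[of S "\<lambda>p. - v p"]] assms(2)
  by (simp add: continuous_on_minus)

lemma usc_on_compose:
  fixes u :: "'a::metric_space \<Rightarrow> real" and f :: "'b::metric_space \<Rightarrow> 'a"
  assumes "usc_on S u" "continuous_on T f" "f ` T \<subseteq> S"
  shows "usc_on T (\<lambda>p. u (f p))"
proof (rule usc_onI)
  fix p c assume p: "p \<in> T" "u (f p) < c"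
  then obtain e where e: "e > 0" "\<forall>q\<in>S. dist q (f p) < e \<longrightarrow> u q < c"
    using usc_onD[OF assms(1), of "f p" c] assms(3) by auto
  obtain d where "d > 0" "\<forall>q\<in>T. dist q p < d \<longrightarrow> dist (f q) (f p) < e"
    using assms(2) p(1) e(1) unfolding continuous_on_iff by blast
  then show "\<exists>e>0. \<forall>q\<in>T. dist q p < e \<longrightarrow> u (f q) < c" using e assms(3) by blast
qed

text \<open>Without a maximum every \<open>p\<close> has a competitor \<open>h p\<close> whose value
  still beats \<open>u\<close> on a whole neighbourhood of \<open>p\<close>. Finitely many such
  neighbourhoods cover \<open>K\<close>, and the best of their competitors would be beaten by
  another of them.\<close>

lemma usc_on_attains_max:
  fixes u :: "'a::metric_space \<Rightarrow> real"
  assumes K: "compact K" "K \<noteq> {}" and u: "usc_on K u"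
  shows "\<exists>p\<in>K. \<forall>q\<in>K. u q \<le> u p"
proof (rule ccontr)
  assume "\<not> ?thesis"
  then have "\<forall>p\<in>K. \<exists>q\<in>K. u p < u q" by (auto simp: not_le)
  then obtain h where h: "\<And>p. p \<in> K \<Longrightarrow> h p \<in> K \<and> u p < u (h p)" by metis
  have "\<forall>p\<in>K. \<exists>e>0. \<forall>q\<in>K. dist q p < e \<longrightarrow> u q < u (h p)"
    using usc_onD[OF u] h by blast
  then obtain e where e: "\<And>p. p \<in> K \<Longrightarrow> e p > 0 \<and> (\<forall>q\<in>K. dist q p < e p \<longrightarrow> u q < u (h p))"
    by metis
  have "K \<subseteq> (\<Union>p\<in>K. ball p (e p))" using e by force
  then obtain C where C: "C \<subseteq> K" "finite C" "K \<subseteq> (\<Union>p\<in>C. ball p (e p))"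
    using compactE_image[OF K(1), of K "\<lambda>p. ball p (e p)"] by auto
  have "C \<noteq> {}" using C K by auto
  then have "Max ((\<lambda>q. u (h q)) ` C) \<in> (\<lambda>q. u (h q)) ` C" using C(2) by (intro Max_in) auto
  then obtain p where p: "p \<in> C" "Max ((\<lambda>q. u (h q)) ` C) = u (h p)" by auto
  have pm: "u (h q) \<le> u (h p)" if "q \<in> C" for q
    unfolding p(2)[symmetric] using C(2) that by (intro Max_ge) auto
  have "h p \<in> K" using p C h by auto
  then obtain q where q: "q \<in> C" "h p \<in> ball q (e q)" using C by auto
  then have "u (h p) < u (h q)" using e[of q] C \<open>h p \<in> K\<close> by (auto simp: dist_commute)
  then show False using pm[OF q(1)] by simp
qed

lemma usc_on_superlevel_compact:
  fixes u :: "'a::metric_space \<Rightarrow> real"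
  assumes K: "compact K" and u: "usc_on K u"
  shows "compact {p\<in>K. c \<le> u p}"
proof -
  have "closed {p\<in>K. c \<le> u p}"
    unfolding closed_def
  proof (subst open_dist, intro ballI)
    fix x assume x: "x \<in> - {p\<in>K. c \<le> u p}"
    show "\<exists>e>0. \<forall>y. dist y x < e \<longrightarrow> y \<in> - {p\<in>K. c \<le> u p}"
    proof (cases "x \<in> K")
      case True
      then have "u x < c" using x by auto
      then show ?thesis using usc_onD[OF u True] by fastforce
    next
      case False
      then have "x \<in> - K" "open (- K)" using compact_imp_closed[OF K] by (auto simp: open_closed)
      then obtain e where "e > 0" "\<forall>y. dist y x < e \<longrightarrow> y \<in> - K" unfolding open_dist by blast
      then show ?thesis by blast
    qed
  qed
  then have "compact (K \<inter> {p\<in>K. c \<le> u p})" by (rule compact_Int_closed[OF K])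
  moreover have "K \<inter> {p\<in>K. c \<le> u p} = {p\<in>K. c \<le> u p}" by blast
  ultimately show ?thesis by simp
qed

text \<open>A subsolution cannot be touched from above by a strict classical supersolution, so the
  maximum of the difference lies off \<open>V\<close>. This is the form of the maximum principle on
  which both comparison arguments and Perron's supremum rest.\<close>

lemma max_off_strict:
  assumes F: "continuous_on UNIV F" and K: "compact K" and V: "open V" "V \<subseteq> K"
    and v: "vsub F V v" and usc: "usc_on K (\<lambda>p. v p - \<phi> p)" and d: "D2on V \<phi> g H"
    and strict: "\<And>p. p \<in> V \<Longrightarrow> lap (H p) < F (snd (g p))" and q: "q \<in> K"
  shows "\<exists>y\<in>K - V. v q - \<phi> q \<le> v y - \<phi> y"
proof -
  obtain y where y: "y \<in> K" "\<forall>q\<in>K. v q - \<phi> q \<le> v y - \<phi> y"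
    using usc_on_attains_max[OF K _ usc] q by blast
  have "y \<notin> V"
  proof
    assume yV: "y \<in> V"
    have "\<forall>\<^sub>F q in nhds y. v q - \<phi> q \<le> v y - \<phi> y"
      using eventually_nhds_in_open[OF V(1) yV] by eventually_elim (use y V in auto)
    then have "F (snd (g y)) \<le> lap (H y)"
      using vsub_test[OF F v yV V(1) yV d] by simp
    then show False using strict[OF yV] by simp
  qed
  then show ?thesis using y q by auto
qed

lemma D2on_recip:
  "D2on (UNIV \<times> {..<T}) (\<lambda>p::'a::euclidean_space \<times> real. \<eta> / (T - snd p)) (\<lambda>p. (0, \<eta> / (T - snd p)^2))
     (\<lambda>p k. (0, (2 * \<eta> / (T - snd p)^3) * snd k))"
proof (rule D2on_snd)
  fix s assume s: "s \<in> {..<T}"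
  show "((\<lambda>a. \<eta> / (T - a)) has_real_derivative \<eta> / (T - s)\<^sup>2) (at s)"
    using s by (auto intro!: derivative_eq_intros simp: power2_eq_square)
  have "((\<lambda>a. \<eta> / (T - a)^2) has_real_derivative (\<eta> * (2 * (T - s))) / ((T - s)^2 * (T - s)^2)) (at s)"
    using s by (auto intro!: derivative_eq_intros) (simp add: minus_divide_left right_diff_distrib)
  also have "(\<eta> * (2 * (T - s))) / ((T - s)^2 * (T - s)^2) = (2 * \<eta> * (T - s)) / ((T - s)^3 * (T - s))"
    by (simp add: power2_eq_square power3_eq_cube algebra_simps)
  also have "\<dots> = 2 * \<eta> / (T - s)^3" using s by (subst mult_divide_mult_cancel_right) auto
  finally show "((\<lambda>a. \<eta> / (T - a)\<^sup>2) has_real_derivative 2 * \<eta> / (T - s) ^ 3) (at s)" .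
qed

text \<open>Adding \<eta> / (t1 - t) to \<phi> does two things: its time derivative makes the
  supersolution strict, \<open>F\<close> being strictly increasing, and its growth near
  \<open>t1\<close> keeps the maximum away from the top of the cylinder, where neither the equation
  nor the lateral bound is available.\<close>

lemma classical_comparison:
  fixes O' :: "'a::euclidean_space set"
  assumes O: "open O'" "bounded O'"
    and F: "continuous_on UNIV F" "strict_mono F" and v: "vsub F (O' \<times> {t0<..<t1}) v"
    and usc: "usc_on (closure O' \<times> {t0..t1}) v" and d: "D2on (O' \<times> {t0<..<t1}) \<phi> g H"
    and cont: "continuous_on (closure O' \<times> {t0..t1}) \<phi>"
    and sup: "\<And>p. p \<in> O' \<times> {t0<..<t1} \<Longrightarrow> lap (H p) \<le> F (snd (g p))"
    and init: "\<And>x. x \<in> closure O' \<Longrightarrow> v (x, t0) \<le> \<phi> (x, t0)"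
    and lat: "\<And>x t. x \<in> frontier O' \<Longrightarrow> t0 \<le> t \<Longrightarrow> t < t1 \<Longrightarrow> v (x, t) \<le> \<phi> (x, t)"
    and x: "x \<in> closure O'" and t: "t0 \<le> t" "t < t1"
  shows "v (x, t) \<le> \<phi> (x, t)"
proof (rule ccontr)
  assume neg: "\<not> v (x, t) \<le> \<phi> (x, t)"
  define m where "m = v (x, t) - \<phi> (x, t)"
  have m: "m > 0" using neg by (simp add: m_def)
  have cp: "compact (closure O' \<times> {t0..t1})" using O by (intro compact_Times) auto
  obtain z where z: "\<forall>q\<in>closure O' \<times> {t0..t1}. v q - \<phi> q \<le> v z - \<phi> z"
    using usc_on_attains_max[OF cp _ usc_on_diff[OF usc cont]] x t by fastforce
  define B where "B = max 1 (v z - \<phi> z)"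
  have B: "B > 0" "\<And>q. q \<in> closure O' \<times> {t0..t1} \<Longrightarrow> v q - \<phi> q \<le> B" using z by (auto simp: B_def max.coboundedI2)
  \<comment> \<open>At the point under consideration the penalty then costs m / 2, half of the
    supposed excess.\<close>
  define \<eta> where "\<eta> = m * (t1 - t) / 2"
  have \<eta>: "\<eta> > 0" using m t by (simp add: \<eta>_def)
  \<comment> \<open>At time t1 - \<kappa> the penalty is at least \<open>B\<close>, an upper bound
    for v - \<phi>, so no positive value can sit on the top face of the shortened cylinder.\<close>
  define \<kappa> where "\<kappa> = min (t1 - t) (\<eta> / B)"
  have \<kappa>: "\<kappa> > 0" "\<kappa> \<le> t1 - t" "B \<le> \<eta> / \<kappa>" using \<eta> B t
    by (auto simp: \<kappa>_def min_def field_simps)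
  define K where "K = closure O' \<times> {t0..t1 - \<kappa>}"
  define V where "V = O' \<times> {t0<..<t1 - \<kappa>}"
  define \<psi> where "\<psi> = (\<lambda>p. \<phi> p + \<eta> / (t1 - snd p))"
  have VV: "V \<subseteq> O' \<times> {t0<..<t1}" "V \<subseteq> UNIV \<times> {..<t1}" using \<kappa> by (auto simp: V_def)
  have K: "compact K" "V \<subseteq> K" "open V" "K \<subseteq> closure O' \<times> {t0..t1}"
    using O \<kappa> closure_subset[of O'] by (auto simp: K_def V_def intro!: compact_Times open_Times)
  have d': "D2on V \<psi> (\<lambda>p. g p + (0, \<eta> / (t1 - snd p)^2)) (\<lambda>p k. H p k + (0, (2 * \<eta> / (t1 - snd p)^3) * snd k))"
    unfolding \<psi>_def by (rule D2on_add[OF D2on_subset[OF d VV(1)] D2on_subset[OF D2on_recip VV(2)]])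
  have c': "continuous_on K \<psi>"
    unfolding \<psi>_def by (intro continuous_intros continuous_on_subset[OF cont K(4)]) (use \<kappa> in \<open>auto simp: K_def\<close>)
  have "\<exists>y\<in>K - V. v (x, t) - \<psi> (x, t) \<le> v y - \<psi> y"
  proof (rule max_off_strict[OF F(1) K(1,3,2) vsub_mono[OF v VV(1)] _ d'])
    show "usc_on K (\<lambda>p. v p - \<psi> p)" by (rule usc_on_diff[OF usc_on_subset[OF usc K(4)] c'])
    show "(x, t) \<in> K" using x t \<kappa> by (auto simp: K_def)
    fix p assume p: "p \<in> V"
    have "lap (\<lambda>k. H p k + (0, (2 * \<eta> / (t1 - snd p)^3) * snd k)) = lap (H p)"
      by (simp only: lap_add lap_snd add_0_right)
    also have "\<dots> \<le> F (snd (g p))" using sup VV p by auto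
    also have "\<dots> < F (snd (g p + (0, \<eta> / (t1 - snd p)^2)))"
      using p \<kappa> \<eta> by (intro strict_monoD[OF F(2)]) (auto simp: V_def)
    finally show "lap (\<lambda>k. H p k + (0, (2 * \<eta> / (t1 - snd p)^3) * snd k)) < F (snd (g p + (0, \<eta> / (t1 - snd p)^2)))" .
  qed auto
  then obtain y where y: "y \<in> K" "y \<notin> V" "v (x, t) - \<psi> (x, t) \<le> v y - \<psi> y" by auto
  have "\<eta> / (t1 - t) = m / 2" using t by (simp add: \<eta>_def divide_eq_eq del: right_diff_distrib_numeral)
  then have "v (x, t) - \<psi> (x, t) = m / 2" by (simp add: \<psi>_def m_def)
  then have pos: "v y - \<psi> y > 0" using y m by simp
  obtain x' t' where y': "y = (x', t')" by (cases y)
  have yt: "x' \<in> closure O'" "t0 \<le> t'" "t' \<le> t1 - \<kappa>" using y by (auto simp: K_def y')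
  have "\<eta> / (t1 - t') \<ge> 0" using yt \<kappa> \<eta> by simp
  then have "v y > \<phi> y" using pos by (simp add: \<psi>_def y')
  then have "x' \<notin> frontier O'" "t' \<noteq> t0" using lat[of x' t'] init[of x'] yt \<kappa> by (auto simp: y')
  then have "t' = t1 - \<kappa>" using y yt O by (auto simp: V_def y' frontier_def interior_open)
  then have "v y - \<psi> y = (v y - \<phi> y) - \<eta> / \<kappa>" by (simp add: \<psi>_def y')
  also have "\<dots> \<le> B - \<eta> / \<kappa>" using B y K by (intro diff_right_mono) auto
  finally show False using pos \<kappa> by simp
qed

section \<open>Equivalence of quadratic tests with smooth test functions\<close>

lemma Ck_on_affine: "Ck_on k S (\<lambda>x. c + a \<bullet> x)"
proof (induction k arbitrary: c a)
  case 0
  then show ?case by (auto intro!: continuous_intros)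
next
  case (Suc k)
  have d: "((\<lambda>x. c + a \<bullet> x) has_derivative (\<lambda>k. a \<bullet> k)) (at x)" for x
    by (auto intro!: derivative_eq_intros)
  have "frechet_derivative (\<lambda>x. c + a \<bullet> x) (at x) v = a \<bullet> v + 0 \<bullet> x" for x v
    using frechet_derivative_at[OF d, of x] by (metis add.right_neutral inner_zero_left)
  moreover have "(\<lambda>x. c + a \<bullet> x) differentiable (at x)" for x using d unfolding differentiable_def by blast
  ultimately show ?case using Suc[of _ 0] by simp
qed

text \<open>A directional derivative of a quadratic polynomial is affine, and affine functions
  reproduce themselves under differentiation, so one step down leads to
  \<open>Ck_on_affine\<close>.\<close>

lemma smooth_on_quad:
  assumes "linear A"
  shows "smooth_on S (quad c a A p)"
  unfolding smooth_on_def
proof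
  fix k
  have ladj: "linear (adjoint A)" using assms adjoint_linear by blast
  have s: "adjoint A k \<bullet> x = A x \<bullet> k" for k x
    using adjoint_works[OF assms, of x k] by (simp add: inner_commute)
  note D2 = D2on_quad[OF assms, of UNIV c a p]
  have d: "(quad c a A p has_derivative (\<lambda>k. (a + (1/2) *\<^sub>R (A (q - p) + adjoint A (q - p))) \<bullet> k)) (at q)" for q
    using D2 by (auto simp: D2on_def)
  show "Ck_on k S (quad c a A p)"
  proof (cases k)
    case 0
    then show ?thesis using D2on_continuous[OF D2] by (auto intro: continuous_on_subset)
  next
    case (Suc k)
    have "frechet_derivative (quad c a A p) (at q) v
      = (a \<bullet> v - ((1/2) *\<^sub>R (A p + adjoint A p)) \<bullet> v) + ((1/2) *\<^sub>R (A v + adjoint A v)) \<bullet> q" for q v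
    proof -
      have "frechet_derivative (quad c a A p) (at q) v = (a + (1/2) *\<^sub>R (A (q - p) + adjoint A (q - p))) \<bullet> v"
        using frechet_derivative_at[OF d, of q] by metis
      also have "\<dots> = (a \<bullet> v - ((1/2) *\<^sub>R (A p + adjoint A p)) \<bullet> v) + (A q + adjoint A q) \<bullet> v / 2"
        by (simp add: linear_diff[OF assms] linear_diff[OF ladj] inner_add_left inner_diff_left diff_divide_distrib add_divide_distrib)
      also have "(A q + adjoint A q) \<bullet> v = (A v + adjoint A v) \<bullet> q"
        by (simp add: inner_add_left s)
      finally show ?thesis by simp
    qed
    then have "frechet_derivative (quad c a A p) (at q) v = (\<lambda>q. (a \<bullet> v - ((1/2) *\<^sub>R (A p + adjoint A p)) \<bullet> v)
        + ((1/2) *\<^sub>R (A v + adjoint A v)) \<bullet> q) q" for q v .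
    from this have "Ck_on k' S (\<lambda>q. frechet_derivative (quad c a A p) (at q) v)" for v k'
      by (simp only: Ck_on_affine)
    moreover have "quad c a A p differentiable (at q)" for q using d unfolding differentiable_def by blast
    ultimately show ?thesis unfolding Suc Ck_on.simps by blast
  qed
qed

lemma frechet_derivative_inner_Basis:
  assumes "f differentiable (at q)"
  shows "frechet_derivative f (at q) = (\<lambda>k. (\<Sum>i\<in>Basis. frechet_derivative f (at q) i *\<^sub>R i) \<bullet> k)"
proof
  fix k
  have l: "linear (frechet_derivative f (at q))" using assms by (rule linear_frechet_derivative)
  have "frechet_derivative f (at q) k = frechet_derivative f (at q) (\<Sum>i\<in>Basis. (k \<bullet> i) *\<^sub>R i)"
    by (simp add: euclidean_representation)
  also have "\<dots> = (\<Sum>i\<in>Basis. (k \<bullet> i) * frechet_derivative f (at q) i)"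
    by (simp add: linear_sum[OF l] linear_cmul[OF l])
  finally show "frechet_derivative f (at q) k = (\<Sum>i\<in>Basis. frechet_derivative f (at q) i *\<^sub>R i) \<bullet> k"
    by (simp add: inner_sum_left inner_commute[of k] mult.commute)
qed

text \<open>\<open>Ck_on\<close> speaks of directional derivatives; gradient and Hessian are
  assembled from those along \<open>Basis\<close>. The continuity of the Hessian entries is kept for
  the boundary graph, where the trace has to be bounded on a compact set.\<close>

lemma smooth_on_D2on:
  assumes "smooth_on W \<phi>"
  obtains g H where "D2on W \<phi> g H" "\<And>v w. continuous_on W (\<lambda>p. H p v \<bullet> w)"
proof
  define g where "g = (\<lambda>q. \<Sum>i\<in>Basis. frechet_derivative \<phi> (at q) i *\<^sub>R i)"
  define H where "H = (\<lambda>p k. \<Sum>i\<in>Basis. frechet_derivative (\<lambda>q. frechet_derivative \<phi> (at q) i) (at p) k *\<^sub>R i)"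
  have ck: "Ck_on (Suc (Suc 0)) W \<phi>" using assms unfolding smooth_on_def by blast
  have 1: "\<phi> differentiable (at p)" if "p \<in> W" for p using ck that by auto
  have 2: "(\<lambda>q. frechet_derivative \<phi> (at q) v) differentiable (at p)" if "p \<in> W" for p v
    using ck that by auto
  have 3: "continuous_on W (\<lambda>p. frechet_derivative (\<lambda>q. frechet_derivative \<phi> (at q) i) (at p) v)" for i v
    using ck by auto
  show "D2on W \<phi> g H"
    unfolding D2on_def
  proof (intro ballI conjI)
    fix p assume p: "p \<in> W"
    show "(\<phi> has_derivative (\<bullet>) (g p)) (at p)"
      unfolding g_def
      by (rule has_derivative_eq_rhs[OF frechet_derivative_works[THEN iffD1, OF 1[OF p]]
            frechet_derivative_inner_Basis[OF 1[OF p]]])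
    show "(g has_derivative H p) (at p)"
      unfolding g_def H_def
      by (intro has_derivative_sum has_derivative_scaleR_left
          frechet_derivative_works[THEN iffD1, OF 2[OF p]])
  qed
  show "continuous_on W (\<lambda>p. H p v \<bullet> w)" for v w
    unfolding H_def inner_sum_left inner_scaleR_left by (intro continuous_intros 3)
qed

lemma time_deriv_D2on:
  assumes "D2on W \<phi> g H" "(x, t) \<in> W"
  shows "time_deriv \<phi> x t = snd (g (x, t))"
proof -
  have "((\<lambda>s. (x, s)) has_derivative (\<lambda>h. (0, h))) (at t)" by (auto intro!: derivative_eq_intros)
  moreover have "(\<phi> has_derivative (\<lambda>k. g (x, t) \<bullet> k)) (at (x, t))" using assms by (auto simp: D2on_def)
  ultimately have "((\<lambda>s. \<phi> (x, s)) has_derivative (\<lambda>h. g (x, t) \<bullet> (0, h))) (at t)"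
    using has_derivative_compose by blast
  then have "((\<lambda>s. \<phi> (x, s)) has_real_derivative snd (g (x, t))) (at t)"
    by (simp add: has_field_derivative_def inner_prod_def)
  then show ?thesis by (simp add: time_deriv_def DERIV_imp_deriv)
qed

text \<open>The outer derivative in \<open>laplacian\<close> acts on a function that is itself a
  derivative, so the inner formula must hold for all \<open>y\<close> near \<open>x\<close>; the
  product neighbourhood inside \<open>W\<close> provides this.\<close>

lemma space_laplacian_D2on:
  assumes d: "D2on W \<phi> g H" and W: "(x, t) \<in> W" "open W"
  shows "space_laplacian \<phi> x t = lap (H (x, t))"
proof -
  obtain A B where AB: "open A" "open B" "x \<in> A" "t \<in> B" "A \<times> B \<subseteq> W"
    using W by (metis mem_Sigma_iff open_prod_elim)
  have e: "((\<lambda>y. (y, t)) has_derivative (\<lambda>h. (h, 0))) (at y)" for y by (auto intro!: derivative_eq_intros)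
  have 1: "frechet_derivative (\<lambda>y. \<phi> (y, t)) (at y) i = g (y, t) \<bullet> (i, 0)" if "y \<in> A" for y i
  proof -
    have "(\<phi> has_derivative (\<lambda>k. g (y, t) \<bullet> k)) (at (y, t))" using d that AB by (auto simp: D2on_def)
    from has_derivative_compose[OF e this]
    have "((\<lambda>y. \<phi> (y, t)) has_derivative (\<lambda>h. g (y, t) \<bullet> (h, 0))) (at y)" .
    then show ?thesis using frechet_derivative_at by metis
  qed
  have 2: "frechet_derivative (\<lambda>y. frechet_derivative (\<lambda>y. \<phi> (y, t)) (at y) i) (at x) i = H (x, t) (i, 0) \<bullet> (i, 0)" for i
  proof -
    have "(g has_derivative H (x, t)) (at (x, t))" using d W by (auto simp: D2on_def)
    from has_derivative_compose[OF e this]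
    have "((\<lambda>y. g (y, t)) has_derivative (\<lambda>h. H (x, t) (h, 0))) (at x)" .
    then have "((\<lambda>y. g (y, t) \<bullet> (i, 0)) has_derivative (\<lambda>h. H (x, t) (h, 0) \<bullet> (i, 0))) (at x)"
      by (rule has_derivative_inner_left)
    then have "((\<lambda>y. frechet_derivative (\<lambda>y. \<phi> (y, t)) (at y) i) has_derivative (\<lambda>h. H (x, t) (h, 0) \<bullet> (i, 0))) (at x)"
      by (rule has_derivative_transform_within_open[OF _ AB(1) AB(3)]) (simp add: 1)
    then show ?thesis using frechet_derivative_at by metis
  qed
  show ?thesis by (simp add: space_laplacian_def laplacian_def lap_def 2)
qed

text \<open>Cylinders form a neighbourhood base, so the cylinder may be shrunk until it lies in the
  domain; the property is then the purely local one that \<open>vsub\<close> uses.\<close>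

lemma local_max_at_iff:
  assumes \<Omega>: "open \<Omega>" and p: "x \<in> \<Omega>" "t \<in> {0<..<T}"
  shows "local_max_at \<Omega> T w x t \<longleftrightarrow> (\<forall>\<^sub>F q in nhds (x, t). w q \<le> w (x, t))"
proof
  assume "local_max_at \<Omega> T w x t"
  then obtain \<delta> where "\<delta> > 0" "\<forall>p \<in> ball x \<delta> \<times> {t - \<delta><..<t + \<delta>}. w p \<le> w (x, t)"
    unfolding local_max_at_def by blast
  then show "\<forall>\<^sub>F q in nhds (x, t). w q \<le> w (x, t)"
    unfolding eventually_nhds
    by (intro exI[of _ "ball x \<delta> \<times> {t - \<delta><..<t + \<delta>}"]) (auto intro!: open_Times)
next
  assume "\<forall>\<^sub>F q in nhds (x, t). w q \<le> w (x, t)"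
  then obtain S where S: "open S" "(x, t) \<in> S" "\<forall>q\<in>S. w q \<le> w (x, t)" by (auto simp: eventually_nhds)
  have "open (S \<inter> \<Omega> \<times> {0<..<T})" "(x, t) \<in> S \<inter> \<Omega> \<times> {0<..<T}"
    using S \<Omega> p by (auto intro!: open_Int open_Times)
  then obtain A B where AB: "open A" "open B" "x \<in> A" "t \<in> B" "A \<times> B \<subseteq> S \<inter> \<Omega> \<times> {0<..<T}"
    by (metis mem_Sigma_iff open_prod_elim)
  obtain d1 where d1: "d1 > 0" "ball x d1 \<subseteq> A" using AB open_contains_ball by blast
  obtain d2 where d2: "d2 > 0" "ball t d2 \<subseteq> B" using AB open_contains_ball by blast
  define \<delta> where "\<delta> = min d1 d2"
  have "ball x \<delta> \<times> {t - \<delta><..<t + \<delta>} \<subseteq> A \<times> B"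
    using d1 d2 by (auto simp: \<delta>_def subset_iff dist_real_def)
  then have "ball x \<delta> \<times> {t - \<delta><..<t + \<delta>} \<subseteq> S \<inter> \<Omega> \<times> {0<..<T}" using AB(5) by (rule order_trans)
  moreover have "\<delta> > 0" using d1 d2 by (simp add: \<delta>_def)
  ultimately have "\<delta> > 0 \<and> ball x \<delta> \<times> {t - \<delta><..<t + \<delta>} \<subseteq> \<Omega> \<times> {0<..<T} \<and>
     (\<forall>p \<in> ball x \<delta> \<times> {t - \<delta><..<t + \<delta>}. w p \<le> w (x, t))"
    using S(3) by blast
  then show "local_max_at \<Omega> T w x t" unfolding local_max_at_def by blast
qed

lemma local_min_at_iff: "local_min_at \<Omega> T w x t \<longleftrightarrow> local_max_at \<Omega> T (\<lambda>p. - w p) x t"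
  by (simp add: local_min_at_def local_max_at_def)

text \<open>In one direction quadratics are smooth and hence allowed as tests; in the other
  \<open>vsub_test\<close> replaces a smooth test function by quadratics.\<close>

lemma viscosity_subsolution_iff:
  assumes \<Omega>: "open \<Omega>" and F: "continuous_on UNIV F" "\<And>s. F s = b_coeff bm bp s * s"
  shows "viscosity_subsolution bm bp \<Omega> T u \<longleftrightarrow> bounded (u ` (closure \<Omega> \<times> {0..T}))
     \<and> usc_on (closure \<Omega> \<times> {0..T}) u \<and> vsub F (\<Omega> \<times> {0<..<T}) u"
    (is "?L \<longleftrightarrow> ?R")
proof
  have W: "open (\<Omega> \<times> {0<..<T})" using \<Omega> by (auto intro: open_Times)
  {
    assume L: ?L
    have "vsub F (\<Omega> \<times> {0<..<T}) u"
      unfolding vsub_def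
    proof (intro ballI allI impI)
      fix p a and A :: "'a \<times> real \<Rightarrow> 'a \<times> real"
      assume p: "p \<in> \<Omega> \<times> {0<..<T}" and A: "linear A" and t: "\<forall>\<^sub>F q in nhds p. u q \<le> quad (u p) a A p q"
      obtain x t where p': "p = (x, t)" by (cases p)
      have q0: "quad (u p) a A p p = u p" by (simp add: quad_def linear_0[OF A])
      note D2 = D2on_quad[OF A, of "\<Omega> \<times> {0<..<T}" "u p" a p]
      have "local_max_at \<Omega> T (\<lambda>q. u q - quad (u p) a A p q) x t"
        using p t q0 by (subst local_max_at_iff[OF \<Omega>]) (auto simp: p')
      then have "F (time_deriv (quad (u p) a A p) x t) - space_laplacian (quad (u p) a A p) x t \<le> 0"
        using L smooth_on_quad[OF A] p unfolding viscosity_subsolution_def F(2) by (simp add: p')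
      moreover have "adjoint A 0 = 0" using adjoint_linear[OF A] linear_0 by blast
      then have "time_deriv (quad (u p) a A p) x t = snd a"
        using time_deriv_D2on[OF D2, of x t] p by (simp add: p' linear_0[OF A])
      moreover have "space_laplacian (quad (u p) a A p) x t = lap A"
        using space_laplacian_D2on[OF D2 _ W, of x t] p by (simp only: p' lap_adjoint[OF A])
      ultimately show "F (snd a) \<le> lap A" by simp
    qed
    then show ?R using L by (simp add: viscosity_subsolution_def)
  next
    assume R: ?R
    have "b_coeff bm bp (time_deriv \<phi> x t) * time_deriv \<phi> x t - space_laplacian \<phi> x t \<le> 0"
      if s: "smooth_on (\<Omega> \<times> {0<..<T}) \<phi>" and p: "x \<in> \<Omega>" "t \<in> {0<..<T}"
        and m: "local_max_at \<Omega> T (\<lambda>p. u p - \<phi> p) x t" for \<phi> x t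
    proof -
      have pW: "(x, t) \<in> \<Omega> \<times> {0<..<T}" using p by auto
      obtain g H where d: "D2on (\<Omega> \<times> {0<..<T}) \<phi> g H" by (rule smooth_on_D2on[OF s])
      have vs: "vsub F (\<Omega> \<times> {0<..<T}) u" using R by simp
      have "F (snd (g (x, t))) \<le> lap (H (x, t))"
        by (rule vsub_test[OF F(1) vs pW W pW d]) (use m in \<open>simp only: local_max_at_iff[OF \<Omega> p]\<close>)
      then show ?thesis
        by (simp add: time_deriv_D2on[OF d pW] space_laplacian_D2on[OF d pW W] F(2)[symmetric])
    qed
    then show ?L using R by (simp add: viscosity_subsolution_def)
  }
qed

lemma smooth_on_uminus_quad: "linear A \<Longrightarrow> smooth_on S (\<lambda>q. - quad c a A p q)"
proof -
  assume "linear A"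
  then have "smooth_on S (quad (- c) (- a) (\<lambda>k. - A k) p)"
    by (intro smooth_on_quad linear_compose_neg)
  moreover have "quad (- c) (- a) (\<lambda>k. - A k) p = (\<lambda>q. - quad c a A p q)"
    unfolding quad_def fun_eq_iff by (simp only: inner_minus_left) simp
  ultimately show "smooth_on S (\<lambda>q. - quad c a A p q)" by simp
qed

text \<open>Reflection turns supersolutions for \<open>F\<close> into subsolutions for s \<mapsto> -
  F (- s). With \<open>F\<close> the larger of two linear fluxes, the reflected flux is the smaller
  one. All later arguments can so be phrased for \<open>vsub\<close>.\<close>

lemma viscosity_supersolution_iff:
  assumes \<Omega>: "open \<Omega>" and F: "continuous_on UNIV F" "\<And>s. F s = b_coeff bm bp s * s"
  shows "viscosity_supersolution bm bp \<Omega> T u \<longleftrightarrow> bounded (u ` (closure \<Omega> \<times> {0..T}))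
     \<and> usc_on (closure \<Omega> \<times> {0..T}) (\<lambda>p. - u p) \<and> vsub (\<lambda>s. - F (- s)) (\<Omega> \<times> {0<..<T}) (\<lambda>p. - u p)"
    (is "?L \<longleftrightarrow> ?R")
proof
  have W: "open (\<Omega> \<times> {0<..<T})" using \<Omega> by (auto intro: open_Times)
  {
    assume L: ?L
    have "vsub (\<lambda>s. - F (- s)) (\<Omega> \<times> {0<..<T}) (\<lambda>p. - u p)"
      unfolding vsub_def
    proof (intro ballI allI impI)
      fix p a and A :: "'a \<times> real \<Rightarrow> 'a \<times> real"
      assume p: "p \<in> \<Omega> \<times> {0<..<T}" and A: "linear A" and t: "\<forall>\<^sub>F q in nhds p. - u q \<le> quad (- u p) a A p q"
      obtain x t where p': "p = (x, t)" by (cases p)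
      have q0: "quad (- u p) a A p p = - u p" by (simp add: quad_def linear_0[OF A])
      note D2 = D2on_minus[OF D2on_quad[OF A, of "\<Omega> \<times> {0<..<T}" "- u p" a p]]
      have "local_min_at \<Omega> T (\<lambda>q. u q - - quad (- u p) a A p q) x t"
        unfolding local_min_at_iff
      proof (subst local_max_at_iff[OF \<Omega>])
        show "x \<in> \<Omega>" "t \<in> {0<..<T}" using p by (auto simp: p')
        show "\<forall>\<^sub>F q in nhds (x, t). - (u q - - quad (- u p) a A p q) \<le> - (u (x, t) - - quad (- u p) a A p (x, t))"
          using t unfolding p'[symmetric] q0 by eventually_elim simp
      qed
      then have "F (time_deriv (\<lambda>q. - quad (- u p) a A p q) x t) - space_laplacian (\<lambda>q. - quad (- u p) a A p q) x t \<ge> 0"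
        using L smooth_on_uminus_quad[OF A] p unfolding viscosity_supersolution_def F(2) by (simp add: p')
      moreover have "adjoint A 0 = 0" using adjoint_linear[OF A] linear_0 by blast
      then have "time_deriv (\<lambda>q. - quad (- u p) a A p q) x t = - snd a"
        using time_deriv_D2on[OF D2, of x t] p by (simp add: p' linear_0[OF A])
      moreover have "space_laplacian (\<lambda>q. - quad (- u p) a A p q) x t = - lap A"
        using space_laplacian_D2on[OF D2 _ W, of x t] p by (simp only: p' lap_adjoint[OF A] lap_minus)
      ultimately show "- F (- snd a) \<le> lap A" by simp
    qed
    then show ?R using L by (simp add: viscosity_supersolution_def lsc_iff)
  next
    assume R: ?R
    have F': "continuous_on UNIV (\<lambda>s. - F (- s))"
      by (intro continuous_intros continuous_on_compose2[OF F(1)]) auto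
    have "b_coeff bm bp (time_deriv \<phi> x t) * time_deriv \<phi> x t - space_laplacian \<phi> x t \<ge> 0"
      if s: "smooth_on (\<Omega> \<times> {0<..<T}) \<phi>" and p: "x \<in> \<Omega>" "t \<in> {0<..<T}"
        and m: "local_min_at \<Omega> T (\<lambda>p. u p - \<phi> p) x t" for \<phi> x t
    proof -
      have pW: "(x, t) \<in> \<Omega> \<times> {0<..<T}" using p by auto
      obtain g H where d: "D2on (\<Omega> \<times> {0<..<T}) \<phi> g H" by (rule smooth_on_D2on[OF s])
      have m': "\<forall>\<^sub>F q in nhds (x, t). - u q - - \<phi> q \<le> - u (x, t) - - \<phi> (x, t)"
        using m unfolding local_min_at_iff local_max_at_iff[OF \<Omega> p] by eventually_elim simp
      have vs: "vsub (\<lambda>s. - F (- s)) (\<Omega> \<times> {0<..<T}) (\<lambda>p. - u p)" using R by simp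
      have "- F (- snd (- g (x, t))) \<le> lap (\<lambda>k. - H (x, t) k)"
        by (rule vsub_test[OF F' vs pW W pW D2on_minus[OF d] m'])
      then show ?thesis
        by (simp add: time_deriv_D2on[OF d pW] space_laplacian_D2on[OF d pW W] F(2)[symmetric] lap_minus)
    qed
    then show ?L using R by (simp add: viscosity_supersolution_def lsc_iff)
  }
qed

section \<open>Sup-convolution\<close>

text \<open>The penalty is the cone \<open>n * dist\<close> and not a squared distance: Lipschitz
  continuity is all that is wanted of \<open>f\<close>, and a cone gives it with constant
  \<open>n\<close> on the whole space. A maximiser for a point of \<open>D\<close> lies within
  \<open>R / n\<close> of it. Translation by the vector from the point to its maximiser leaves the
  penalty unchanged, so a test for \<open>f\<close> becomes a test for \<open>u\<close> with the
  same derivatives.\<close>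

lemma sup_convolution:
  fixes u :: "'a::euclidean_space \<times> real \<Rightarrow> real"
  assumes D: "compact D" "D \<noteq> {}" and usc: "usc_on D u" and u: "\<And>q. q \<in> D \<Longrightarrow> 1 \<le> u q \<and> u q \<le> R"
    and n: "n > 0" and W: "open W" "W \<subseteq> D" and v: "vsub F W u"
  obtains f where "\<And>p. 0 \<le> f p" "\<And>p. f p \<le> R" "\<And>p q. \<bar>f p - f q\<bar> \<le> n * dist p q"
    "\<exists>B. \<forall>p. B < norm p \<longrightarrow> f p = 0" "\<And>p. p \<in> D \<Longrightarrow> u p \<le> f p"
    "\<And>p. p \<in> D \<Longrightarrow> \<exists>q\<in>D. dist p q \<le> R / n \<and> f p \<le> u q"
    "vsub F {p. cball p (R / n) \<subseteq> W} f"
proof -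
  have "\<exists>q\<in>D. \<forall>y\<in>D. u y - n * dist p y \<le> u q - n * dist p q" for p
    by (rule usc_on_attains_max[OF D]) (intro usc_on_diff usc continuous_intros)
  then obtain m where m: "\<And>p. m p \<in> D" "\<And>p y. y \<in> D \<Longrightarrow> u y - n * dist p y \<le> u (m p) - n * dist p (m p)"
    by metis
  define s where "s p = u (m p) - n * dist p (m p)" for p
  \<comment> \<open>On \<open>D\<close> the cut at 0 has no effect, as \<open>u\<close> is at least
    1 there. Far away it makes \<open>f\<close> vanish, so that \<open>f\<close> can be integrated
    against kernels on the whole space.\<close>
  define f where "f p = max 0 (s p)" for p
  have R: "R \<ge> 1" using u D by fastforce
  have sle: "u y - n * dist p y \<le> s p" if "y \<in> D" for p y using m that by (simp add: s_def)
  have sR: "s p \<le> R" for p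
  proof -
    have "0 \<le> n * dist p (m p)" using n by simp
    then show ?thesis using u[OF m(1)[of p]] by (simp add: s_def)
  qed
  have lip1: "s p - s q \<le> n * dist p q" for p q
  proof -
    have "dist q (m p) \<le> dist p (m p) + dist p q" by (metis dist_commute dist_triangle2 add.commute)
    then have "n * dist q (m p) \<le> n * dist p (m p) + n * dist p q"
      using n by (metis mult_left_mono distrib_left less_imp_le)
    then show ?thesis using sle[OF m(1)[of p], of q] by (simp add: s_def[of p])
  qed
  have lip: "\<bar>f p - f q\<bar> \<le> n * dist p q" for p q
    using lip1[of p q] lip1[of q p] by (auto simp: f_def dist_commute max_def)
  have pos: "s p = f p" "u p \<le> f p" if "p \<in> D" for p
    using sle[OF that, of p] u[OF that] by (auto simp: f_def)
  have near: "dist p (m p) \<le> R / n" "f p \<le> u (m p)" if "p \<in> D" for p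
  proof -
    have "n * dist p (m p) \<le> R" using u[OF m(1)[of p]] u[OF that] pos[OF that] by (simp add: s_def)
    then show "dist p (m p) \<le> R / n" using n by (simp add: field_simps)
    have "0 \<le> n * dist p (m p)" using n by simp
    then show "f p \<le> u (m p)" using pos[OF that] by (simp add: s_def)
  qed
  obtain B where B: "\<And>q. q \<in> D \<Longrightarrow> norm q \<le> B" using compact_imp_bounded[OF D(1)] bounded_iff by metis
  show ?thesis
  proof
    show "0 \<le> f p" "f p \<le> R" for p using sR R by (auto simp: f_def)
    show "\<bar>f p - f q\<bar> \<le> n * dist p q" for p q by (rule lip)
    show "\<exists>B. \<forall>p. B < norm p \<longrightarrow> f p = 0"
    proof (intro exI[of _ "B + R / n"] allI impI)
      fix p :: "'a \<times> real" assume p: "B + R / n < norm p"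
      have "norm p \<le> norm (m p) + dist p (m p)" by (metis dist_norm norm_triangle_sub)
      then have "R / n < dist p (m p)" using B[OF m(1)[of p]] p by linarith
      then have "R < n * dist p (m p)" using n by (simp add: field_simps)
      then show "f p = 0" using u[OF m(1)[of p]] by (simp add: f_def s_def)
    qed
    show "u p \<le> f p" if "p \<in> D" for p by (rule pos[OF that])
    show "\<exists>q\<in>D. dist p q \<le> R / n \<and> f p \<le> u q" if "p \<in> D" for p
      using near[OF that] m(1) by blast
    show "vsub F {p. cball p (R / n) \<subseteq> W} f"
      unfolding vsub_def
    proof (intro ballI allI impI)
      fix p a and A :: "'a \<times> real \<Rightarrow> 'a \<times> real"
      assume p: "p \<in> {p. cball p (R / n) \<subseteq> W}" and A: "linear A"
        and t: "\<forall>\<^sub>F p' in nhds p. f p' \<le> quad (f p) a A p p'"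
      have "0 \<le> R / n" using R n by simp
      then have "p \<in> W" using p by (intro subsetD[of "cball p (R / n)" W]) (auto simp del: split_paired_All)
      then have pD: "p \<in> D" using W by auto
      \<comment> \<open>The test at \<open>p\<close> is moved to the maximiser \<open>q\<close>. In
        the competition for the shifted point p + (q' - q) the candidate \<open>q'\<close> pays the
        same penalty as \<open>q\<close> pays for \<open>p\<close>.\<close>
      define q where "q = m p"
      have q: "q \<in> W" using near(1)[OF pD] p by (auto simp: q_def)
      have "((\<lambda>q'. p + (q' - q)) \<longlongrightarrow> p + (q - q)) (nhds q)"
        by (intro tendsto_intros filterlim_ident)
      then have "\<forall>\<^sub>F q' in nhds q. f (p + (q' - q)) \<le> quad (f p) a A p (p + (q' - q))"
        using t by (auto simp: filterlim_iff)
      moreover have "\<forall>\<^sub>F q' in nhds q. q' \<in> W" by (rule eventually_nhds_in_open[OF W(1) q])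
      ultimately have "\<forall>\<^sub>F q' in nhds q. u q' \<le> quad (u q) a A q q'"
      proof eventually_elim
        case (elim q')
        have "u q' - n * dist (p + (q' - q)) q' \<le> s (p + (q' - q))" using sle elim W by blast
        also have "\<dots> \<le> f (p + (q' - q))" by (simp add: f_def)
        also have "\<dots> \<le> quad (f p) a A p (p + (q' - q))" by (rule elim)
        also have "\<dots> = quad (u q) a A q q' - n * dist p q"
          using pos(1)[OF pD] by (simp add: quad_def s_def q_def)
        finally show ?case by (simp add: dist_norm)
      qed
      then show "F (snd a) \<le> lap A" using v q A unfolding vsub_def by blast
    qed
  qed
qed

section \<open>The heat kernel\<close>

text \<open>Lebesgue measure is the image of a product measure under the coordinate expansion, so
  integrals of products of one-variable functions factor. All Gaussian moments come from
  here.\<close>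

lemma lborel_integral_prod:
  fixes h :: "'a::euclidean_space \<Rightarrow> real \<Rightarrow> real"
  assumes h: "\<And>i. i \<in> Basis \<Longrightarrow> integrable lborel (h i)"
  shows "integrable lborel (\<lambda>x::'a. \<Prod>i\<in>Basis. h i (x \<bullet> i))"
    "(\<integral>x. (\<Prod>i\<in>Basis. h i (x \<bullet> i)) \<partial>lborel) = (\<Prod>i\<in>Basis. \<integral>t. h i t \<partial>lborel)"
proof -
  interpret product_sigma_finite "\<lambda>_::'a. lborel :: real measure" ..
  have l: "(lborel :: 'a measure) = distr (Pi\<^sub>M Basis (\<lambda>_. lborel)) borel (\<lambda>f. \<Sum>b\<in>Basis. f b *\<^sub>R b)"
    unfolding lborel_def[where 'a='a] lborel_eq_real ..
  have [measurable]: "h i \<in> borel_measurable borel" if "i \<in> Basis" for i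
    using borel_measurable_integrable[OF h[OF that]] by simp
  have T: "(\<lambda>f. \<Sum>b\<in>Basis. f b *\<^sub>R b) \<in> Pi\<^sub>M Basis (\<lambda>_. lborel::real measure) \<rightarrow>\<^sub>M (borel :: 'a measure)"
    by measurable
  have P: "(\<lambda>x::'a. \<Prod>i\<in>Basis. h i (x \<bullet> i)) \<in> borel_measurable borel"
    by measurable
  have e: "(\<Prod>i\<in>Basis. h i ((\<Sum>b\<in>Basis. f b *\<^sub>R b) \<bullet> i)) = (\<Prod>i\<in>Basis. h i (f i))" for f :: "'a \<Rightarrow> real"
    by (intro prod.cong refl) simp
  show "integrable lborel (\<lambda>x::'a. \<Prod>i\<in>Basis. h i (x \<bullet> i))"
    unfolding l by (subst integrable_distr_eq[OF T P]) (simp only: e, rule product_integrable_prod[OF _ h], auto)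
  show "(\<integral>x. (\<Prod>i\<in>Basis. h i (x \<bullet> i)) \<partial>lborel) = (\<Prod>i\<in>Basis. \<integral>t. h i t \<partial>lborel)"
    unfolding l by (subst integral_distr[OF T P]) (simp only: e, rule product_integral_prod[OF _ h], auto)
qed

text \<open>The fundamental solution of b u_t = lap u at time \<open>s\<close>: independent centred
  normal coordinates of variance 2 s / b, written as a product so that one-dimensional moments
  apply.\<close>

definition heatk :: "real \<Rightarrow> real \<Rightarrow> 'a::euclidean_space \<Rightarrow> real"
  where "heatk b s y = (\<Prod>i\<in>Basis. normal_density 0 (sqrt (2 * s / b)) (y \<bullet> i))"

lemma heatk_nonneg: "0 \<le> heatk b s y"
  by (simp add: heatk_def prod_nonneg)

lemma heatk_uminus: "heatk b s (- y) = heatk b s y"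
  by (simp add: heatk_def normal_density_def)

lemma heatk_measurable [measurable]: "heatk b s \<in> borel_measurable borel"
  unfolding heatk_def[abs_def] by measurable

context
  fixes b s :: real
  assumes bs: "0 < b" "0 < s"
begin

lemma heatk_monomial:
  fixes e :: "'a::euclidean_space \<Rightarrow> nat"
  shows "integrable lborel (\<lambda>y::'a. heatk b s y * (\<Prod>i\<in>Basis. (y \<bullet> i) ^ e i))"
    "(\<integral>y. heatk b s y * (\<Prod>i\<in>Basis. (y \<bullet> i) ^ e i) \<partial>lborel)
      = (\<Prod>i\<in>(Basis::'a set). \<integral>t. normal_density 0 (sqrt (2 * s / b)) t * t ^ e i \<partial>lborel)"
  using lborel_integral_prod[of "\<lambda>i t. normal_density 0 (sqrt (2 * s / b)) t * t ^ e i"]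
    integrable_normal_moment[of "sqrt (2 * s / b)" 0] bs
  by (simp_all add: heatk_def prod.distrib)

lemma normal_moments:
  "(\<integral>t. normal_density 0 (sqrt (2 * s / b)) t * t ^ 0 \<partial>lborel) = 1"
  "(\<integral>t. normal_density 0 (sqrt (2 * s / b)) t * t ^ 1 \<partial>lborel) = 0"
  "(\<integral>t. normal_density 0 (sqrt (2 * s / b)) t * t ^ 2 \<partial>lborel) = 2 * s / b"
  "(\<integral>t. normal_density 0 (sqrt (2 * s / b)) t * t ^ 4 \<partial>lborel) = 12 * s\<^sup>2 / b\<^sup>2"
  using integral_normal_density[of "sqrt (2 * s / b)" 0]
    normal_moment_odd[of "sqrt (2 * s / b)" 0 0]
    normal_moment_even[of "sqrt (2 * s / b)" 0 1]
    normal_moment_even[of "sqrt (2 * s / b)" 0 2] bs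
  by (auto dest!: has_bochner_integral_integral_eq simp: eval_nat_numeral fact_numeral field_simps)

lemma heatk_0: "integrable lborel (heatk b s :: 'a::euclidean_space \<Rightarrow> real)"
    "(\<integral>y. heatk b s (y :: 'a::euclidean_space) \<partial>lborel) = 1"
  using heatk_monomial[of "\<lambda>_. 0"] normal_moments(1) by simp_all

lemma prod_Basis_one: "i \<in> (Basis :: 'a::euclidean_space set) \<Longrightarrow>
    (\<Prod>j\<in>Basis. (y \<bullet> j) ^ (if j = i then n else 0)) = (y \<bullet> i) ^ n"
  by (simp add: if_distrib[of "\<lambda>n. _ ^ n"] prod.delta cong: if_cong)

lemma heatk_pow:
  fixes i :: "'a::euclidean_space"
  assumes i: "i \<in> Basis"
  shows "integrable lborel (\<lambda>y. heatk b s y * (y \<bullet> i) ^ n)"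
    "(\<integral>y. heatk b s y * (y \<bullet> i) ^ n \<partial>lborel) = (\<integral>t. normal_density 0 (sqrt (2 * s / b)) t * t ^ n \<partial>lborel)"
proof -
  show "integrable lborel (\<lambda>y. heatk b s y * (y \<bullet> i) ^ n)"
    using heatk_monomial(1)[of "\<lambda>j. if j = i then n else 0"] by (simp add: prod_Basis_one[OF i])
  have "(\<Prod>j\<in>(Basis::'a set). \<integral>t. normal_density 0 (sqrt (2 * s / b)) t * t ^ (if j = i then n else 0) \<partial>lborel)
    = (\<Prod>j\<in>(Basis::'a set). if j = i then (\<integral>t. normal_density 0 (sqrt (2 * s / b)) t * t ^ n \<partial>lborel) else 1)"
    using normal_moments(1) by (intro prod.cong) auto
  also have "\<dots> = (\<integral>t. normal_density 0 (sqrt (2 * s / b)) t * t ^ n \<partial>lborel)"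
    using i by (simp add: prod.delta)
  finally show "(\<integral>y. heatk b s y * (y \<bullet> i) ^ n \<partial>lborel) = (\<integral>t. normal_density 0 (sqrt (2 * s / b)) t * t ^ n \<partial>lborel)"
    using heatk_monomial(2)[of "\<lambda>j. if j = i then n else 0"] by (simp only: prod_Basis_one[OF i])
qed

lemma heatk_off:
  fixes i j :: "'a::euclidean_space"
  assumes i: "i \<in> Basis" "j \<in> Basis" "i \<noteq> j"
  shows "integrable lborel (\<lambda>y. heatk b s y * ((y \<bullet> i) * (y \<bullet> j)))"
    "(\<integral>y. heatk b s y * ((y \<bullet> i) * (y \<bullet> j)) \<partial>lborel) = 0"
proof -
  have p: "(\<Prod>k\<in>Basis. (y \<bullet> k) ^ (if k = i \<or> k = j then 1 else 0)) = (y \<bullet> i) * (y \<bullet> j)" for y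
  proof -
    have "(\<Prod>k\<in>Basis. (y \<bullet> k) ^ (if k = i \<or> k = j then 1 else 0)) = (\<Prod>k\<in>{i,j}. (y \<bullet> k))"
      using i by (intro prod.mono_neutral_cong_right) auto
    then show ?thesis using i by simp
  qed
  show "integrable lborel (\<lambda>y. heatk b s y * ((y \<bullet> i) * (y \<bullet> j)))"
    using heatk_monomial(1)[of "\<lambda>k. if k = i \<or> k = j then 1 else 0"] by (simp only: p)
  have "(\<Prod>k\<in>(Basis::'a set). \<integral>t. normal_density 0 (sqrt (2 * s / b)) t * t ^ (if k = i \<or> k = j then 1 else 0) \<partial>lborel) = 0"
    using normal_moments(2) i by (intro prod_zero) auto
  then show "(\<integral>y. heatk b s y * ((y \<bullet> i) * (y \<bullet> j)) \<partial>lborel) = 0"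
    using heatk_monomial(2)[of "\<lambda>k. if k = i \<or> k = j then 1 else 0"] by (simp only: p)
qed

lemma heatk_1:
  fixes a :: "'a::euclidean_space"
  shows "integrable lborel (\<lambda>y. heatk b s y * (a \<bullet> y))" "(\<integral>y. heatk b s y * (a \<bullet> y) \<partial>lborel) = 0"
proof -
  have e: "heatk b s y * (a \<bullet> y) = (\<Sum>i\<in>Basis. (a \<bullet> i) * (heatk b s y * (y \<bullet> i) ^ 1))" for y
    by (subst euclidean_inner) (simp add: sum_distrib_left algebra_simps)
  have i: "integrable lborel (\<lambda>y. (a \<bullet> i) * (heatk b s y * (y \<bullet> i) ^ 1))" if "i \<in> Basis" for i
    by (intro integrable_mult_right heatk_pow that)
  show "integrable lborel (\<lambda>y. heatk b s y * (a \<bullet> y))"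
    unfolding e by (intro Bochner_Integration.integrable_sum i)
  have "(\<integral>y. heatk b s y * (a \<bullet> y) \<partial>lborel) = (\<Sum>i\<in>Basis. (a \<bullet> i) * (\<integral>y. heatk b s y * (y \<bullet> i) ^ 1 \<partial>lborel))"
    unfolding e by (subst Bochner_Integration.integral_sum[OF i]) (simp_all only: integral_mult_right_zero)
  also have "\<dots> = 0" by (intro sum.neutral ballI) (simp only: heatk_pow(2) normal_moments(2) mult_zero_right)
  finally show "(\<integral>y. heatk b s y * (a \<bullet> y) \<partial>lborel) = 0" .
qed

text \<open>Mixed second moments vanish and the diagonal ones all equal 2 s / b, so a quadratic form
  is averaged to its trace. This is how the Laplacian arises from Gaussian means.\<close>

lemma heatk_2:
  fixes A :: "'a::euclidean_space \<Rightarrow> 'a"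
  assumes A: "linear A"
  shows "integrable lborel (\<lambda>y. heatk b s y * (A y \<bullet> y))"
    "(\<integral>y. heatk b s y * (A y \<bullet> y) \<partial>lborel) = 2 * s / b * (\<Sum>i\<in>Basis. A i \<bullet> i)"
proof -
  have Ay: "A y \<bullet> y = (\<Sum>i\<in>Basis. \<Sum>j\<in>Basis. (A i \<bullet> j) * ((y \<bullet> i) * (y \<bullet> j)))" for y
  proof -
    have "A y = (\<Sum>i\<in>Basis. (y \<bullet> i) *\<^sub>R A i)"
      by (subst euclidean_representation[of y, symmetric]) (simp add: linear_sum[OF A] linear_cmul[OF A])
    then have "A y \<bullet> y = (\<Sum>i\<in>Basis. (y \<bullet> i) * (A i \<bullet> y))" by (simp add: inner_sum_left)
    also have "\<dots> = (\<Sum>i\<in>Basis. \<Sum>j\<in>Basis. (A i \<bullet> j) * ((y \<bullet> i) * (y \<bullet> j)))"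
      by (intro sum.cong refl, subst euclidean_inner) (simp add: sum_distrib_left algebra_simps)
    finally show ?thesis .
  qed
  have e: "heatk b s y * (A y \<bullet> y) = (\<Sum>i\<in>Basis. \<Sum>j\<in>Basis. (A i \<bullet> j) * (heatk b s y * ((y \<bullet> i) * (y \<bullet> j))))" for y
    unfolding Ay by (simp add: sum_distrib_left algebra_simps)
  have i: "integrable lborel (\<lambda>y. heatk b s y * ((y \<bullet> i) * (y \<bullet> j)))"
    "(\<integral>y. heatk b s y * ((y \<bullet> i) * (y \<bullet> j)) \<partial>lborel) = (if i = j then 2 * s / b else 0)"
    if "i \<in> Basis" "j \<in> Basis" for i j :: 'a
    using heatk_off[OF that] heatk_pow[OF that(1), of 2] normal_moments(3)
    by (cases "i = j"; simp add: power2_eq_square)+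
  note i' = i(1)[THEN integrable_mult_right]
  show "integrable lborel (\<lambda>y. heatk b s y * (A y \<bullet> y))"
    unfolding e by (intro Bochner_Integration.integrable_sum i')
  have "(\<integral>y. heatk b s y * (A y \<bullet> y) \<partial>lborel)
    = (\<Sum>i\<in>Basis. \<Sum>j\<in>Basis. (A i \<bullet> j) * (\<integral>y. heatk b s y * ((y \<bullet> i) * (y \<bullet> j)) \<partial>lborel))"
    unfolding e
    by (subst Bochner_Integration.integral_sum, intro Bochner_Integration.integrable_sum i', assumption+,
        intro sum.cong refl, subst Bochner_Integration.integral_sum, intro i', assumption+)
       (simp only: integral_mult_right_zero)
  also have "\<dots> = (\<Sum>i\<in>Basis. \<Sum>j\<in>Basis. if i = j then (A i \<bullet> j) * (2 * s / b) else 0)"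
    by (intro sum.cong refl) (simp add: i)
  also have "\<dots> = 2 * s / b * (\<Sum>i\<in>Basis. A i \<bullet> i)"
    by (simp add: sum.delta' sum_distrib_left mult.commute sum_divide_distrib)
  finally show "(\<integral>y. heatk b s y * (A y \<bullet> y) \<partial>lborel) = 2 * s / b * (\<Sum>i\<in>Basis. A i \<bullet> i)" .
qed

lemma heatk_4:
  "integrable lborel (\<lambda>y::'a::euclidean_space. heatk b s y * (\<Sum>i\<in>Basis. (y \<bullet> i) ^ 4))"
  "(\<integral>y. heatk b s y * (\<Sum>i\<in>Basis. ((y::'a) \<bullet> i) ^ 4) \<partial>lborel) = 12 * DIM('a) * s\<^sup>2 / b\<^sup>2"
proof -
  note i = heatk_pow(1)[of _ 4]
  show "integrable lborel (\<lambda>y::'a. heatk b s y * (\<Sum>i\<in>Basis. (y \<bullet> i) ^ 4))"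
    unfolding sum_distrib_left by (intro Bochner_Integration.integrable_sum i)
  show "(\<integral>y. heatk b s y * (\<Sum>i\<in>Basis. ((y::'a) \<bullet> i) ^ 4) \<partial>lborel) = 12 * DIM('a) * s\<^sup>2 / b\<^sup>2"
    unfolding sum_distrib_left
    by (subst Bochner_Integration.integral_sum[OF i]) (simp_all add: heatk_pow(2) normal_moments(4))
qed

text \<open>Cauchy-Schwarz against the constant 1; it trades the fourth power of the norm for fourth
  powers of coordinates, whose moments are known.\<close>

lemma norm4_le: "(norm y) ^ 4 \<le> DIM('a) * (\<Sum>i\<in>Basis. ((y::'a::euclidean_space) \<bullet> i) ^ 4)"
proof -
  have "(norm y) ^ 4 = ((norm y)\<^sup>2)\<^sup>2" by simp
  also have "(norm y)\<^sup>2 = (\<Sum>i\<in>Basis. (y \<bullet> i)\<^sup>2)"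
    unfolding power2_norm_eq_inner by (subst euclidean_inner) (simp add: power2_eq_square)
  also have "(\<Sum>i\<in>Basis. (y \<bullet> i)\<^sup>2) = (\<Sum>i\<in>Basis. 1 * (y \<bullet> i)\<^sup>2)" by simp
  also have "(\<Sum>i\<in>Basis. 1 * (y \<bullet> i)\<^sup>2)\<^sup>2 \<le> (\<Sum>i\<in>(Basis::'a set). 1\<^sup>2) * (\<Sum>i\<in>Basis. ((y \<bullet> i)\<^sup>2)\<^sup>2)"
    by (rule Cauchy_Schwarz_ineq_sum)
  finally show ?thesis by simp
qed

text \<open>The quartic term lets a local second-order expansion be used globally: away from the
  centre a bounded function minus its Taylor polynomial is dominated by a multiple of |y|^4, whose
  Gaussian mean is only of order s^2. The constant 12 is 3 times the square of 2, from the fourth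
  moment of a normal variable of variance 2 s / b.\<close>

lemma heatk_taylor:
  fixes g :: "'a::euclidean_space \<Rightarrow> real"
  assumes g: "integrable lborel (\<lambda>y. heatk b s y * g y)" and A: "linear A" and C: "C \<ge> 0"
    and le: "\<And>y. g y \<le> c + a \<bullet> y + A y \<bullet> y / 2 + e * (norm y)\<^sup>2 + C * norm y ^ 4"
  shows "(\<integral>y. heatk b s y * g y \<partial>lborel) \<le> c + s / b * (\<Sum>i\<in>Basis. A i \<bullet> i)
    + 2 * e * DIM('a) * s / b + 12 * C * (DIM('a))\<^sup>2 * s\<^sup>2 / b\<^sup>2"
proof -
  have id: "linear (\<lambda>y::'a. y)" by (simp add: linear_id[unfolded id_def])
  define G where "G = (\<lambda>y::'a. heatk b s y * c + heatk b s y * (a \<bullet> y) + heatk b s y * (A y \<bullet> y) / 2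
      + e * (heatk b s y * (y \<bullet> y)) + C * DIM('a) * (heatk b s y * (\<Sum>i\<in>Basis. (y \<bullet> i) ^ 4)))"
  note ii = heatk_0(1) heatk_1(1) heatk_2(1)[OF A] heatk_2(1)[OF id] heatk_4(1)
  have "heatk b s y * g y \<le> G y" for y
  proof -
    have "C * norm y ^ 4 \<le> C * (DIM('a) * (\<Sum>i\<in>Basis. (y \<bullet> i) ^ 4))"
      using norm4_le C by (intro mult_left_mono) auto
    then have "g y \<le> c + a \<bullet> y + A y \<bullet> y / 2 + e * (y \<bullet> y) + C * (DIM('a) * (\<Sum>i\<in>Basis. (y \<bullet> i) ^ 4))"
      using le[of y] by (simp add: power2_norm_eq_inner)
    then have "heatk b s y * g y \<le> heatk b s y * (c + a \<bullet> y + A y \<bullet> y / 2 + e * (y \<bullet> y) + C * (DIM('a) * (\<Sum>i\<in>Basis. (y \<bullet> i) ^ 4)))"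
      by (intro mult_left_mono heatk_nonneg)
    also have "\<dots> = G y" by (simp add: G_def algebra_simps)
    finally show ?thesis .
  qed
  moreover have "integrable lborel G" unfolding G_def
    by (intro Bochner_Integration.integrable_add integrable_mult_right integrable_mult_left integrable_divide ii)
  ultimately have "(\<integral>y. heatk b s y * g y \<partial>lborel) \<le> (\<integral>y. G y \<partial>lborel)"
    by (intro integral_mono g)
  also have "\<dots> = c + 0 + (2 * s / b * (\<Sum>i\<in>Basis. A i \<bullet> i)) / 2 + e * (2 * s / b * (\<Sum>i\<in>(Basis::'a set). i \<bullet> i))
     + C * DIM('a) * (12 * DIM('a) * s\<^sup>2 / b\<^sup>2)"
    unfolding G_def
    apply (subst Bochner_Integration.integral_add, (intro Bochner_Integration.integrable_add integrable_mult_right integrable_mult_left integrable_divide ii)+)+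
    apply (simp only: integral_mult_right_zero integral_mult_left_zero integral_divide_zero heatk_0(2) heatk_1(2) heatk_2(2)[OF A] heatk_2(2)[OF id] heatk_4(2))
    done
  finally show ?thesis by (simp add: algebra_simps power2_eq_square)
qed

end

section \<open>Differentiation under the integral sign\<close>

lemma leibniz_convolution:
  fixes \<kappa> :: "'e::euclidean_space \<Rightarrow> 'c::euclidean_space" and \<iota> :: "'b::euclidean_space \<Rightarrow> 'e"
    and f :: "'b \<Rightarrow> real"
  assumes \<iota>: "continuous_on UNIV \<iota>" and f: "continuous_on (cbox l u) f"
    and U: "open U" "convex U" and UV: "\<And>p y. p \<in> U \<Longrightarrow> y \<in> cbox l u \<Longrightarrow> p - \<iota> y \<in> V"
    and d: "\<And>p. p \<in> V \<Longrightarrow> (\<kappa> has_derivative K p) (at p)" and c: "\<And>v. continuous_on V (\<lambda>p. K p v)"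
    and p: "p \<in> U"
  shows "((\<lambda>p. integral (cbox l u) (\<lambda>y. f y *\<^sub>R \<kappa> (p - \<iota> y))) has_derivative
      (\<lambda>k. integral (cbox l u) (\<lambda>y. f y *\<^sub>R K (p - \<iota> y) k))) (at p)"
    "(\<lambda>y. f y *\<^sub>R K (p - \<iota> y) k) integrable_on cbox l u"
proof -
  have cK: "continuous_on V \<kappa>"
    by (intro continuous_at_imp_continuous_on ballI) (rule has_derivative_continuous[OF d])
  have bl: "bounded_linear (K p)" if "p \<in> V" for p using d[OF that] by (rule has_derivative_bounded_linear)
  \<comment> \<open>The parametric differentiation rule wants the derivative as a continuous map
    into bounded operators; in finite dimension it is enough to have continuity on each fixed
    vector, which is what the hypothesis on \<open>K\<close> gives.\<close>
  define fx where "fx p y = f y *\<^sub>R Blinfun (K (p - \<iota> y))" for p y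
  have fxa: "blinfun_apply (fx p y) k = f y *\<^sub>R K (p - \<iota> y) k" if "p \<in> U" "y \<in> cbox l u" for p y k
    using bl[OF UV[OF that]] by (simp add: fx_def bounded_linear_Blinfun_apply blinfun.scaleR_left)
  have c2: "continuous_on (U \<times> cbox l u) (\<lambda>z. h (fst z - \<iota> (snd z)))" if "continuous_on V h"
    for h :: "'e \<Rightarrow> 'c"
    by (rule continuous_on_compose2[OF that])
      (auto intro!: continuous_intros continuous_on_compose2[OF \<iota>] UV)
  have c3: "continuous_on (cbox l u) (\<lambda>y. h (p - \<iota> y))" if "continuous_on V h" "p \<in> U"
    for h :: "'e \<Rightarrow> 'c" and p
    by (rule continuous_on_compose2[OF that(1)])
      (auto intro!: continuous_intros continuous_on_compose2[OF \<iota>] UV that(2))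
  have cf: "continuous_on (U \<times> cbox l u) (\<lambda>z. f (snd z))"
    by (rule continuous_on_compose2[OF f]) (auto intro!: continuous_intros)
  have cfx: "continuous_on (U \<times> cbox l u) (\<lambda>(p, y). fx p y)"
  proof (rule continuous_on_blinfun_componentwise)
    fix i :: 'e
    have "continuous_on (U \<times> cbox l u) (\<lambda>z. f (snd z) *\<^sub>R K (fst z - \<iota> (snd z)) i)"
      by (intro continuous_on_scaleR cf c2 c)
    then show "continuous_on (U \<times> cbox l u) (\<lambda>z. blinfun_apply (case z of (p, y) \<Rightarrow> fx p y) i)"
      by (rule continuous_on_eq) (auto simp: fxa)
  qed
  have "((\<lambda>p. integral (cbox l u) (\<lambda>y. f y *\<^sub>R \<kappa> (p - \<iota> y))) has_derivative
      integral (cbox l u) (fx p)) (at p within U)"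
  proof (rule leibniz_rule[OF _ _ cfx p U(2)])
    fix q y assume q: "q \<in> U" "y \<in> cbox l u"
    have "(\<kappa> has_derivative K (q - \<iota> y)) (at (q - \<iota> y))" by (rule d[OF UV[OF q]])
    moreover have "((\<lambda>p. p - \<iota> y) has_derivative (\<lambda>k. k)) (at q within U)"
      by (auto intro!: derivative_eq_intros)
    ultimately have "((\<lambda>p. \<kappa> (p - \<iota> y)) has_derivative K (q - \<iota> y)) (at q within U)"
      using has_derivative_compose[of "\<lambda>p. p - \<iota> y" "\<lambda>k. k" q U \<kappa> "K (q - \<iota> y)"] by blast
    then have "((\<lambda>p. f y *\<^sub>R \<kappa> (p - \<iota> y)) has_derivative (\<lambda>k. f y *\<^sub>R K (q - \<iota> y) k)) (at q within U)"
      by (rule has_derivative_scaleR_right)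
    moreover have "blinfun_apply (fx q y) = (\<lambda>k. f y *\<^sub>R K (q - \<iota> y) k)" using fxa[OF q] by auto
    ultimately show "((\<lambda>p. f y *\<^sub>R \<kappa> (p - \<iota> y)) has_derivative blinfun_apply (fx q y)) (at q within U)"
      by simp
  next
    fix q assume q: "q \<in> U"
    show "(\<lambda>y. f y *\<^sub>R \<kappa> (q - \<iota> y)) integrable_on cbox l u"
      by (intro integrable_continuous continuous_on_scaleR f c3[OF cK q])
  qed
  moreover have "at p within U = at p" using p U(1) by (rule at_within_open)
  moreover have "blinfun_apply (integral (cbox l u) (fx p)) k = integral (cbox l u) (\<lambda>y. f y *\<^sub>R K (p - \<iota> y) k)" for k
  proof -
    have "continuous_on (cbox l u) (\<lambda>y. (p, y))" by (intro continuous_intros)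
    then have "continuous_on (cbox l u) (fx p)"
      using continuous_on_compose2[OF cfx, of "cbox l u" "\<lambda>y. (p, y)"] p by auto
    then have "fx p integrable_on cbox l u" by (rule integrable_continuous)
    then have "integral (cbox l u) ((\<lambda>x. blinfun_apply x k) \<circ> fx p) = blinfun_apply (integral (cbox l u) (fx p)) k"
      by (intro integral_linear blinfun.bounded_linear_left)
    moreover have "integral (cbox l u) ((\<lambda>x. blinfun_apply x k) \<circ> fx p) = integral (cbox l u) (\<lambda>y. f y *\<^sub>R K (p - \<iota> y) k)"
      by (rule integral_cong) (simp add: fxa p)
    ultimately show ?thesis by simp
  qed
  ultimately show "((\<lambda>p. integral (cbox l u) (\<lambda>y. f y *\<^sub>R \<kappa> (p - \<iota> y))) has_derivative
      (\<lambda>k. integral (cbox l u) (\<lambda>y. f y *\<^sub>R K (p - \<iota> y) k))) (at p)"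
    by (auto intro: has_derivative_eq_rhs)
  show "(\<lambda>y. f y *\<^sub>R K (p - \<iota> y) k) integrable_on cbox l u"
    by (intro integrable_continuous continuous_on_scaleR f c3 c p)
qed

text \<open>The map \<iota> covers two uses: \<iota> y = (y, \<tau>) integrates over space at a
  fixed time and gives the heat flow, while the identity on space-time gives mollification. All
  derivatives fall on the kernel.\<close>

lemma D2on_convolution:
  fixes \<kappa> :: "'e::euclidean_space \<Rightarrow> real" and \<iota> :: "'b::euclidean_space \<Rightarrow> 'e"
    and f :: "'b \<Rightarrow> real"
  assumes \<iota>: "continuous_on UNIV \<iota>" and f: "continuous_on (cbox l u) f"
    and U: "open U" "convex U" and UV: "\<And>p y. p \<in> U \<Longrightarrow> y \<in> cbox l u \<Longrightarrow> p - \<iota> y \<in> V"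
    and d: "D2on V \<kappa> g H" and c: "\<And>v. continuous_on V (\<lambda>p. H p v)"
  shows "D2on U (\<lambda>p. integral (cbox l u) (\<lambda>y. f y * \<kappa> (p - \<iota> y)))
     (\<lambda>p. integral (cbox l u) (\<lambda>y. f y *\<^sub>R g (p - \<iota> y)))
     (\<lambda>p k. integral (cbox l u) (\<lambda>y. f y *\<^sub>R H (p - \<iota> y) k))"
  unfolding D2on_def
proof (intro ballI conjI)
  fix p assume p: "p \<in> U"
  have d1: "(\<kappa> has_derivative (\<lambda>k. g q \<bullet> k)) (at q)" "(g has_derivative H q) (at q)" if "q \<in> V" for q
    using d that by (auto simp: D2on_def)
  have cg: "continuous_on V g"
    by (intro continuous_at_imp_continuous_on ballI) (rule has_derivative_continuous[OF d1(2)])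
  have cg': "continuous_on V (\<lambda>p. g p \<bullet> v)" for v by (intro continuous_intros cg)
  have ig: "(\<lambda>y. f y *\<^sub>R g (p - \<iota> y)) integrable_on cbox l u"
    by (intro integrable_continuous continuous_on_scaleR f continuous_on_compose2[OF cg])
      (auto intro!: continuous_intros continuous_on_compose2[OF \<iota>] UV p)
  have i: "integral (cbox l u) (\<lambda>y. f y * (g (p - \<iota> y) \<bullet> k)) = integral (cbox l u) (\<lambda>y. f y *\<^sub>R g (p - \<iota> y)) \<bullet> k" for k
    using integral_linear[OF ig bounded_linear_inner_left[of k]] by (simp add: o_def)
  show "((\<lambda>p. integral (cbox l u) (\<lambda>y. f y * \<kappa> (p - \<iota> y))) has_derivative
      (\<bullet>) (integral (cbox l u) (\<lambda>y. f y *\<^sub>R g (p - \<iota> y)))) (at p)"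
    using leibniz_convolution(1)[OF \<iota> f U UV d1(1) cg' p] by (simp add: i)
  show "((\<lambda>p. integral (cbox l u) (\<lambda>y. f y *\<^sub>R g (p - \<iota> y))) has_derivative
      (\<lambda>k. integral (cbox l u) (\<lambda>y. f y *\<^sub>R H (p - \<iota> y) k))) (at p)"
    by (rule leibniz_convolution(1)[OF \<iota> f U UV d1(2) c p])
qed

lemma lap_integral:
  fixes H :: "'b::euclidean_space \<Rightarrow> 'a::euclidean_space \<times> real \<Rightarrow> 'a \<times> real"
  assumes "\<And>k. (\<lambda>y. H y k) integrable_on S"
  shows "lap (\<lambda>k. integral S (\<lambda>y. H y k)) = integral S (\<lambda>y. lap (H y))"
proof -
  have i: "integral S (\<lambda>y. H y k) \<bullet> v = integral S (\<lambda>y. H y k \<bullet> v)" "(\<lambda>y. H y k \<bullet> v) integrable_on S" for k v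
    using integral_linear[OF assms bounded_linear_inner_left[of v], of k]
      integrable_linear[OF assms bounded_linear_inner_left[of v], of k] by (simp_all add: o_def)
  show ?thesis unfolding lap_def i(1) by (subst integral_sum) (auto intro: i(2))
qed

text \<open>The normalising power of \<open>s\<close> is put into the exponent as a logarithm, so
  that the kernel is exp E and a single application of the chain rule differentiates it.\<close>

lemma heatk_exp:
  assumes "0 < b" "0 < s"
  shows "heatk b s (y :: 'a::euclidean_space)
    = exp (- (DIM('a) / 2) * ln (4 * pi * s / b) + (- b / (4 * s)) * (norm y)\<^sup>2)"
proof -
  have n: "normal_density 0 (sqrt (2 * s / b)) t = exp (- (1 / 2) * ln (4 * pi * s / b)) * exp ((- b / (4 * s)) * t\<^sup>2)" for t
  proof -
    have p: "4 * pi * s / b > 0" using assms by simp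
    have "exp (- (1 / 2) * ln (4 * pi * s / b)) = 1 / sqrt (4 * pi * s / b)"
      using p by (simp add: exp_minus ln_sqrt[symmetric] inverse_eq_divide)
    moreover have "(sqrt (2 * s / b))\<^sup>2 = 2 * s / b" using assms by simp
    ultimately show ?thesis using assms unfolding normal_density_def
      by (simp add: field_simps)
  qed
  have "(\<Sum>i\<in>Basis. (y \<bullet> i)\<^sup>2) = (norm y)\<^sup>2"
    unfolding power2_norm_eq_inner by (subst euclidean_inner) (simp add: power2_eq_square)
  moreover have "heatk b s y = exp (\<Sum>i\<in>Basis. - (1 / 2) * ln (4 * pi * s / b) + (- b / (4 * s)) * (y \<bullet> i)\<^sup>2)"
    unfolding heatk_def n exp_add[symmetric] by (simp add: exp_sum)
  ultimately show ?thesis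
    unfolding sum.distrib sum_distrib_left[symmetric] by simp
qed

lemma heatk_D2on:
  fixes b :: real
  assumes b: "b > 0"
  obtains g :: "'a::euclidean_space \<times> real \<Rightarrow> 'a \<times> real" and H where
    "D2on (UNIV \<times> {0<..}) (\<lambda>p. heatk b (snd p) (fst p)) g H" "\<And>v. continuous_on (UNIV \<times> {0<..}) (\<lambda>p. H p v)"
    "\<And>p. p \<in> UNIV \<times> {0<..} \<Longrightarrow> b * snd (g p) = lap (H p)"
proof -
  define N where "N = real DIM('a)"
  let ?V = "UNIV \<times> {0<..} :: ('a \<times> real) set"
  have r1: "D2on ?V (\<lambda>p. - (N / 2) * ln (4 * pi * snd p / b)) (\<lambda>p. (0, - (N / 2) / snd p))
     (\<lambda>p k. (0, ((N / 2) / (snd p)\<^sup>2) * snd k))"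
    using b by (intro D2on_snd) (auto intro!: derivative_eq_intros simp: field_simps power2_eq_square)
  have r2: "D2on ?V (\<lambda>p. - b / (4 * snd p)) (\<lambda>p. (0, b / (4 * (snd p)\<^sup>2)))
     (\<lambda>p k. (0, (- b / (2 * (snd p)^3)) * snd k))"
    by (intro D2on_snd) (auto intro!: derivative_eq_intros simp: field_simps power2_eq_square power3_eq_cube)
  have sq: "D2on ?V (\<lambda>p. (norm (fst p))\<^sup>2) (\<lambda>p. (2 *\<^sub>R fst p, 0)) (\<lambda>p k. (2 *\<^sub>R fst k, 0))"
    using D2on_subset[OF D2on_fst[OF D2on_sq[of UNIV 0]], of ?V] by simp
  note E = D2on_add[OF r1 D2on_mult[OF r2 sq]]
  note h = D2on_compose[OF E, of exp exp exp, OF DERIV_exp DERIV_exp]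
  define gE where "gE p = (0, - (N / 2) / snd p) + ((- b / (4 * snd p)) *\<^sub>R (2 *\<^sub>R fst p, 0) +
     (norm (fst p))\<^sup>2 *\<^sub>R (0, b / (4 * (snd p)\<^sup>2)))" for p :: "'a \<times> real"
  define HE where "HE p k = (0, ((N / 2) / (snd p)\<^sup>2) * snd k) + ((((0, b / (4 * (snd p)\<^sup>2)) \<bullet> k) *\<^sub>R (2 *\<^sub>R fst p, 0)
      + ((2 *\<^sub>R fst p, 0) \<bullet> k) *\<^sub>R (0, b / (4 * (snd p)\<^sup>2)))
      + ((- b / (4 * snd p)) *\<^sub>R (2 *\<^sub>R fst k, 0) + (norm (fst p))\<^sup>2 *\<^sub>R (0, (- b / (2 * (snd p)^3)) * snd k)))"
    for p k :: "'a \<times> real"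
  define E where "E p = - (N / 2) * ln (4 * pi * snd p / b) + - b / (4 * snd p) * (norm (fst p))\<^sup>2" for p :: "'a \<times> real"
  have D: "D2on ?V (\<lambda>p. exp (E p)) (\<lambda>p. exp (E p) *\<^sub>R gE p) (\<lambda>p k. exp (E p) *\<^sub>R ((gE p \<bullet> k) *\<^sub>R gE p) + exp (E p) *\<^sub>R HE p k)"
    using h unfolding E_def gE_def HE_def .
  have cE: "continuous_on ?V E" "continuous_on ?V gE" "continuous_on ?V (\<lambda>p. HE p v)" for v
    unfolding E_def gE_def HE_def using b by (auto intro!: continuous_intros)
  have lapHE: "lap (HE p) = - (N * b) / (2 * snd p)" if "snd p > 0" for p
  proof -
    have "lap (HE p) = lap (\<lambda>k. (- b / (4 * snd p)) *\<^sub>R (2 *\<^sub>R fst k, 0 :: real) :: 'a \<times> real)"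
      unfolding HE_def lap_add lap_scaleR lap_snd lap_outer by simp
    also have "\<dots> = (- b / (4 * snd p)) * (2 * N)"
      unfolding lap_scaleR lap_fst[of "\<lambda>k. 2 *\<^sub>R k"] by (simp add: N_def)
    finally show ?thesis by simp
  qed
  \<comment> \<open>For exp E the heat equation reads b E_t = |grad E|^2 + lap E. Here the squared
    gradient cancels the |y|^2 part of b E_t, and lap E = - N b / (2 s) is the part from the
    logarithm.\<close>
  have cal: "b * snd (gE p) = fst (gE p) \<bullet> fst (gE p) + lap (HE p)" if p: "snd p > 0" for p
    unfolding lapHE[OF p] using p
    by (simp add: gE_def dot_square_norm field_simps power2_eq_square)
  have "D2on ?V (\<lambda>p. heatk b (snd p) (fst p)) (\<lambda>p. exp (E p) *\<^sub>R gE p) (\<lambda>p k. exp (E p) *\<^sub>R ((gE p \<bullet> k) *\<^sub>R gE p) + exp (E p) *\<^sub>R HE p k)"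
    unfolding D2on_def
  proof (intro ballI conjI)
    fix p :: "'a \<times> real" assume p: "p \<in> ?V"
    have "((\<lambda>p. exp (E p)) has_derivative (\<bullet>) (exp (E p) *\<^sub>R gE p)) (at p)" using D p unfolding D2on_def by blast
    then show "((\<lambda>p. heatk b (snd p) (fst p)) has_derivative (\<bullet>) (exp (E p) *\<^sub>R gE p)) (at p)"
      by (rule has_derivative_transform_within_open[of _ _ _ _ ?V])
        (use p b in \<open>auto simp: heatk_exp E_def N_def intro: open_Times\<close>)
  qed (use D in \<open>unfold D2on_def, blast\<close>)
  moreover have "continuous_on ?V (\<lambda>p. exp (E p) *\<^sub>R ((gE p \<bullet> v) *\<^sub>R gE p) + exp (E p) *\<^sub>R HE p v)" for v
    by (intro continuous_intros cE)
  moreover have "b * snd (exp (E p) *\<^sub>R gE p) = lap (\<lambda>k. exp (E p) *\<^sub>R ((gE p \<bullet> k) *\<^sub>R gE p) + exp (E p) *\<^sub>R HE p k)" if "p \<in> ?V" for p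
  proof -
    have "lap (\<lambda>k. exp (E p) *\<^sub>R ((gE p \<bullet> k) *\<^sub>R gE p) + exp (E p) *\<^sub>R HE p k) = exp (E p) * (fst (gE p) \<bullet> fst (gE p) + lap (HE p))"
      by (simp only: lap_add lap_scaleR lap_outer distrib_left)
    moreover have "snd p > 0" using that by auto
    ultimately show ?thesis using cal[of p] by (simp add: mult.left_commute)
  qed
  ultimately show ?thesis using that by blast
qed

lemma D2on_continuous_gradient: "D2on W \<phi> g H \<Longrightarrow> continuous_on W g"
  by (auto simp: D2on_def intro!: continuous_at_imp_continuous_on dest!: has_derivative_continuous)

section \<open>Heat flow of a time slice\<close>

lemma lborel_integral_reflect:
  fixes t :: "'a::euclidean_space" and g :: "'a \<Rightarrow> real"
  assumes [measurable]: "g \<in> borel_measurable borel"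
  shows "(\<integral>x. g (t - x) \<partial>lborel) = (\<integral>x. g x \<partial>lborel)"
    "integrable lborel (\<lambda>x. g (t - x)) \<longleftrightarrow> integrable lborel g"
proof -
  have "lborel = density (distr lborel borel (\<lambda>x::'a. t + (-1) *\<^sub>R x)) (\<lambda>_. \<bar>-1::real\<bar> ^ DIM('a))"
    by (rule lborel_affine) simp
  then have l: "(lborel :: 'a measure) = distr lborel borel (\<lambda>x. t - x)" by (simp add: density_1)
  show "(\<integral>x. g (t - x) \<partial>lborel) = (\<integral>x. g x \<partial>lborel)"
    by (subst (2) l) (simp add: integral_distr)
  show "integrable lborel (\<lambda>x. g (t - x)) \<longleftrightarrow> integrable lborel g"
    by (subst (2) l) (simp add: integrable_distr_eq)
qed

lemma lborel_integral_shift: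
  fixes t :: "'a::euclidean_space" and g :: "'a \<Rightarrow> real"
  assumes [measurable]: "g \<in> borel_measurable borel"
  shows "(\<integral>x. g (t + x) \<partial>lborel) = (\<integral>x. g x \<partial>lborel)"
proof -
  have l: "(lborel :: 'a measure) = distr lborel borel ((+) t)" by (rule lborel_distr_plus[symmetric])
  show ?thesis by (subst (2) l) (simp add: integral_distr)
qed

lemma integral_cbox_lborel:
  fixes g :: "'a::euclidean_space \<Rightarrow> real"
  assumes g: "integrable lborel g" and z: "\<And>y. y \<notin> cbox l u \<Longrightarrow> g y = 0"
  shows "integral (cbox l u) g = (\<integral>y. g y \<partial>lborel)"
proof -
  have "integral (cbox l u) g = integral UNIV (\<lambda>y. if y \<in> cbox l u then g y else 0)"
    by (rule integral_restrict_UNIV[symmetric])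
  also have "(\<lambda>y. if y \<in> cbox l u then g y else 0) = g" using z by auto
  finally show ?thesis using integral_lborel[OF g] by simp
qed

lemma heatk_mult_integrable:
  fixes g :: "'a::euclidean_space \<Rightarrow> real"
  assumes bs: "0 < b" "0 < s" and [measurable]: "g \<in> borel_measurable borel" and M: "\<And>y. \<bar>g y\<bar> \<le> M"
  shows "integrable lborel (\<lambda>y. heatk b s y * g y)"
proof (rule Bochner_Integration.integrable_bound)
  show "integrable lborel (\<lambda>y::'a. M * heatk b s y)" using heatk_0(1)[OF bs, where 'a='a] by simp
  show "AE y in lborel. norm (heatk b s y * g y) \<le> norm (M * heatk b s y)"
    using M order_trans[OF abs_ge_zero M]
    by (auto intro!: AE_I2 mult_right_mono simp: abs_mult heatk_nonneg mult.commute[of _ "heatk b s _"] mult_left_mono)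
qed simp

text \<open>The solution with data \<open>f\<close> at time \<tau>. The integral runs over a box so
  that differentiation under it stays on a compact set; for data vanishing outside the box it is the
  full Gaussian mean (\<open>heat_flow_eq\<close>).\<close>

definition heat_flow :: "real \<Rightarrow> ('a::euclidean_space \<Rightarrow> real) \<Rightarrow> 'a \<Rightarrow> 'a \<Rightarrow> real \<Rightarrow> 'a \<times> real \<Rightarrow> real"
  where "heat_flow b f l u \<tau> p = integral (cbox l u) (\<lambda>y. f y * heatk b (snd p - \<tau>) (fst p - y))"

lemma heat_flow_D2on:
  fixes f :: "'a::euclidean_space \<Rightarrow> real"
  assumes b: "b > 0" and f: "continuous_on (cbox l u) f"
  obtains g H where "D2on (UNIV \<times> {\<tau><..}) (heat_flow b f l u \<tau>) g H"
    "\<And>p. p \<in> UNIV \<times> {\<tau><..} \<Longrightarrow> b * snd (g p) = lap (H p)"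
proof -
  let ?V = "UNIV \<times> {0<..} :: ('a \<times> real) set" and ?U = "UNIV \<times> {\<tau><..} :: ('a \<times> real) set"
  obtain g :: "'a \<times> real \<Rightarrow> 'a \<times> real" and H where gH: "D2on ?V (\<lambda>p. heatk b (snd p) (fst p)) g H"
    "\<And>v. continuous_on ?V (\<lambda>p. H p v)" "\<And>p. p \<in> ?V \<Longrightarrow> b * snd (g p) = lap (H p)"
    by (rule heatk_D2on[OF b]) (rule that)
  define \<iota> where "\<iota> y = (y, \<tau>)" for y :: 'a
  have \<iota>: "continuous_on UNIV \<iota>" unfolding \<iota>_def by (intro continuous_intros)
  have U: "open ?U" "convex ?U" by (auto intro: open_Times convex_Times)
  have UV: "p - \<iota> y \<in> ?V" if "p \<in> ?U" for p y using that by (auto simp: \<iota>_def)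
  have D: "D2on ?U (\<lambda>p. integral (cbox l u) (\<lambda>y. f y * heatk b (snd (p - \<iota> y)) (fst (p - \<iota> y))))
     (\<lambda>p. integral (cbox l u) (\<lambda>y. f y *\<^sub>R g (p - \<iota> y)))
     (\<lambda>p k. integral (cbox l u) (\<lambda>y. f y *\<^sub>R H (p - \<iota> y) k))"
    by (rule D2on_convolution[OF \<iota> f U UV gH(1,2)])
  have cg: "continuous_on ?V g"
    by (rule D2on_continuous_gradient[OF gH(1)])
  have "b * snd (integral (cbox l u) (\<lambda>y. f y *\<^sub>R g (p - \<iota> y))) = lap (\<lambda>k. integral (cbox l u) (\<lambda>y. f y *\<^sub>R H (p - \<iota> y) k))"
    if p: "p \<in> ?U" for p
  proof -
    have c3: "continuous_on (cbox l u) (\<lambda>y. h (p - \<iota> y))" if "continuous_on ?V h" for h :: "'a \<times> real \<Rightarrow> 'a \<times> real"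
    proof (rule continuous_on_compose2[OF that])
      show "continuous_on (cbox l u) (\<lambda>y. p - \<iota> y)"
        by (intro continuous_intros continuous_on_subset[OF \<iota>]) auto
      show "(\<lambda>y. p - \<iota> y) ` cbox l u \<subseteq> ?V" by (rule image_subsetI) (rule UV[OF p])
    qed
    have ig: "(\<lambda>y. f y *\<^sub>R g (p - \<iota> y)) integrable_on cbox l u"
      by (intro integrable_continuous continuous_on_scaleR f c3 cg)
    have iH: "(\<lambda>y. f y *\<^sub>R H (p - \<iota> y) k) integrable_on cbox l u" for k
      by (intro integrable_continuous continuous_on_scaleR f c3 gH(2))
    have "lap (\<lambda>k. integral (cbox l u) (\<lambda>y. f y *\<^sub>R H (p - \<iota> y) k)) = integral (cbox l u) (\<lambda>y. lap (\<lambda>k. f y *\<^sub>R H (p - \<iota> y) k))"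
      by (rule lap_integral[OF iH])
    also have "\<dots> = integral (cbox l u) (\<lambda>y. b * snd (f y *\<^sub>R g (p - \<iota> y)))"
      using gH(3)[OF UV[OF p]] by (intro integral_cong) (simp add: lap_scaleR mult.left_commute[of b])
    also have "\<dots> = b * integral (cbox l u) (\<lambda>y. snd (f y *\<^sub>R g (p - \<iota> y)))" by simp
    also have "integral (cbox l u) (\<lambda>y. snd (f y *\<^sub>R g (p - \<iota> y))) = snd (integral (cbox l u) (\<lambda>y. f y *\<^sub>R g (p - \<iota> y)))"
      using integral_linear[OF ig bounded_linear_snd] by (simp add: o_def)
    finally show ?thesis by simp
  qed
  moreover have "(\<lambda>p. integral (cbox l u) (\<lambda>y. f y * heatk b (snd (p - \<iota> y)) (fst (p - \<iota> y)))) = heat_flow b f l u \<tau>"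
    by (simp add: heat_flow_def \<iota>_def fun_eq_iff)
  ultimately show ?thesis using that[OF D[unfolded \<open>_ = heat_flow b f l u \<tau>\<close>]] by blast
qed

lemma heat_flow_eq:
  fixes f :: "'a::euclidean_space \<Rightarrow> real"
  assumes b: "b > 0" and s: "\<tau> < t" and f: "continuous_on UNIV f" "\<And>y. \<bar>f y\<bar> \<le> M" "\<And>y. y \<notin> cbox l u \<Longrightarrow> f y = 0"
  shows "heat_flow b f l u \<tau> (x, t) = (\<integral>y. heatk b (t - \<tau>) y * f (x + y) \<partial>lborel)"
proof -
  have [measurable]: "f \<in> borel_measurable borel" using f(1) by (rule borel_measurable_continuous_onI)
  have s': "t - \<tau> > 0" using s by simp
  define g where "g y = f y * heatk b (t - \<tau>) (x - y)" for y
  have [measurable]: "g \<in> borel_measurable borel" unfolding g_def by measurable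
  have "integrable lborel (\<lambda>y. heatk b (t - \<tau>) y * f (x - y))"
    using f(2) by (intro heatk_mult_integrable[OF b s', of _ M]) auto
  then have "integrable lborel (\<lambda>y. g (x - y))" by (simp add: g_def mult.commute)
  then have "integrable lborel g" by (subst (asm) lborel_integral_reflect(2)) simp_all
  then have "integral (cbox l u) g = (\<integral>y. g y \<partial>lborel)" using f(3) by (intro integral_cbox_lborel) (auto simp: g_def)
  also have "\<dots> = (\<integral>y. g (x + y) \<partial>lborel)" by (rule lborel_integral_shift[symmetric]) simp
  also have "\<dots> = (\<integral>y. heatk b (t - \<tau>) y * f (x + y) \<partial>lborel)"
    by (simp add: g_def heatk_uminus mult.commute)
  finally show ?thesis by (simp add: heat_flow_def g_def[abs_def])
qed

text \<open>A Lipschitz function differs from its Gaussian mean by the order of the standard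
  deviation, hence by a multiple of the square root of \<open>s\<close>.\<close>

lemma heat_flow_initial:
  fixes f :: "'a::euclidean_space \<Rightarrow> real"
  assumes bs: "b > 0" "s > 0" and f: "continuous_on UNIV f" "\<And>y. \<bar>f y\<bar> \<le> M"
    and L: "\<And>x y. \<bar>f x - f y\<bar> \<le> L * dist x y" "L \<ge> 0"
  shows "f x \<le> (\<integral>y. heatk b s y * f (x + y) \<partial>lborel) + L * sqrt s * (1 + 2 * DIM('a) / b)"
proof -
  have [measurable]: "f \<in> borel_measurable borel" using f(1) by (rule borel_measurable_continuous_onI)
  have i: "integrable lborel (\<lambda>y. heatk b s y * f (x + y))"
    using f(2) by (intro heatk_mult_integrable[OF bs, of _ M]) auto
  have i2: "integrable lborel (\<lambda>y::'a. heatk b s y * f x)" using heatk_0(1)[OF bs, where 'a='a] by simp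
  have e: "heatk b s y * (f x - f (x + y)) = heatk b s y * f x - heatk b s y * f (x + y)" for y
    by (simp add: algebra_simps)
  have "(\<integral>y. heatk b s y * (f x - f (x + y)) \<partial>lborel) \<le> L * sqrt s + s / b * (\<Sum>i\<in>(Basis::'a set). 0 \<bullet> i)
    + 2 * (L / sqrt s) * DIM('a) * s / b + 12 * (0::real) * (DIM('a))\<^sup>2 * s\<^sup>2 / b\<^sup>2"
  proof (rule heatk_taylor[OF bs, where a = 0 and A = "\<lambda>_. 0"])
    show "integrable lborel (\<lambda>y. heatk b s y * (f x - f (x + y)))"
      unfolding e by (rule Bochner_Integration.integrable_diff[OF i2 i])
    fix y :: 'a
    \<comment> \<open>This replaces the norm by a constant and a square, the form that
      \<open>heatk_taylor\<close> can integrate; the split at |y| = sqrt s balances the two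
      contributions.\<close>
    have "norm y \<le> sqrt s + (norm y)\<^sup>2 / sqrt s"
    proof (cases "norm y \<le> sqrt s")
      case False
      then have "norm y * sqrt s \<le> norm y * norm y" using bs by (intro mult_left_mono) auto
      then have "norm y \<le> (norm y)\<^sup>2 / sqrt s" using bs by (simp add: field_simps power2_eq_square)
      then show ?thesis using bs by (smt (verit) real_sqrt_gt_0_iff)
    qed (use bs in \<open>simp add: add_increasing2\<close>)
    then have "L * norm y \<le> L * (sqrt s + (norm y)\<^sup>2 / sqrt s)" using L(2) by (rule mult_left_mono)
    moreover have "f x - f (x + y) \<le> L * norm y" using L(1)[of x "x + y"] by (simp add: dist_norm)
    ultimately show "f x - f (x + y) \<le> L * sqrt s + 0 \<bullet> y + 0 \<bullet> y / 2 + L / sqrt s * (norm y)\<^sup>2 + 0 * norm y ^ 4"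
      by (simp add: distrib_left)
  qed (auto simp: linear_0 intro: linearI)
  also have "2 * (L / sqrt s) * DIM('a) * s / b = L * sqrt s * (2 * DIM('a) / b)"
  proof -
    have "s / sqrt s = sqrt s" using bs by (simp add: real_div_sqrt)
    moreover have "2 * (L / sqrt s) * DIM('a) * s / b = L * (s / sqrt s) * (2 * DIM('a) / b)" by simp
    ultimately show ?thesis by simp
  qed
  finally have "(\<integral>y. heatk b s y * (f x - f (x + y)) \<partial>lborel) \<le> L * sqrt s * (1 + 2 * DIM('a) / b)"
    by (simp add: distrib_left)
  moreover have "(\<integral>y. heatk b s y * (f x - f (x + y)) \<partial>lborel) = f x - (\<integral>y. heatk b s y * f (x + y) \<partial>lborel)"
    unfolding e using heatk_0(2)[OF bs, where 'a='a] by (simp add: Bochner_Integration.integral_diff[OF i2 i])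
  ultimately show ?thesis by simp
qed

text \<open>On a small cylinder \<open>f\<close> is compared with the heat flow of its own slice at
  \<open>t0\<close> plus a barrier. The barrier is a multiple of the square of |x - x0|^2 + C (t -
  t0): it exceeds the bound \<open>M\<close> on the lateral boundary, yet at the centre it has grown
  only to order h^2 after time \<open>h\<close>. This second-order smallness is what makes the
  inequality usable infinitesimally.\<close>

lemma heat_step:
  fixes f :: "'a::euclidean_space \<times> real \<Rightarrow> real"
  assumes b: "b > 0" and f: "\<And>p. 0 \<le> f p" "\<And>p. f p \<le> M" and L: "\<And>p q. \<bar>f p - f q\<bar> \<le> L * dist p q"
    and supp: "\<And>p. B < norm p \<Longrightarrow> f p = 0"
    and v: "vsub (\<lambda>\<tau>. b * \<tau>) W f" and W: "cball x0 r \<times> {t0..t0 + h0} \<subseteq> W" and r: "r > 0" and h: "0 < h" "h < h0"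
  shows "f (x0, t0 + h) \<le> (\<integral>y. heatk b h y * f (x0 + y, t0) \<partial>lborel) + M * ((4 + 2 * DIM('a)) / b)\<^sup>2 / r ^ 4 * h\<^sup>2"
proof -
  have M: "M \<ge> 0" using f order_trans by blast
  have L0: "L \<ge> 0"
  proof -
    have "0 \<le> L * dist ((0::'a), 0::real) (0, 1)" using L[of "(0, 0)" "(0, 1)"] by linarith
    then show ?thesis by (simp add: dist_Pair_Pair)
  qed
  have cf: "continuous_on UNIV f"
  proof (subst continuous_on_iff, intro ballI allI impI)
    fix p :: "'a \<times> real" and e :: real assume e: "e > 0"
    show "\<exists>d>0. \<forall>q\<in>UNIV. dist q p < d \<longrightarrow> dist (f q) (f p) < e"
    proof (intro exI[of _ "e / (L + 1)"] conjI ballI impI)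
      show "e / (L + 1) > 0" using e L0 by simp
      fix q assume q: "dist q p < e / (L + 1)"
      have "\<bar>f q - f p\<bar> \<le> L * dist q p" by (rule L)
      also have "\<dots> \<le> (L + 1) * dist q p" by (simp add: mult_right_mono)
      also have "\<dots> < e" using q L0 by (simp add: field_simps)
      finally show "dist (f q) (f p) < e" by (simp add: dist_real_def)
    qed
  qed
  define f0 where "f0 x = f (x, t0)" for x
  have cf0: "continuous_on S f0" for S unfolding f0_def
    by (rule continuous_on_compose2[OF cf]) (auto intro!: continuous_intros)
  have f0L: "\<bar>f0 x - f0 y\<bar> \<le> L * dist x y" for x y using L[of "(x, t0)" "(y, t0)"] by (simp add: f0_def dist_Pair_Pair)
  have f0M: "\<bar>f0 y\<bar> \<le> M" for y using f[of "(y, t0)"] by (simp add: f0_def)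
  obtain l u where lu: "cball (0::'a) B \<subseteq> cbox l u"
    using bounded_subset_cbox_symmetric[OF bounded_cball[of 0 B]] by (metis)
  have f0s: "f0 y = 0" if "y \<notin> cbox l u" for y
  proof -
    have "B < norm y" using that lu by (auto simp: subset_iff not_le)
    also have "norm y \<le> norm (y, t0)" by (simp add: norm_Pair)
    finally show ?thesis unfolding f0_def by (rule supp)
  qed
  \<comment> \<open>With this \<open>C\<close> the square of \<beta> is a supersolution: its
    Laplacian is 8 |x - x0|^2 + 4 N \<beta>, at most (8 + 4 N) \<beta>, which equals b times its
    time derivative 2 C \<beta>.\<close>
  define C where "C = (4 + 2 * DIM('a)) / b"
  have C: "C > 0" using b by (simp add: C_def add_pos_nonneg)
  define \<beta> where "\<beta> p = (norm (fst p - x0))\<^sup>2 + C * (snd p - t0)" for p :: "'a \<times> real"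
  have "D2on UNIV (\<lambda>p. (norm (fst p - x0))\<^sup>2) (\<lambda>p. (2 *\<^sub>R (fst p - x0), 0)) (\<lambda>p k. (2 *\<^sub>R fst k, 0::real))"
    using D2on_fst[OF D2on_sq[of UNIV x0]] by simp
  moreover have "D2on UNIV (\<lambda>p::'a \<times> real. C * (snd p - t0)) (\<lambda>p. (0, C)) (\<lambda>p k. (0, 0 * snd k))"
    using D2on_snd[of UNIV "\<lambda>s. C * (s - t0)" "\<lambda>_. C" "\<lambda>_. 0", where 'a='a]
    unfolding UNIV_Times_UNIV by (rule meta_mp) (auto intro!: derivative_eq_intros)
  ultimately have D\<beta>: "D2on UNIV \<beta> (\<lambda>p. (2 *\<^sub>R (fst p - x0), 0) + (0, C)) (\<lambda>p k. (2 *\<^sub>R fst k, 0) + (0, 0 * snd k))"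
    unfolding \<beta>_def by (rule D2on_add)
  \<comment> \<open>On the sphere of radius \<open>r\<close> one has \<beta> \<ge> r^2, so the
    barrier is at least \<open>M\<close> there.\<close>
  define K where "K = M / r ^ 4"
  have K: "K \<ge> 0" using M by (simp add: K_def)
  have DB: "D2on UNIV (\<lambda>p. K * (\<beta> p)\<^sup>2) (\<lambda>p. (2 * K * \<beta> p) *\<^sub>R ((2 *\<^sub>R (fst p - x0), 0) + (0, C)))
     (\<lambda>p k. (2 * K) *\<^sub>R (((2 *\<^sub>R (fst p - x0), 0) + (0, C)) \<bullet> k) *\<^sub>R ((2 *\<^sub>R (fst p - x0), 0) + (0, C))
       + (2 * K * \<beta> p) *\<^sub>R ((2 *\<^sub>R fst k, 0) + (0, 0 * snd k)))"
    by (rule D2on_compose[OF D\<beta>, of "\<lambda>s. K * s\<^sup>2" "\<lambda>s. 2 * K * s" "\<lambda>_. 2 * K"]) (auto intro!: derivative_eq_intros)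
  \<comment> \<open>The flow is started at the earlier time t0 - \<sigma> with the data of time
    \<open>t0\<close>. It is then smooth up to \<open>t0\<close>, at the price of an initial error
    of order sqrt \<sigma>.\<close>
  have est: "f (x0, t0 + h) \<le> heat_flow b f0 l u (t0 - \<sigma>) (x0, t0 + h) + L * sqrt \<sigma> * (1 + 2 * DIM('a) / b) + K * C\<^sup>2 * h\<^sup>2"
    if \<sigma>: "\<sigma> > 0" for \<sigma>
  proof -
    define cc where "cc = L * sqrt \<sigma> * (1 + 2 * DIM('a) / b)"
    have cc: "cc \<ge> 0" using L0 \<sigma> b by (simp add: cc_def)
    obtain g H where gH: "D2on (UNIV \<times> {t0 - \<sigma><..}) (heat_flow b f0 l u (t0 - \<sigma>)) g H"
      "\<And>p. p \<in> UNIV \<times> {t0 - \<sigma><..} \<Longrightarrow> b * snd (g p) = lap (H p)"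
      by (rule heat_flow_D2on[OF b cf0, where l = l and u = u and \<tau> = "t0 - \<sigma>"]) (rule that)
    define \<phi> where "\<phi> p = (heat_flow b f0 l u (t0 - \<sigma>) p + cc) + K * (\<beta> p)\<^sup>2" for p
    note D = D2on_add[OF D2on_add[OF gH(1) D2on_const[of _ cc]] D2on_subset[OF DB subset_UNIV]]
    have flow: "heat_flow b f0 l u (t0 - \<sigma>) (x, t) = (\<integral>y. heatk b (t - (t0 - \<sigma>)) y * f0 (x + y) \<partial>lborel)"
      if "t0 \<le> t" for x t
      using that \<sigma> by (intro heat_flow_eq[OF b _ cf0 f0M f0s]) auto
    have flow0: "0 \<le> heat_flow b f0 l u (t0 - \<sigma>) (x, t)" if "t0 \<le> t" for x t
      unfolding flow[OF that] using f by (intro integral_nonneg_AE AE_I2) (simp add: heatk_nonneg f0_def)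
    have "f (x0, t0 + h) \<le> \<phi> (x0, t0 + h)"
    proof (rule classical_comparison[where O' = "ball x0 r" and F = "\<lambda>\<tau>. b * \<tau>" and \<phi> = \<phi>])
      show "vsub (\<lambda>\<tau>. b * \<tau>) (ball x0 r \<times> {t0<..<t0 + h0}) f"
        by (rule vsub_mono[OF v _ order_refl], rule order_trans[OF _ W]) auto
      show "usc_on (closure (ball x0 r) \<times> {t0..t0 + h0}) f"
        by (intro usc_on_continuous continuous_on_subset[OF cf]) auto
      show "strict_mono (\<lambda>\<tau>. b * \<tau>)" using b by (auto simp: strict_mono_def)
      show "D2on (ball x0 r \<times> {t0<..<t0 + h0}) \<phi> (\<lambda>p. g p + 0 + (2 * K * \<beta> p) *\<^sub>R ((2 *\<^sub>R (fst p - x0), 0) + (0, C)))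
        (\<lambda>p k. H p k + 0 + ((2 * K) *\<^sub>R (((2 *\<^sub>R (fst p - x0), 0) + (0, C)) \<bullet> k) *\<^sub>R ((2 *\<^sub>R (fst p - x0), 0) + (0, C))
       + (2 * K * \<beta> p) *\<^sub>R ((2 *\<^sub>R fst k, 0) + (0, 0 * snd k))))"
        unfolding \<phi>_def by (rule D2on_subset[OF D]) (use \<sigma> in auto)
      show "continuous_on (closure (ball x0 r) \<times> {t0..t0 + h0}) \<phi>"
        unfolding \<phi>_def by (rule continuous_on_subset[OF D2on_continuous[OF D]]) (use \<sigma> in auto)
      show "lap (\<lambda>k. H p k + 0 + ((2 * K) *\<^sub>R (((2 *\<^sub>R (fst p - x0), 0) + (0, C)) \<bullet> k) *\<^sub>R ((2 *\<^sub>R (fst p - x0), 0) + (0, C))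
       + (2 * K * \<beta> p) *\<^sub>R ((2 *\<^sub>R fst k, 0) + (0, 0 * snd k))))
        \<le> b * snd (g p + 0 + (2 * K * \<beta> p) *\<^sub>R ((2 *\<^sub>R (fst p - x0), 0) + (0, C)))"
        if p: "p \<in> ball x0 r \<times> {t0<..<t0 + h0}" for p
      proof -
        have "lap (\<lambda>k. H p k + 0 + ((2 * K) *\<^sub>R (((2 *\<^sub>R (fst p - x0), 0) + (0, C)) \<bullet> k) *\<^sub>R ((2 *\<^sub>R (fst p - x0), 0) + (0, C))
          + (2 * K * \<beta> p) *\<^sub>R ((2 *\<^sub>R fst k, 0) + (0, 0 * snd k))))
          = lap (H p) + ((2 * K) * (4 * (norm (fst p - x0))\<^sup>2) + (2 * K * \<beta> p) * (2 * DIM('a)))"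
          by (simp only: add_0_right lap_add lap_scaleR lap_outer lap_snd lap_fst[of "\<lambda>k. 2 *\<^sub>R k"])
            (simp add: dot_square_norm)
        also have "(2 * K) * (4 * (norm (fst p - x0))\<^sup>2) + (2 * K * \<beta> p) * (2 * DIM('a))
          \<le> (2 * K) * (4 * \<beta> p) + (2 * K * \<beta> p) * (2 * DIM('a))"
          using K C p by (intro add_right_mono mult_left_mono) (auto simp: \<beta>_def)
        also have "\<dots> = b * (2 * K * \<beta> p * C)" 
        proof -
          have "b * C = 4 + 2 * DIM('a)" using b by (simp add: C_def)
          moreover have "b * (2 * K * \<beta> p * C) = 2 * K * \<beta> p * (b * C)" by simp
          ultimately show ?thesis by (simp add: algebra_simps)
        qed
        finally show ?thesis using gH(2)[of p] p \<sigma> by (auto simp: algebra_simps)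
      qed
      show "f (x, t0) \<le> \<phi> (x, t0)" for x
      proof -
        have "f (x, t0) \<le> heat_flow b f0 l u (t0 - \<sigma>) (x, t0) + cc"
          using heat_flow_initial[OF b \<sigma> cf0 f0M f0L L0, of x] by (simp add: flow f0_def cc_def)
        also have "\<dots> \<le> \<phi> (x, t0)" using K by (simp add: \<phi>_def)
        finally show ?thesis .
      qed
      show "f (x, t) \<le> \<phi> (x, t)" if "x \<in> frontier (ball x0 r)" "t0 \<le> t" for x t
      proof -
        have "norm (x - x0) = r" using that r by (simp add: dist_norm norm_minus_commute)
        then have "r\<^sup>2 \<le> \<beta> (x, t)" using C that by (simp add: \<beta>_def)
        then have "(r\<^sup>2)\<^sup>2 \<le> (\<beta> (x, t))\<^sup>2" by (intro power_mono) auto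
        then have "K * (r\<^sup>2)\<^sup>2 \<le> K * (\<beta> (x, t))\<^sup>2" using K by (rule mult_left_mono)
        moreover have "K * (r\<^sup>2)\<^sup>2 = M" using r by (simp add: K_def)
        ultimately have "M \<le> K * (\<beta> (x, t))\<^sup>2" by simp
        also have "\<dots> \<le> \<phi> (x, t)" using flow0[OF that(2), of x] cc by (simp add: \<phi>_def)
        finally show ?thesis using f(2)[of "(x, t)"] by simp
      qed
    qed (use h r in \<open>auto intro!: continuous_intros\<close>)
    then show ?thesis by (simp add: \<phi>_def \<beta>_def cc_def power_mult_distrib)
  qed
  obtain g H where gH: "D2on (UNIV \<times> {t0<..}) (heat_flow b f0 l u t0) g H"
    by (rule heat_flow_D2on[OF b cf0, where l = l and u = u and \<tau> = t0])
  \<comment> \<open>The kernel depends only on elapsed time, so starting earlier is evaluating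
    later; the limit \<sigma> \<rightarrow> 0 becomes continuity of one fixed flow at a positive
    time.\<close>
  have shift: "heat_flow b f0 l u (t0 - \<sigma>) (x0, t0 + h) = heat_flow b f0 l u t0 (x0, t0 + h + \<sigma>)" for \<sigma>
    by (simp add: heat_flow_def algebra_simps)
  have "isCont (heat_flow b f0 l u t0) (x0, t0 + h)"
    using D2on_continuous[OF gH] h by (subst (asm) continuous_on_eq_continuous_at) (auto intro: open_Times)
  then have "((\<lambda>\<sigma>. heat_flow b f0 l u t0 (x0, t0 + h + \<sigma>)) \<longlongrightarrow> heat_flow b f0 l u t0 (x0, t0 + h)) (at_right 0)"
    by (rule isCont_tendsto_compose) (auto intro!: tendsto_eq_intros)
  then have "((\<lambda>\<sigma>. heat_flow b f0 l u t0 (x0, t0 + h + \<sigma>) + L * sqrt \<sigma> * (1 + 2 * DIM('a) / b) + K * C\<^sup>2 * h\<^sup>2)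
    \<longlongrightarrow> heat_flow b f0 l u t0 (x0, t0 + h) + L * sqrt 0 * (1 + 2 * DIM('a) / b) + K * C\<^sup>2 * h\<^sup>2) (at_right 0)"
    by (intro tendsto_intros)
  moreover have "\<forall>\<^sub>F \<sigma> in at_right 0. f (x0, t0 + h) \<le> heat_flow b f0 l u t0 (x0, t0 + h + \<sigma>) + L * sqrt \<sigma> * (1 + 2 * DIM('a) / b) + K * C\<^sup>2 * h\<^sup>2"
    using est unfolding shift by (auto simp: eventually_at_right_less intro: eventually_mono[OF eventually_at_right_less[of 0]])
  ultimately have "f (x0, t0 + h) \<le> heat_flow b f0 l u t0 (x0, t0 + h) + K * C\<^sup>2 * h\<^sup>2"
    using tendsto_lowerbound[OF _ _ trivial_limit_at_right_real] by fastforce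
  also have "heat_flow b f0 l u t0 (x0, t0 + h) = (\<integral>y. heatk b h y * f (x0 + y, t0) \<partial>lborel)"
  proof -
    have "heat_flow b f0 l u t0 (x0, t0 + h) = (\<integral>y. heatk b (t0 + h - t0) y * f0 (x0 + y) \<partial>lborel)"
      using h by (intro heat_flow_eq[OF b _ cf0 f0M f0s]) auto
    then show ?thesis by (simp add: f0_def)
  qed
  finally show ?thesis by (simp add: K_def C_def)
qed

section \<open>Mollification of viscosity subsolutions\<close>

lemma pos_power_derivative:
  "((\<lambda>s::real. (max 0 s) ^ Suc (Suc n)) has_real_derivative (real (Suc (Suc n)) * (max 0 s) ^ Suc n)) (at s)"
proof -
  consider "s > 0" | "s < 0" | "s = 0" by linarith
  then show ?thesis
  proof cases
    case 1
    have "((\<lambda>s::real. s ^ Suc (Suc n)) has_real_derivative (real (Suc (Suc n)) * s ^ Suc n)) (at s)"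
      using DERIV_pow[of "Suc (Suc n)" s] by simp
    then have "((\<lambda>s::real. (max 0 s) ^ Suc (Suc n)) has_real_derivative (real (Suc (Suc n)) * s ^ Suc n)) (at s)"
      by (rule has_field_derivative_transform_within_open[of _ _ _ "{0<..}"]) (use 1 in auto)
    then show ?thesis using 1 by simp
  next
    case 2
    have "((\<lambda>s::real. 0) has_real_derivative 0) (at s)" by simp
    then have "((\<lambda>s::real. (max 0 s) ^ Suc (Suc n)) has_real_derivative 0) (at s)"
      by (rule has_field_derivative_transform_within_open[of _ _ _ "{..<0}"]) (use 2 in auto)
    then show ?thesis using 2 by simp
  next
    case 3
    have "((\<lambda>h::real. (max 0 h) ^ Suc (Suc n) / h) \<longlongrightarrow> 0) (at 0)"
    proof (rule Lim_null_comparison)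
      show "\<forall>\<^sub>F h::real in at 0. norm ((max 0 h) ^ Suc (Suc n) / h) \<le> \<bar>h\<bar> ^ Suc n"
      proof (intro always_eventually allI)
        fix h :: real
        show "norm ((max 0 h) ^ Suc (Suc n) / h) \<le> \<bar>h\<bar> ^ Suc n"
        proof (cases "h > 0")
          case False
          then have "norm ((max 0 h) ^ Suc (Suc n) / h) = 0" by simp
          then show ?thesis using zero_le_power_abs[of h "Suc n"] by linarith
        qed simp
      qed
      show "((\<lambda>h::real. \<bar>h\<bar> ^ Suc n) \<longlongrightarrow> 0) (at 0)"
        by (auto intro!: tendsto_eq_intros)
    qed
    then show ?thesis using 3 by (simp add: has_field_derivative_iff)
  qed
qed

text \<open>An unnormalised mollifier. The fourth power of the positive part is already of class
  C^2, all that the second-order calculus asks of a kernel.\<close>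

definition bump :: "real \<Rightarrow> 'e::euclidean_space \<Rightarrow> real"
  where "bump \<epsilon> p = (max 0 (\<epsilon>\<^sup>2 - (norm p)\<^sup>2)) ^ 4"

lemma bump_nonneg: "0 \<le> bump \<epsilon> p" by (simp add: bump_def)

lemma bump_continuous: "continuous_on S (bump \<epsilon>)"
  unfolding bump_def[abs_def] by (intro continuous_intros)

lemma bump_zero: "0 \<le> \<epsilon> \<Longrightarrow> \<epsilon> < norm p \<Longrightarrow> bump \<epsilon> p = 0"
  by (simp add: bump_def max_def)

lemma bump_D2on:
  fixes \<epsilon> :: real
  obtains g :: "'e::euclidean_space \<Rightarrow> 'e" and H where "D2on UNIV (bump \<epsilon>) g H" "\<And>v. continuous_on UNIV (\<lambda>p. H p v)"
proof -
  have D: "D2on UNIV (\<lambda>p::'e. \<epsilon>\<^sup>2 - (norm (p - 0))\<^sup>2) (\<lambda>p. 0 - 2 *\<^sub>R (p - 0)) (\<lambda>p k. 0 - 2 *\<^sub>R k)"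
    by (rule D2on_diff[OF D2on_const D2on_sq])
  have d: "((\<lambda>s::real. (max 0 s) ^ 4) has_real_derivative (4 * (max 0 s) ^ 3)) (at s)"
    "((\<lambda>s::real. 4 * (max 0 s) ^ 3) has_real_derivative (12 * (max 0 s) ^ 2)) (at s)" for s
    using pos_power_derivative[of 2 s] DERIV_cmult[OF pos_power_derivative[of 1 s], of 4] by (simp_all add: eval_nat_numeral)
  note D' = D2on_compose[OF D d]
  have "D2on UNIV (bump \<epsilon>) (\<lambda>p::'e. (4 * (max 0 (\<epsilon>\<^sup>2 - (norm (p - 0))\<^sup>2)) ^ 3) *\<^sub>R (0 - 2 *\<^sub>R (p - 0)))
    (\<lambda>p k. (12 * (max 0 (\<epsilon>\<^sup>2 - (norm (p - 0))\<^sup>2)) ^ 2) *\<^sub>R (((0 - 2 *\<^sub>R (p - 0)) \<bullet> k) *\<^sub>R (0 - 2 *\<^sub>R (p - 0)))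
      + (4 * (max 0 (\<epsilon>\<^sup>2 - (norm (p - 0))\<^sup>2)) ^ 3) *\<^sub>R (0 - 2 *\<^sub>R k))"
    using D' by (simp add: bump_def[abs_def])
  then show ?thesis
    by (rule that) (intro continuous_intros)
qed

lemma bump_integrable:
  assumes "\<epsilon> > 0"
  shows "integrable lborel (bump \<epsilon> :: 'e::euclidean_space \<Rightarrow> real)"
proof -
  have "integrable lborel (\<lambda>x::'e. indicator (cball 0 \<epsilon>) x *\<^sub>R bump \<epsilon> x)"
    by (rule borel_integrable_compact[OF compact_cball bump_continuous])
  moreover have "(\<lambda>x::'e. indicator (cball 0 \<epsilon>) x *\<^sub>R bump \<epsilon> x) = bump \<epsilon>"
    using assms by (auto simp: fun_eq_iff indicator_def bump_zero)
  ultimately show ?thesis by simp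
qed

lemma bump_integral_pos:
  assumes e: "\<epsilon> > 0"
  shows "(\<integral>p. bump \<epsilon> (p :: 'e::euclidean_space) \<partial>lborel) > 0"
proof -
  obtain a where a: "cball (0::'e) \<epsilon> \<subseteq> box (- a) a"
    using bounded_subset_box_symmetric[OF bounded_cball[of 0 \<epsilon>]] by metis
  have ne: "box (- a) a \<noteq> {}" using a e by fastforce
  have sub: "cball (0::'e) \<epsilon> \<subseteq> cbox (- a) a" using a box_subset_cbox by blast
  have "integral (cbox (- a) a) (bump \<epsilon>) = (\<integral>p. bump \<epsilon> (p :: 'e) \<partial>lborel)"
    by (rule integral_cbox_lborel[OF bump_integrable[OF e]]) (use sub e bump_zero[of \<epsilon>] in \<open>force\<close>)
  moreover have "integral (cbox (- a) a) (bump \<epsilon>) \<noteq> 0"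
  proof -
    have "bump \<epsilon> (0::'e) \<noteq> 0" "(0::'e) \<in> cbox (- a) a" using e sub by (auto simp: bump_def)
    then show ?thesis
      using integral_cbox_eq_0_iff[OF bump_continuous ne bump_nonneg] by blast
  qed
  moreover have "(\<integral>p. bump \<epsilon> (p :: 'e) \<partial>lborel) \<ge> 0" by (simp add: bump_nonneg)
  ultimately show ?thesis by linarith
qed

text \<open>The bound of \<open>heat_step\<close> is averaged over translations, with an error
  constant that does not depend on the translation. The average \<open>U\<close> then obeys the same
  bound, and since it is twice differentiable the Gaussian mean can be expanded: division by
  \<open>h\<close> and h \<rightarrow> 0 give the classical inequality. The construction of
  \<open>U\<close> does not involve \<open>b\<close>, so one \<open>U\<close> serves both heat
  equations.\<close>

lemma mollify:
  fixes f :: "'a::euclidean_space \<times> real \<Rightarrow> real"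
  assumes f: "\<And>p. 0 \<le> f p" "\<And>p. f p \<le> M" and L: "\<And>p q. \<bar>f p - f q\<bar> \<le> L * dist p q"
    and supp: "\<And>p. B < norm p \<Longrightarrow> f p = 0" and e: "\<epsilon> > 0"
  obtains U g H where "D2on UNIV U g H" "\<And>p. \<bar>U p - f p\<bar> \<le> L * \<epsilon>"
    "\<And>b W p. b > 0 \<Longrightarrow> vsub (\<lambda>\<tau>. b * \<tau>) W f \<Longrightarrow> cball p (2 * \<epsilon>) \<subseteq> W \<Longrightarrow> b * snd (g p) \<le> lap (H p)"
proof -
  have M: "M \<ge> 0" using f order_trans by blast
  have L0: "L \<ge> 0"
  proof -
    have "0 \<le> L * dist ((0::'a), 0::real) (0, 1)" using L[of "(0, 0)" "(0, 1)"] by linarith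
    then show ?thesis by (simp add: dist_Pair_Pair)
  qed
  have fabs: "\<bar>f p\<bar> \<le> M" for p using f[of p] by simp
  have cf: "continuous_on S f" for S
  proof -
    have "L-lipschitz_on S f" using L L0 by (intro lipschitz_onI) (auto simp: dist_real_def)
    then show ?thesis by (rule lipschitz_on_continuous_on)
  qed
  have [measurable]: "f \<in> borel_measurable borel" by (rule borel_measurable_continuous_onI[OF cf])
  define I where "I = (\<integral>p. bump \<epsilon> (p :: 'a \<times> real) \<partial>lborel)"
  have I: "I > 0" unfolding I_def by (rule bump_integral_pos[OF e])
  define \<rho> :: "'a \<times> real \<Rightarrow> real" where "\<rho> p = bump \<epsilon> p / I" for p
  have \<rho>0: "0 \<le> \<rho> p" for p using I by (simp add: \<rho>_def bump_nonneg)
  have \<rho>z: "\<rho> p = 0" if "\<epsilon> < norm p" for p using that e by (simp add: \<rho>_def bump_zero)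
  have i\<rho>: "integrable lborel \<rho>" unfolding \<rho>_def using bump_integrable[OF e, where 'e="'a \<times> real"] by simp
  have \<rho>1: "(\<integral>q. \<rho> q \<partial>lborel) = 1" unfolding \<rho>_def using I by (simp add: I_def[symmetric])
  have [measurable]: "\<rho> \<in> borel_measurable borel" using borel_measurable_integrable[OF i\<rho>] by simp
  obtain l u where lu: "cball (0::'a \<times> real) B \<subseteq> cbox l u"
    using bounded_subset_cbox_symmetric[OF bounded_cball[of 0 B]] by metis
  have fz: "f q = 0" if "q \<notin> cbox l u" for q using that lu supp[of q] by (force simp: not_le)
  have i\<rho>f: "integrable lborel (\<lambda>q. \<rho> q * f (p - q))" for p
  proof (rule Bochner_Integration.integrable_bound)
    show "integrable lborel (\<lambda>q. M * \<rho> q)" using i\<rho> by simp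
    show "AE q in lborel. norm (\<rho> q * f (p - q)) \<le> norm (M * \<rho> q)"
    proof (rule AE_I2)
      fix q
      have "\<rho> q * \<bar>f (p - q)\<bar> \<le> \<rho> q * M" using fabs \<rho>0 by (rule mult_left_mono)
      then show "norm (\<rho> q * f (p - q)) \<le> norm (M * \<rho> q)"
        using M \<rho>0[of q] by (simp add: abs_mult mult.commute)
    qed
  qed simp
  define U where "U p = (\<integral>q. \<rho> q * f (p - q) \<partial>lborel)" for p
  have U0: "0 \<le> U p" for p unfolding U_def by (intro integral_nonneg_AE AE_I2 mult_nonneg_nonneg f \<rho>0)
  have UM: "U p \<le> M" for p
  proof -
    have "U p \<le> (\<integral>q. \<rho> q * M \<partial>lborel)" unfolding U_def
      by (intro integral_mono i\<rho>f integrable_mult_left i\<rho> mult_left_mono f \<rho>0)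
    then show ?thesis using \<rho>1 by simp
  qed
  have Uf: "\<bar>U p - f p\<bar> \<le> L * \<epsilon>" for p
  proof -
    have i2: "integrable lborel (\<lambda>q. \<rho> q * f p)" using i\<rho> by simp
    have "U p - f p = (\<integral>q. \<rho> q * f (p - q) - \<rho> q * f p \<partial>lborel)"
      unfolding U_def using \<rho>1 by (simp add: Bochner_Integration.integral_diff[OF i\<rho>f i2])
    also have "\<bar>\<dots>\<bar> \<le> (\<integral>q. \<rho> q * (L * \<epsilon>) \<partial>lborel)"
    proof (rule integral_abs_bound_integral)
      show "integrable lborel (\<lambda>q. \<rho> q * f (p - q) - \<rho> q * f p)"
        by (rule Bochner_Integration.integrable_diff[OF i\<rho>f i2])
      show "integrable lborel (\<lambda>q. \<rho> q * (L * \<epsilon>))" using i\<rho> by simp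
      fix q :: "'a \<times> real"
      show "\<bar>\<rho> q * f (p - q) - \<rho> q * f p\<bar> \<le> \<rho> q * (L * \<epsilon>)"
      proof (cases "\<epsilon> < norm q")
        case False
        have "\<bar>f (p - q) - f p\<bar> \<le> L * norm q" using L[of "p - q" p] by (simp add: dist_norm)
        also have "\<dots> \<le> L * \<epsilon>" using False L0 by (intro mult_left_mono) auto
        finally have "\<rho> q * \<bar>f (p - q) - f p\<bar> \<le> \<rho> q * (L * \<epsilon>)" using \<rho>0 by (rule mult_left_mono)
        then show ?thesis using \<rho>0[of q] by (simp add: right_diff_distrib[symmetric] abs_mult)
      qed (simp add: \<rho>z)
    qed
    also have "\<dots> = L * \<epsilon>" using \<rho>1 by simp
    finally show ?thesis .
  qed
  obtain gb :: "'a \<times> real \<Rightarrow> 'a \<times> real" and Hb where b: "D2on UNIV (bump \<epsilon>) gb Hb" "\<And>v. continuous_on UNIV (\<lambda>p. Hb p v)"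
    by (rule bump_D2on[of \<epsilon>]) (rule that)
  have D\<rho>: "D2on UNIV \<rho> (\<lambda>p. (1 / I) *\<^sub>R gb p) (\<lambda>p k. (1 / I) *\<^sub>R Hb p k)"
    using D2on_cmult[OF b(1), of "1 / I"] by (simp add: \<rho>_def[abs_def])
  have c\<rho>: "continuous_on UNIV (\<lambda>p. (1 / I) *\<^sub>R Hb p v)" for v by (intro continuous_intros b(2))
  \<comment> \<open>After reflection the translation sits on the kernel, which can be
    differentiated; the definition of \<open>U\<close> keeps it on \<open>f\<close>, to which
    \<open>heat_step\<close> applies.\<close>
  have Ueq: "U p = integral (cbox l u) (\<lambda>q. f q * \<rho> (p - q))" for p
  proof -
    define k where "k q = f q * \<rho> (p - q)" for q
    have [measurable]: "k \<in> borel_measurable borel" unfolding k_def by measurable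
    have e: "(\<lambda>q. k (p - q)) = (\<lambda>q. \<rho> q * f (p - q))" by (simp add: k_def mult.commute)
    have "integrable lborel k"
      using i\<rho>f[of p] unfolding e[symmetric] by (subst (asm) lborel_integral_reflect(2)) simp_all
    then have "integral (cbox l u) k = (\<integral>q. k q \<partial>lborel)" by (rule integral_cbox_lborel) (simp add: k_def fz)
    also have "\<dots> = (\<integral>q. k (p - q) \<partial>lborel)" by (rule lborel_integral_reflect(1)[symmetric]) simp
    also have "\<dots> = U p" by (simp only: e U_def)
    finally show ?thesis by (simp add: k_def[abs_def])
  qed
  define g where "g p = integral (cbox l u) (\<lambda>q. f q *\<^sub>R (1 / I) *\<^sub>R gb (p - q))" for p
  define H where "H p k = integral (cbox l u) (\<lambda>q. f q *\<^sub>R (1 / I) *\<^sub>R Hb (p - q) k)" for p k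
  have DU: "D2on UNIV U g H"
    unfolding Ueq[abs_def] g_def H_def
    by (rule D2on_convolution[where \<iota> = "\<lambda>q. q", OF _ cf _ _ _ D\<rho> c\<rho>]) (auto intro: continuous_on_id)
  have cU: "continuous_on S U" for S using continuous_on_subset[OF D2on_continuous[OF DU]] by auto
  have [measurable]: "U \<in> borel_measurable borel" by (rule borel_measurable_continuous_onI[OF cU])
  have "b * snd (g p) \<le> lap (H p)"
    if b: "b > 0" and v: "vsub (\<lambda>\<tau>. b * \<tau>) W f" and W: "cball p (2 * \<epsilon>) \<subseteq> W" for b W p
  proof -
    obtain x t where p: "p = (x, t)" by (cases p)
    \<comment> \<open>The constant of \<open>heat_step\<close> for a spatial ball of radius
      \<epsilon> / 2, common to all centres.\<close>
    define C where "C = M * ((4 + 2 * DIM('a)) / b)\<^sup>2 / (\<epsilon> / 2) ^ 4"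
    have step: "U (x, t + h) \<le> (\<integral>y. heatk b h y * U (x + y, t) \<partial>lborel) + C * h\<^sup>2" if h: "0 < h" "h < \<epsilon> / 2" for h
    proof -
      define G where "G q = (\<integral>y. heatk b h y * f ((x + y, t) - q) \<partial>lborel)" for q
      define k where "k = (\<lambda>z::('a \<times> real) \<times> 'a. \<rho> (fst z) * (heatk b h (snd z) * f ((x + snd z, t) - fst z)))"
      have ih: "integrable lborel (heatk b h :: 'a \<Rightarrow> real)" "(\<integral>y. heatk b h (y::'a) \<partial>lborel) = 1"
        by (rule heatk_0[OF b h(1)])+
      have ihf: "integrable lborel (\<lambda>y. heatk b h y * f ((x + y, t) - q))" for q
        by (rule heatk_mult_integrable[OF b h(1) _ fabs]) measurable
      have km [measurable]: "k \<in> borel_measurable (lborel \<Otimes>\<^sub>M lborel)"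
        unfolding k_def by measurable
      have "integrable (lborel \<Otimes>\<^sub>M lborel) (\<lambda>z::('a \<times> real) \<times> 'a. \<rho> (fst z) * heatk b h (snd z))"
      proof (rule lborel_pair.Fubini_integrable)
        show "AE q in lborel. integrable lborel (\<lambda>y::'a. \<rho> (fst (q, y)) * heatk b h (snd (q, y)))"
          using ih by simp
        show "integrable lborel (\<lambda>q. \<integral>y. norm (\<rho> (fst (q, y)) * heatk b h (snd (q, y::'a))) \<partial>lborel)"
          using i\<rho> ih by (simp add: abs_mult heatk_nonneg \<rho>0)
      qed measurable
      then have ik: "integrable (lborel \<Otimes>\<^sub>M lborel) k"
      proof (rule Bochner_Integration.integrable_bound[OF integrable_mult_right[of M] km])
        show "AE z in lborel \<Otimes>\<^sub>M lborel. norm (k z) \<le> norm (M * (\<rho> (fst z) * heatk b h (snd z)))"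
        proof (rule AE_I2)
          fix z :: "('a \<times> real) \<times> 'a"
          have "norm (k z) = (\<rho> (fst z) * heatk b h (snd z)) * f ((x + snd z, t) - fst z)"
            using f \<rho>0 by (simp add: k_def abs_mult heatk_nonneg)
          also have "\<dots> \<le> (\<rho> (fst z) * heatk b h (snd z)) * M"
            using f \<rho>0 by (intro mult_left_mono) (auto simp: heatk_nonneg)
          finally show "norm (k z) \<le> norm (M * (\<rho> (fst z) * heatk b h (snd z)))"
            using M \<rho>0 by (simp add: abs_mult heatk_nonneg mult.commute)
        qed
      qed
      have iG: "integrable lborel (\<lambda>q. \<rho> q * G q)"
        using lborel_pair.integrable_fst'[OF ik] by (simp add: k_def G_def)
      have "U (x, t + h) \<le> (\<integral>q. \<rho> q * G q + \<rho> q * (C * h\<^sup>2) \<partial>lborel)"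
        unfolding U_def
      proof (intro integral_mono i\<rho>f Bochner_Integration.integrable_add iG)
        show "integrable lborel (\<lambda>q. \<rho> q * (C * h\<^sup>2))" using i\<rho> by simp
        fix q :: "'a \<times> real"
        show "\<rho> q * f ((x, t + h) - q) \<le> \<rho> q * G q + \<rho> q * (C * h\<^sup>2)"
        proof (cases "\<epsilon> < norm q")
          case False
          obtain x' t' where q: "(x, t) - q = (x', t')" by (cases "(x, t) - q")
          have q': "(x, t + h) - q = (x', t' + h)" "(x + y, t) - q = (x' + y, t')" for y
            using q by (cases q; simp; fail)+
          \<comment> \<open>One \<epsilon> is spent on the translation by \<open>q\<close>, a second
            one on the cylinder, half in space and half in time; hence the radius 2 \<epsilon> in
            the statement.\<close>
          have sub: "cball x' (\<epsilon> / 2) \<times> {t'..t' + \<epsilon> / 2} \<subseteq> W"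
          proof (rule order_trans[OF _ W], rule subsetI)
            fix z assume "z \<in> cball x' (\<epsilon> / 2) \<times> {t'..t' + \<epsilon> / 2}"
            then obtain x2 t2 where z: "z = (x2, t2)" "dist x' x2 \<le> \<epsilon> / 2" "t' \<le> t2" "t2 \<le> t' + \<epsilon> / 2" by auto
            have "dist ((x, t) - q) z \<le> dist x' x2 + dist t' t2"
              unfolding q z(1) dist_Pair_Pair by (rule sqrt_sum_squares_le_sum) auto
            also have "\<dots> \<le> \<epsilon>" using z by (simp add: dist_real_def)
            finally have "dist ((x, t) - q) z \<le> \<epsilon>" .
            moreover have "dist p ((x, t) - q) = norm q" by (simp add: p dist_norm)
            ultimately have "dist p z \<le> 2 * \<epsilon>" using dist_triangle[of p z "(x, t) - q"] False by linarith
            then show "z \<in> cball p (2 * \<epsilon>)" by simp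
          qed
          have "f ((x, t + h) - q) \<le> G q + C * h\<^sup>2"
            unfolding q' G_def C_def
            by (rule heat_step[OF b f L supp v sub _ h]) (use e in auto)
          then have "\<rho> q * f ((x, t + h) - q) \<le> \<rho> q * (G q + C * h\<^sup>2)" using \<rho>0 by (rule mult_left_mono)
          then show ?thesis by (simp add: distrib_left)
        qed (simp add: \<rho>z)
      qed
      also have "\<dots> = (\<integral>q. \<rho> q * G q \<partial>lborel) + C * h\<^sup>2"
        using i\<rho> \<rho>1 by (simp add: Bochner_Integration.integral_add[OF iG])
      also have "(\<integral>q. \<rho> q * G q \<partial>lborel) = (\<integral>q. (\<integral>y. k (q, y) \<partial>lborel) \<partial>lborel)"
        by (simp add: k_def G_def)
      \<comment> \<open>Averaging over translations commutes with the Gaussian mean, so on the right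
        the averaged function reappears.\<close>
      also have "\<dots> = (\<integral>y. (\<integral>q. k (q, y) \<partial>lborel) \<partial>lborel)"
        by (rule lborel_pair.Fubini_integral[symmetric]) (simp add: ik)
      also have "\<dots> = (\<integral>y. heatk b h y * U (x + y, t) \<partial>lborel)"
      proof -
        have "k (q, y) = heatk b h y * (\<rho> q * f ((x + y, t) - q))" for q y by (simp add: k_def)
        then show ?thesis by (simp add: U_def)
      qed
      finally show ?thesis .
    qed
    define a where "a = fst (g p)"
    define A where "A y = fst (H p (y, 0))" for y
    have lH: "linear (H p)" by (rule D2on_linear[OF DU]) simp
    have A: "linear A" unfolding A_def
    proof (rule linearI)
      fix u v :: 'a and c :: real
      have "H p (u + v, 0) = H p (u, 0) + H p (v, 0)" using linear_add[OF lH, of "(u, 0)" "(v, 0)"] by simp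
      then show "fst (H p (u + v, 0)) = fst (H p (u, 0)) + fst (H p (v, 0))" by simp
      have "H p (c *\<^sub>R u, 0) = c *\<^sub>R H p (u, 0)" using linear_cmul[OF lH, of c "(u, 0)"] by simp
      then show "fst (H p (c *\<^sub>R u, 0)) = c *\<^sub>R fst (H p (u, 0))" by simp
    qed
    have lapA: "lap (H p) = (\<Sum>i\<in>Basis. A i \<bullet> i)" by (simp add: lap_def A_def inner_prod_def)
    have qd: "quad (U p) (g p) (H p) p (x + y, t) = U p + a \<bullet> y + A y \<bullet> y / 2" for y
      by (simp add: quad_def p a_def A_def inner_prod_def)
    obtain KA where KA: "KA > 0" "\<And>y. norm (A y) \<le> KA * norm y" using linear_bounded_pos[OF A] by blast
    have main: "b * snd (g p) \<le> lap (H p) + 2 * e' * DIM('a)" if e': "e' > 0" for e' :: real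
    proof -
      obtain d where d: "d > 0" "\<And>q. dist q p < d \<Longrightarrow> \<bar>U q - quad (U p) (g p) (H p) p q\<bar> \<le> e' * (norm (q - p))\<^sup>2"
        using Peano[OF open_UNIV _ DU, of p e'] e' unfolding eventually_nhds_metric by auto
      \<comment> \<open>At distance at least \<open>d\<close> the ratio \<theta> = |y| / d is at
        least 1, so its powers 0, 1 and 2 are at most its fourth power. The three summands absorb,
        in this order, the bound of \<open>U\<close>, the linear term and the quadratic
        term.\<close>
      define K where "K = M / d ^ 4 + norm a / d ^ 3 + KA / d\<^sup>2"
      have K: "K \<ge> 0" using M d KA by (simp add: K_def)
      have tay: "U (x + y, t) \<le> U p + a \<bullet> y + A y \<bullet> y / 2 + e' * (norm y)\<^sup>2 + K * norm y ^ 4" for y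
      proof (cases "norm y < d")
        case True
        then have "dist (x + y, t) p < d" by (simp add: p dist_norm norm_Pair)
        from d(2)[OF this] have "U (x + y, t) \<le> quad (U p) (g p) (H p) p (x + y, t) + e' * (norm ((x + y, t) - p))\<^sup>2" by linarith
        moreover have "0 \<le> K * norm y ^ 4" using K by simp
        ultimately show ?thesis unfolding qd by (simp add: p norm_Pair)
      next
        case False
        then have r: "norm y / d \<ge> 1" using d by simp
        define \<theta> where "\<theta> = norm y / d"
        have ny: "norm y = \<theta> * d" using d by (simp add: \<theta>_def)
        have p4: "1 \<le> \<theta> ^ 4" "\<theta> \<le> \<theta> ^ 4" "\<theta>\<^sup>2 \<le> \<theta> ^ 4"
          using r power_increasing[of 1 4 \<theta>] power_increasing[of 2 4 \<theta>] by (auto simp: \<theta>_def[symmetric] one_le_power)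
        have "U (x + y, t) \<le> M" by (rule UM)
        also have "\<dots> \<le> M * \<theta> ^ 4" using mult_left_mono[OF p4(1) M] by simp
        finally have 1: "U (x + y, t) \<le> M * \<theta> ^ 4" .
        have "- (a \<bullet> y) \<le> norm a * norm y" using Cauchy_Schwarz_ineq2[of a y] by linarith
        also have "\<dots> = norm a * d * \<theta>" by (simp add: ny)
        also have "\<dots> \<le> norm a * d * \<theta> ^ 4" using d p4 by (intro mult_left_mono) auto
        finally have 2: "- (a \<bullet> y) \<le> norm a * d * \<theta> ^ 4" .
        have "- (A y \<bullet> y / 2) \<le> norm (A y) * norm y" using Cauchy_Schwarz_ineq2[of "A y" y] by (auto intro: order_trans[of _ "\<bar>A y \<bullet> y\<bar>"])
        also have "\<dots> \<le> (KA * norm y) * norm y" using KA by (intro mult_right_mono) auto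
        also have "\<dots> = KA * d\<^sup>2 * \<theta>\<^sup>2" by (simp add: ny power2_eq_square)
        also have "\<dots> \<le> KA * d\<^sup>2 * \<theta> ^ 4" using KA p4 by (intro mult_left_mono) auto
        finally have 3: "- (A y \<bullet> y / 2) \<le> KA * d\<^sup>2 * \<theta> ^ 4" .
        have "K * norm y ^ 4 = M * \<theta> ^ 4 + norm a * d * \<theta> ^ 4 + KA * d\<^sup>2 * \<theta> ^ 4"
          unfolding ny K_def using d by (simp add: field_simps eval_nat_numeral)
        moreover have "0 \<le> e' * (norm y)\<^sup>2" using e' by simp
        ultimately show ?thesis using 1 2 3 U0[of p] by linarith
      qed
      define c4 where "c4 = 12 * K * (DIM('a))\<^sup>2 / b\<^sup>2 + C"
      have le: "(U (x, t + h) - U p) / h \<le> lap (H p) / b + 2 * e' * DIM('a) / b + c4 * h" if h: "0 < h" "h < \<epsilon> / 2" for h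
      proof -
        have "integrable lborel (\<lambda>y. heatk b h y * U (x + y, t))"
          by (rule heatk_mult_integrable[OF b h(1), of _ M]) (measurable, simp add: U0 UM)
        from heatk_taylor[OF b h(1) this A K tay]
        have "(\<integral>y. heatk b h y * U (x + y, t) \<partial>lborel) \<le> U p + h / b * lap (H p) + 2 * e' * DIM('a) * h / b
           + 12 * K * (DIM('a))\<^sup>2 * h\<^sup>2 / b\<^sup>2" by (simp add: lapA)
        with step[OF h] have "U (x, t + h) - U p \<le> h / b * lap (H p) + 2 * e' * DIM('a) * h / b
           + 12 * K * (DIM('a))\<^sup>2 * h\<^sup>2 / b\<^sup>2 + C * h\<^sup>2" by linarith
        also have "\<dots> = h * (lap (H p) / b + 2 * e' * DIM('a) / b + c4 * h)"
          by (simp add: c4_def algebra_simps power2_eq_square)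
        finally show ?thesis using h by (simp add: divide_le_eq mult.commute)
      qed
      have "(U has_derivative (\<lambda>k. g p \<bullet> k)) (at p)" using DU unfolding D2on_def by blast
      then have "(U has_derivative (\<lambda>k. g p \<bullet> k)) (at (x, t + 0))" by (simp add: p)
      moreover have "((\<lambda>h. (x, t + h)) has_derivative (\<lambda>h. (0, h))) (at 0)" by (auto intro!: derivative_eq_intros)
      ultimately have "((\<lambda>h. U (x, t + h)) has_derivative (\<lambda>h. g p \<bullet> (0, h))) (at 0)"
        using has_derivative_compose[of "\<lambda>h. (x, t + h)" "\<lambda>h. (0, h)" 0 UNIV U] by blast
      then have "((\<lambda>h. U (x, t + h)) has_real_derivative snd (g p)) (at 0)"
        by (simp add: has_field_derivative_def inner_prod_def)
      then have "((\<lambda>h. (U (x, t + h) - U p) / h) \<longlongrightarrow> snd (g p)) (at 0)"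
        by (simp add: has_field_derivative_iff p)
      \<comment> \<open>The inequality is known for positive \<open>h\<close> only; \<open>U\<close>
        being differentiable, the one-sided quotients already determine the time derivative.\<close>
      then have lim: "((\<lambda>h. (U (x, t + h) - U p) / h) \<longlongrightarrow> snd (g p)) (at_right 0)"
        by (rule filterlim_mono) (auto simp: at_le)
      have lim2: "((\<lambda>h. lap (H p) / b + 2 * e' * DIM('a) / b + c4 * h) \<longlongrightarrow> lap (H p) / b + 2 * e' * DIM('a) / b + c4 * 0) (at_right 0)"
        by (intro tendsto_intros)
      have "\<forall>\<^sub>F h in at_right 0. (U (x, t + h) - U p) / h \<le> lap (H p) / b + 2 * e' * DIM('a) / b + c4 * h"
        unfolding eventually_at_right_field using le e by (intro exI[of _ "\<epsilon> / 2"]) auto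
      from tendsto_le[OF trivial_limit_at_right_real lim2 lim this]
      have "snd (g p) \<le> (lap (H p) + 2 * e' * DIM('a)) / b" by (simp add: add_divide_distrib)
      then show ?thesis using b by (simp add: pos_le_divide_eq mult.commute)
    qed
    show ?thesis
    proof (rule field_le_epsilon)
      fix r :: real assume r: "r > 0"
      show "b * snd (g p) \<le> lap (H p) + r" using main[of "r / (2 * DIM('a))"] r by simp
    qed
  qed
  then show ?thesis by (rule that[OF DU Uf])
qed

section \<open>Comparison with a classical supersolution\<close>

definition bflux :: "real \<Rightarrow> real \<Rightarrow> real \<Rightarrow> real"
  where "bflux bm bp s = max (bm * s) (bp * s)"

lemma bflux_eq: "0 < bm \<Longrightarrow> bm < bp \<Longrightarrow> bflux bm bp s = b_coeff bm bp s * s"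
  by (auto simp: bflux_def b_coeff_def max_def mult_le_cancel_right)

lemma bflux_continuous: "continuous_on UNIV (bflux bm bp)"
  unfolding bflux_def[abs_def] by (intro continuous_intros)

lemma bflux_refl_continuous: "continuous_on UNIV (\<lambda>s. - bflux bm bp (- s))"
  unfolding bflux_def by (intro continuous_intros)

lemma bflux_strict_mono:
  assumes "0 < bm" "bm < bp"
  shows "strict_mono (bflux bm bp)"
proof (rule strict_monoI)
  fix x y :: real assume "x < y"
  then have "bm * x < bm * y" "bp * x < bp * y" using assms by auto
  then show "bflux bm bp x < bflux bm bp y" unfolding bflux_def by linarith
qed

text \<open>Suppose the penalised difference \<Phi> is positive somewhere. A compact superlevel set
  of \<Phi> lies inside the cylinder; near it \<open>u\<close> is replaced by its smooth
  regularisation \<open>U\<close>. There \<Psi> - U is a strict classical supersolution for the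
  reflected flux, so - v - (\<Psi> - U) attains its maximum on the boundary of the neighbourhood,
  where its values are too small.\<close>

lemma core_comparison:
  fixes u v :: "'a::euclidean_space \<times> real \<Rightarrow> real"
  assumes \<Omega>: "open \<Omega>" "bounded \<Omega>" and bm: "0 < bm" "0 < bp"
    and u: "usc_on (closure \<Omega> \<times> {0..T}) u" "\<And>p. p \<in> closure \<Omega> \<times> {0..T} \<Longrightarrow> \<bar>u p\<bar> \<le> M"
      "vsub (bflux bm bp) (\<Omega> \<times> {0<..<T}) u"
    and v: "usc_on (closure \<Omega> \<times> {0..T}) (\<lambda>p. - v p)" "\<And>p. p \<in> closure \<Omega> \<times> {0..T} \<Longrightarrow> \<bar>v p\<bar> \<le> M"
      "vsub (\<lambda>s. - bflux bm bp (- s)) (\<Omega> \<times> {0<..<T}) (\<lambda>p. - v p)"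
    and s0: "0 \<le> s0" "s0 < T"
    and \<psi>: "D2on (\<Omega> \<times> {s0<..<T}) \<psi> g H" "continuous_on (closure \<Omega> \<times> {s0..T}) \<psi>"
      "\<And>p. p \<in> \<Omega> \<times> {s0<..<T} \<Longrightarrow> lap (H p) \<le> bm * snd (g p)"
      "\<And>p. p \<in> \<Omega> \<times> {s0<..<T} \<Longrightarrow> lap (H p) \<le> bp * snd (g p)"
    and init: "\<And>x. x \<in> closure \<Omega> \<Longrightarrow> u (x, s0) - v (x, s0) \<le> \<psi> (x, s0)"
    and lat: "\<And>x t. x \<in> frontier \<Omega> \<Longrightarrow> s0 \<le> t \<Longrightarrow> t < T \<Longrightarrow> u (x, t) - v (x, t) \<le> \<psi> (x, t)"
    and x: "x \<in> closure \<Omega>" and t: "s0 \<le> t" "t < T"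
  shows "u (x, t) - v (x, t) \<le> \<psi> (x, t)"
proof (rule ccontr)
  assume neg: "\<not> u (x, t) - v (x, t) \<le> \<psi> (x, t)"
  let ?D = "closure \<Omega> \<times> {0..T}"
  let ?W = "\<Omega> \<times> {0<..<T}"
  define m0 where "m0 = u (x, t) - v (x, t) - \<psi> (x, t)"
  have m0: "m0 > 0" using neg by (simp add: m0_def)
  have uv: "usc_on ?D (\<lambda>p. u p + - v p)" by (rule usc_on_add[OF u(1) v(1)])
  have cD: "compact ?D" "compact (closure \<Omega> \<times> {s0..T})" using \<Omega> by (auto intro!: compact_Times)
  have sD: "closure \<Omega> \<times> {s0..T} \<subseteq> ?D" using s0 by auto
  obtain z where z: "\<forall>q\<in>closure \<Omega> \<times> {s0..T}. u q + - v q - \<psi> q \<le> u z + - v z - \<psi> z"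
    using usc_on_attains_max[OF cD(2) _ usc_on_diff[OF usc_on_subset[OF uv sD] \<psi>(2)]] x t by fastforce
  define B where "B = max 1 (u z + - v z - \<psi> z)"
  have B: "B > 0" "\<And>q. q \<in> closure \<Omega> \<times> {s0..T} \<Longrightarrow> u q - v q - \<psi> q \<le> B" using z by (auto simp: B_def max.coboundedI2)
  \<comment> \<open>The penalty works as in \<open>classical_comparison\<close>: it costs half the
    excess at the given point and keeps the superlevel set below time T - \<kappa>.\<close>
  define \<eta> where "\<eta> = m0 * (T - t) / 2"
  have \<eta>: "\<eta> > 0" using m0 t by (simp add: \<eta>_def)
  define \<kappa> where "\<kappa> = min (T - t) (\<eta> / B)"
  have \<kappa>: "\<kappa> > 0" "\<kappa> \<le> T - t" "B \<le> \<eta> / \<kappa>" using \<eta> B t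
    by (auto simp: \<kappa>_def min_def field_simps)
  define Kc where "Kc = closure \<Omega> \<times> {s0..T - \<kappa>}"
  define V where "V = \<Omega> \<times> {s0<..<T - \<kappa>}"
  define \<Psi> where "\<Psi> p = \<psi> p + \<eta> / (T - snd p)" for p :: "'a \<times> real"
  define \<Phi> where "\<Phi> p = u p + - v p - \<Psi> p" for p
  have VK: "V \<subseteq> Kc" "open V" "compact Kc" "Kc \<subseteq> closure \<Omega> \<times> {s0..T}" "Kc \<subseteq> ?D" "V \<subseteq> \<Omega> \<times> {s0<..<T}" "V \<subseteq> UNIV \<times> {..<T}" "V \<subseteq> ?W"
    using \<Omega> \<kappa> closure_subset[of \<Omega>] s0 by (auto simp: Kc_def V_def intro!: compact_Times open_Times)
  have c\<Psi>: "continuous_on Kc \<Psi>"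
    unfolding \<Psi>_def by (intro continuous_intros continuous_on_subset[OF \<psi>(2) VK(4)]) (use \<kappa> in \<open>auto simp: Kc_def\<close>)
  have usc\<Phi>: "usc_on Kc \<Phi>" unfolding \<Phi>_def[abs_def]
    by (rule usc_on_diff[OF usc_on_subset[OF uv VK(5)] c\<Psi>])
  \<comment> \<open>The value of \<Phi> at the given point is 2 m, and off the superlevel set it is
    below \<open>m\<close>. Regularisation costs m / 3 at each of the two points that are compared,
    and 2 m - m / 3 still exceeds m + m / 3.\<close>
  define m where "m = m0 / 4"
  have m: "m > 0" using m0 by (simp add: m_def)
  define ps where "ps = (x, t)"
  have \<Phi>ps: "\<Phi> ps = 2 * m"
  proof -
    have "\<eta> / (T - t) = m0 / 2" using t by (simp add: \<eta>_def divide_eq_eq del: right_diff_distrib_numeral)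
    moreover have "\<Phi> ps = m0 - \<eta> / (T - t)" by (simp add: \<Phi>_def \<Psi>_def m0_def ps_def)
    ultimately show ?thesis by (simp add: m_def)
  qed
  define K where "K = {p\<in>Kc. m \<le> \<Phi> p}"
  have K: "compact K" unfolding K_def by (rule usc_on_superlevel_compact[OF VK(3) usc\<Phi>])
  have psK: "ps \<in> K" using x t \<kappa> \<Phi>ps m by (auto simp: K_def Kc_def ps_def)
  have KV: "K \<subseteq> V"
  proof
    fix p assume "p \<in> K"
    then have p: "p \<in> Kc" "m \<le> \<Phi> p" by (auto simp: K_def)
    obtain y r where pyr: "p = (y, r)" by (cases p)
    have r: "y \<in> closure \<Omega>" "s0 \<le> r" "r \<le> T - \<kappa>" using p by (auto simp: Kc_def pyr)
    have "\<eta> / (T - r) \<ge> 0" using r \<kappa> \<eta> by simp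
    then have gt: "u (y, r) - v (y, r) > \<psi> (y, r)" using p m by (simp add: \<Phi>_def \<Psi>_def pyr)
    then have "y \<notin> frontier \<Omega>" "r \<noteq> s0" using lat[of y r] init[of y] r \<kappa> by (auto simp: not_less)
    moreover have "r \<noteq> T - \<kappa>"
    proof
      assume "r = T - \<kappa>"
      then have "\<Phi> p = u p - v p - \<psi> p - \<eta> / \<kappa>" by (simp add: \<Phi>_def \<Psi>_def pyr)
      also have "\<dots> \<le> B - \<eta> / \<kappa>" using B(2)[of p] VK p by (intro diff_right_mono) auto
      finally show False using p m \<kappa> by linarith
    qed
    ultimately show "p \<in> V" using r \<Omega> by (auto simp: V_def pyr frontier_def interior_open)
  qed
  obtain e where e: "e > 0" "(\<Union>y\<in>K. ball y e) \<subseteq> V"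
    by (rule compact_subset_open_imp_ball_epsilon_subset[OF K VK(2) KV])
  have Kne: "K \<noteq> {}" using psK by auto
  \<comment> \<open>One third of the margin \<open>e\<close> is used for the neighbourhood; another
    third remains around each of its points and must hold the radius of the mollifier and that of
    the sup-convolution.\<close>
  define K' where "K' = {q. infdist q K \<le> e / 3}"
  define V' where "V' = {q. infdist q K < e / 3}"
  have room: "cball q (e / 3) \<subseteq> V" if "q \<in> K'" for q
  proof
    fix w assume w: "w \<in> cball q (e / 3)"
    obtain y where y: "y \<in> K" "infdist q K = dist q y"
      using infdist_attains_inf[OF compact_imp_closed[OF K] Kne, of q] by auto
    have "dist y w \<le> dist q y + dist q w" by (metis dist_triangle2 dist_commute)
    also have "\<dots> < e" using that w y e by (auto simp: K'_def)
    finally have "w \<in> ball y e" by simp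
    then show "w \<in> V" using y(1) e(2) by blast
  qed
  have K'V: "K' \<subseteq> V"
  proof
    fix q assume "q \<in> K'"
    moreover have "q \<in> cball q (e / 3)" using e(1) by simp
    ultimately show "q \<in> V" using room by blast
  qed
  have oV': "open V'" unfolding V'_def by (intro open_Collect_less continuous_intros)
  have V'K': "V' \<subseteq> K'" by (auto simp: V'_def K'_def)
  have cK': "compact K'"
  proof -
    have "closed K'" unfolding K'_def by (intro closed_Collect_le continuous_intros)
    moreover have "bounded K'"
      by (rule bounded_subset[OF compact_imp_bounded[OF VK(3)] order_trans[OF K'V VK(1)]])
    ultimately show ?thesis by (simp add: compact_eq_bounded_closed)
  qed
  define S where "S = K' - V'"
  have cS: "compact S" unfolding S_def using cK' oV' by (rule compact_diff)
  have SKc: "S \<subseteq> Kc" using K'V VK by (auto simp: S_def)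
  have S\<Phi>: "\<Phi> y < m" if "y \<in> S" for y
  proof -
    have "y \<notin> K" using that e by (auto simp: S_def V'_def)
    then show ?thesis using that SKc by (auto simp: K_def)
  qed
  \<comment> \<open>The sup-convolution takes the value of \<open>u\<close> at a nearby point
    \<open>q\<close> instead of at \<open>y\<close>. Pairs (q, y) for which this would lift the
    difference to \<open>m\<close> form a compact set off the diagonal, hence are at least
    \<open>d1\<close> apart. Semicontinuity of the sum on the product thus replaces uniform
    continuity of \<open>u\<close>.\<close>
  define Cc where "Cc = {z\<in>?D \<times> S. m \<le> u (fst z) + (- v (snd z) - \<Psi> (snd z))}"
  have "compact Cc" unfolding Cc_def
  proof (rule usc_on_superlevel_compact)
    show "compact (?D \<times> S)" by (rule compact_Times[OF cD(1) cS])
    have "usc_on S (\<lambda>y. - v y - \<Psi> y)"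
      using SKc VK by (intro usc_on_diff usc_on_subset[OF v(1)] continuous_on_subset[OF c\<Psi>]) auto
    then have "usc_on (?D \<times> S) (\<lambda>z. - v (snd z) - \<Psi> (snd z))"
      by (rule usc_on_compose[where f = snd]) (auto intro!: continuous_intros)
    moreover have "usc_on (?D \<times> S) (\<lambda>z. u (fst z))"
      by (rule usc_on_compose[OF u(1), where f = fst]) (auto intro!: continuous_intros)
    ultimately show "usc_on (?D \<times> S) (\<lambda>z. u (fst z) + (- v (snd z) - \<Psi> (snd z)))"
      by (rule usc_on_add[rotated])
  qed
  have Cdiag: "dist (fst z) (snd z) > 0" if "z \<in> Cc" for z
  proof -
    have "fst z \<noteq> snd z"
    proof
      assume "fst z = snd z"
      then have "m \<le> \<Phi> (snd z)" "snd z \<in> S" using that by (auto simp: Cc_def \<Phi>_def)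
      then show False using S\<Phi>[of "snd z"] by simp
    qed
    then show ?thesis by simp
  qed
  obtain d1 where d1: "d1 > 0" "\<And>z. z \<in> Cc \<Longrightarrow> d1 \<le> dist (fst z) (snd z)"
  proof (cases "Cc = {}")
    case False
    have "continuous_on Cc (\<lambda>z. dist (fst z) (snd z))" by (intro continuous_intros)
    from continuous_attains_inf[OF \<open>compact Cc\<close> False this] obtain z0 where
      "z0 \<in> Cc" "\<forall>z\<in>Cc. dist (fst z0) (snd z0) \<le> dist (fst z) (snd z)" by blast
    then show ?thesis using that[of "dist (fst z0) (snd z0)"] Cdiag by blast
  qed (use that[of 1] in auto)
  \<comment> \<open>The shifted function u + (M + 1) takes values between 1 and 2 M + 1, the range
    that \<open>sup_convolution\<close> asks for.\<close>
  define R where "R = 2 * M + 1"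
  have "\<bar>u ps\<bar> \<le> M" using psK VK by (intro u(2)) (auto simp: K_def)
  then have M0: "M \<ge> 0" by linarith
  then have R: "R > 0" by (simp add: R_def)
  \<comment> \<open>The distance allowed to the maximisers of the sup-convolution: below
    \<open>d1\<close>, so that no bad pair occurs, and at most e / 9. The slope \<open>n\<close> is
    then R / r1.\<close>
  define r1 where "r1 = min (d1 / 2) (e / 9)"
  have r1: "r1 > 0" "r1 < d1" "r1 \<le> e / 9" using d1 e by (auto simp: r1_def)
  define n where "n = R / r1"
  have n: "n > 0" "R / n = r1" using R r1 by (auto simp: n_def)
  have Dne: "?D \<noteq> {}" using psK VK by (auto simp: K_def)
  have WD: "open ?W" "?W \<subseteq> ?D" using \<Omega> closure_subset[of \<Omega>] by (auto intro: open_Times)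
  have u1: "1 \<le> u q + (M + 1) \<and> u q + (M + 1) \<le> R" if "q \<in> ?D" for q using u(2)[OF that] by (auto simp: R_def)
  have vs: "vsub (bflux bm bp) ?W (\<lambda>p. u p + (M + 1))" using u(3) by (simp add: vsub_add_const)
  have usc1: "usc_on ?D (\<lambda>p. u p + (M + 1))"
    by (intro usc_on_add u(1) usc_on_continuous continuous_intros)
  obtain f where f: "\<And>p. 0 \<le> f p" "\<And>p. f p \<le> R" "\<And>p q. \<bar>f p - f q\<bar> \<le> n * dist p q"
    "\<exists>B. \<forall>p. B < norm p \<longrightarrow> f p = 0" "\<And>p. p \<in> ?D \<Longrightarrow> u p + (M + 1) \<le> f p"
    "\<And>p. p \<in> ?D \<Longrightarrow> \<exists>q\<in>?D. dist p q \<le> R / n \<and> f p \<le> u q + (M + 1)"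
    "vsub (bflux bm bp) {p. cball p (R / n) \<subseteq> ?W} f"
    by (rule sup_convolution[OF cD(1) Dne usc1 u1 n(1) WD vs]) (assumption | rule that)+
  obtain Bf where Bf: "\<And>p. Bf < norm p \<Longrightarrow> f p = 0" using f(4) by blast
  have fS: "f y - (M + 1) - v y - \<Psi> y < m" if y: "y \<in> S" for y
  proof -
    have yD: "y \<in> ?D" using y SKc VK by auto
    obtain q where q: "q \<in> ?D" "dist y q \<le> r1" "f y \<le> u q + (M + 1)" using f(6)[OF yD] n by auto
    have "(q, y) \<notin> Cc" using d1(2)[of "(q, y)"] q r1 by (auto simp: dist_commute)
    then have "u q + (- v y - \<Psi> y) < m" using q y by (auto simp: Cc_def)
    then show ?thesis using q by linarith
  qed
  define \<epsilon> where "\<epsilon> = min (e / 18) (m / (3 * n))"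
  have \<epsilon>: "\<epsilon> > 0" "2 * \<epsilon> \<le> e / 9" "n * \<epsilon> \<le> m / 3"
  proof -
    show "\<epsilon> > 0" "2 * \<epsilon> \<le> e / 9" using e m n by (auto simp: \<epsilon>_def)
    have "n * \<epsilon> \<le> n * (m / (3 * n))" using n by (intro mult_left_mono) (auto simp: \<epsilon>_def)
    then show "n * \<epsilon> \<le> m / 3" using n by simp
  qed
  obtain U gU HU where U: "D2on UNIV U gU HU" "\<And>p. \<bar>U p - f p\<bar> \<le> n * \<epsilon>"
    "\<And>b W p. b > 0 \<Longrightarrow> vsub (\<lambda>\<tau>. b * \<tau>) W f \<Longrightarrow> cball p (2 * \<epsilon>) \<subseteq> W \<Longrightarrow> b * snd (gU p) \<le> lap (HU p)"
    by (rule mollify[OF f(1,2,3) Bf \<epsilon>(1)]) (assumption | rule that)+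
  have Usub: "bm * snd (gU p) \<le> lap (HU p)" "bp * snd (gU p) \<le> lap (HU p)" if p: "p \<in> V'" for p
  proof -
    have "cball p (2 * \<epsilon>) \<subseteq> {p. cball p (R / n) \<subseteq> ?W}"
    proof (intro subsetI CollectI)
      fix q w assume q: "q \<in> cball p (2 * \<epsilon>)" and w: "w \<in> cball q (R / n)"
      have "dist p w \<le> dist p q + dist q w" by (rule dist_triangle)
      also have "\<dots> \<le> e / 3" using q w \<epsilon> r1 n e by auto
      finally have "w \<in> cball p (e / 3)" by simp
      moreover have "p \<in> K'" using p V'K' by blast
      ultimately have "w \<in> V" using room by blast
      then show "w \<in> ?W" using VK by auto
    qed
    moreover have "vsub (\<lambda>\<tau>. bm * \<tau>) {p. cball p (R / n) \<subseteq> ?W} f" "vsub (\<lambda>\<tau>. bp * \<tau>) {p. cball p (R / n) \<subseteq> ?W} f"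
      by (rule vsub_mono[OF f(7) order_refl], simp add: bflux_def)+
    ultimately show "bm * snd (gU p) \<le> lap (HU p)" "bp * snd (gU p) \<le> lap (HU p)"
      using U(3) bm by blast+
  qed
  have V'V: "V' \<subseteq> V" using V'K' K'V by auto
  have D\<Psi>: "D2on V' \<Psi> (\<lambda>p. g p + (0, \<eta> / (T - snd p)^2)) (\<lambda>p k. H p k + (0, (2 * \<eta> / (T - snd p)^3) * snd k))"
    unfolding \<Psi>_def
    by (rule D2on_add[OF D2on_subset[OF \<psi>(1)] D2on_subset[OF D2on_recip]]) (use V'V VK in auto)
  note D = D2on_diff[OF D\<Psi> D2on_subset[OF U(1) subset_UNIV]]
  have "\<exists>y\<in>K' - V'. - v ps - (\<Psi> ps - U ps) \<le> - v y - (\<Psi> y - U y)"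
  proof (rule max_off_strict[OF bflux_refl_continuous cK' oV' V'K' _ _ D])
    show "vsub (\<lambda>s. - bflux bm bp (- s)) V' (\<lambda>p. - v p)"
      using V'V VK by (intro vsub_mono[OF v(3)]) auto
    have cU: "continuous_on K' U" using continuous_on_subset[OF D2on_continuous[OF U(1)]] by auto
    show "usc_on K' (\<lambda>p. - v p - (\<Psi> p - U p))"
      using K'V VK by (intro usc_on_diff usc_on_subset[OF v(1)] continuous_on_diff continuous_on_subset[OF c\<Psi>] cU) auto
    show "ps \<in> K'" using psK e by (simp add: K'_def)
    fix p assume p: "p \<in> V'"
    have pW: "p \<in> \<Omega> \<times> {s0<..<T}" using p V'V VK by auto
    define c where "c = \<eta> / (T - snd p)^2"
    have c: "c > 0" using \<eta> pW by (auto simp: c_def)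
    have "lap (\<lambda>k. H p k + (0, (2 * \<eta> / (T - snd p)^3) * snd k) - HU p k) = lap (H p) - lap (HU p)"
      by (simp only: lap_diff lap_add lap_snd add_0_right)
    \<comment> \<open>Strictness is checked for each diffusivity separately; the larger of the two
      expressions is the flux. The positive amount \<open>c\<close>, the time derivative of the
      penalty, makes both inequalities strict.\<close>
    moreover have "bm * (snd (gU p) - (snd (g p) + c)) < lap (HU p) - lap (H p)"
    proof -
      have "bm * c > 0" using bm c by simp
      then show ?thesis using Usub(1)[OF p] \<psi>(3)[OF pW] by (simp add: algebra_simps)
    qed
    moreover have "bp * (snd (gU p) - (snd (g p) + c)) < lap (HU p) - lap (H p)"
    proof -
      have "bp * c > 0" using bm c by simp
      then show ?thesis using Usub(2)[OF p] \<psi>(4)[OF pW] by (simp add: algebra_simps)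
    qed
    moreover have e: "- (snd (g p + (0, \<eta> / (T - snd p)\<^sup>2) - gU p)) = snd (gU p) - (snd (g p) + c)" by (simp add: c_def)
    ultimately show "lap (\<lambda>k. H p k + (0, (2 * \<eta> / (T - snd p)^3) * snd k) - HU p k)
      < - bflux bm bp (- snd (g p + (0, \<eta> / (T - snd p)\<^sup>2) - gU p))"
      unfolding bflux_def e by linarith
  qed
  then obtain y where y: "y \<in> S" "- v ps - (\<Psi> ps - U ps) \<le> - v y - (\<Psi> y - U y)" by (auto simp: S_def)
  have "u ps + (M + 1) \<le> f ps" using psK VK by (intro f(5)) (auto simp: K_def)
  then show False using fS[OF y(1)] y(2) U(2)[of ps] U(2)[of y] \<Phi>ps \<epsilon>(3) m by (simp add: \<Phi>_def)
qed

section \<open>Barriers at the corners\<close>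

lemma D2on_comp_linear:
  assumes d: "D2on UNIV \<phi> g H" and P: "linear P" and s: "\<And>a b. P a \<bullet> b = a \<bullet> P b"
  shows "D2on UNIV (\<lambda>x. \<phi> (P x)) (\<lambda>x. P (g (P x))) (\<lambda>x k. P (H (P x) (P k)))"
  unfolding D2on_def
proof (intro ballI conjI)
  fix x
  have bP: "bounded_linear P" using P by (simp add: linear_conv_bounded_linear)
  have dP: "(P has_derivative P) (at x)" by (rule bounded_linear_imp_has_derivative[OF bP])
  have d1: "(\<phi> has_derivative (\<lambda>k. g (P x) \<bullet> k)) (at (P x))" "(g has_derivative H (P x)) (at (P x))"
    using d by (auto simp: D2on_def)
  show "((\<lambda>x. \<phi> (P x)) has_derivative (\<bullet>) (P (g (P x)))) (at x)"
    using has_derivative_compose[OF dP d1(1)] by (rule has_derivative_eq_rhs) (simp add: s fun_eq_iff)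
  show "((\<lambda>x. P (g (P x))) has_derivative (\<lambda>k. P (H (P x) (P k)))) (at x)"
    by (rule bounded_linear.has_derivative[OF bP has_derivative_compose[OF dP d1(2)]])
qed

text \<open>The projection kills \<nu>, so the derivative of the defining function along \<nu> is
  exactly 1, and its gradient has norm at least 1 everywhere. It can thus stand in for the distance
  to the boundary.\<close>

lemma graph_function:
  fixes \<nu> :: "'a::euclidean_space"
  assumes \<nu>: "norm \<nu> = 1" and \<gamma>: "smooth_on UNIV \<gamma>"
  obtains G H where "D2on UNIV (\<lambda>x. x \<bullet> \<nu> - \<gamma> (x - (x \<bullet> \<nu>) *\<^sub>R \<nu>)) G H" "\<And>x. 1 \<le> norm (G x)"
    "continuous_on UNIV (\<lambda>x. \<Sum>i\<in>Basis. H x i \<bullet> i)"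
proof -
  define P where "P x = x - (x \<bullet> \<nu>) *\<^sub>R \<nu>" for x :: 'a
  have P: "linear P" unfolding P_def by (rule linearI) (simp_all add: inner_add_left scaleR_add_left scaleR_diff_right)
  have s: "P a \<bullet> b = a \<bullet> P b" for a b by (simp add: P_def inner_diff_left inner_diff_right inner_commute)
  have P\<nu>: "P \<nu> = 0" using \<nu> by (simp add: P_def dot_square_norm)
  obtain g H where gH: "D2on UNIV \<gamma> g H" "\<And>v w. continuous_on UNIV (\<lambda>p. H p v \<bullet> w)"
    by (rule smooth_on_D2on[OF \<gamma>]) (rule that)
  have D: "D2on UNIV (\<lambda>x. \<nu> \<bullet> x - \<gamma> (P x)) (\<lambda>x. \<nu> - P (g (P x))) (\<lambda>x k. 0 - P (H (P x) (P k)))"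
    by (rule D2on_diff[OF D2on_inner D2on_comp_linear[OF gH(1) P s]])
  show ?thesis
  proof (rule that)
    show "D2on UNIV (\<lambda>x. x \<bullet> \<nu> - \<gamma> (x - (x \<bullet> \<nu>) *\<^sub>R \<nu>)) (\<lambda>x. \<nu> - P (g (P x))) (\<lambda>x k. 0 - P (H (P x) (P k)))"
      using D by (simp add: P_def inner_commute)
    show "1 \<le> norm (\<nu> - P (g (P x)))" for x
    proof -
      have "\<nu> \<bullet> (\<nu> - P (g (P x))) = 1" using \<nu> by (simp add: inner_diff_right s[symmetric] P\<nu> dot_square_norm)
      then show ?thesis using norm_cauchy_schwarz[of \<nu> "\<nu> - P (g (P x))"] \<nu> by simp
    qed
    have cP: "continuous_on UNIV P" using P linear_continuous_on linear_conv_bounded_linear by blast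
    have c: "continuous_on UNIV (\<lambda>x. H (P x) (P i) \<bullet> P i)" for i
      by (rule continuous_on_compose2[OF gH(2) cP]) auto
    show "continuous_on UNIV (\<lambda>x. \<Sum>i\<in>Basis. (0 - P (H (P x) (P i))) \<bullet> i)"
      by (simp add: s sum_negf) (intro continuous_on_minus continuous_on_sum c)
  qed
qed

lemma trace_outer: "(\<Sum>i\<in>Basis. ((a \<bullet> i) *\<^sub>R c) \<bullet> i) = a \<bullet> (c::'a::euclidean_space)"
  by (simp add: sum_inner_Basis_sq)

lemma trace_scale_id: "(\<Sum>i\<in>Basis. (c *\<^sub>R i) \<bullet> (i::'a::euclidean_space)) = c * DIM('a)"
  by (simp add: inner_Basis mult.commute)

lemma frontier_graph_zero:
  fixes \<Omega> :: "'a::euclidean_space set"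
  assumes \<Omega>: "open \<Omega>" and g: "continuous_on UNIV g" and loc: "\<Omega> \<inter> ball x0 r = {x \<in> ball x0 r. g x > 0}"
    and x: "x \<in> frontier \<Omega>" "x \<in> ball x0 r"
  shows "g x = (0::real)"
proof (rule antisym)
  have "x \<notin> \<Omega>" using x \<Omega> by (simp add: frontier_def interior_open)
  then show "g x \<le> 0" using loc x by force
  show "g x \<ge> 0"
  proof (rule ccontr)
    assume "\<not> g x \<ge> 0"
    then have "x \<in> ball x0 r \<inter> {y. g y < 0}" using x by auto
    moreover have "open (ball x0 r \<inter> {y. g y < 0})"
      using g by (intro open_Int open_ball open_Collect_less continuous_intros) auto
    moreover have "x \<in> closure \<Omega>" using x by (simp add: frontier_def)
    ultimately have "ball x0 r \<inter> {y. g y < 0} \<inter> \<Omega> \<noteq> {}" using open_Int_closure_eq_empty by blast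
    then show False using loc by force
  qed
qed

text \<open>\<open>Q\<close> is the square of the graph function \<open>g\<close> plus a fourth
  power that vanishes in the ball and confines the zeros of \<open>Q\<close> to its closure. A
  square satisfies |grad Q|^2 \<le> C Q, and near its zeros its Laplacian is close to 2 |grad g|^2,
  which is at least 2. These are the two properties that a Gaussian-type barrier needs.\<close>

lemma corner_function:
  fixes \<Omega> :: "'a::euclidean_space set"
  assumes \<Omega>: "open \<Omega>" "bounded \<Omega>" "smooth_boundary \<Omega>" and z: "z \<in> frontier \<Omega>"
  obtains r Q G H C q0 where "r > 0" "D2on UNIV Q G H" "\<And>x. 0 \<le> Q x"
    "\<And>x. x \<in> frontier \<Omega> \<Longrightarrow> x \<in> ball z r \<Longrightarrow> Q x = 0" "C > 0" "q0 > 0"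
    "\<And>x. x \<in> closure \<Omega> \<Longrightarrow> (norm (G x))\<^sup>2 \<le> C * Q x"
    "\<And>x. x \<in> closure \<Omega> \<Longrightarrow> - C \<le> (\<Sum>i\<in>Basis. H x i \<bullet> i)"
    "\<And>x. x \<in> closure \<Omega> \<Longrightarrow> Q x < q0 \<Longrightarrow> 1 \<le> (\<Sum>i\<in>Basis. H x i \<bullet> i)"
proof -
  from \<Omega>(3) z obtain r0 \<nu> \<gamma> where r0: "r0 > 0" and \<nu>: "norm \<nu> = 1" and \<gamma>: "smooth_on UNIV \<gamma>"
    and loc: "\<Omega> \<inter> ball z r0 = {x \<in> ball z r0. x \<bullet> \<nu> > \<gamma> (x - (x \<bullet> \<nu>) *\<^sub>R \<nu>)}"
    unfolding smooth_boundary_def by blast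
  define g where "g x = x \<bullet> \<nu> - \<gamma> (x - (x \<bullet> \<nu>) *\<^sub>R \<nu>)" for x
  obtain Gg Hg where gr: "D2on UNIV (\<lambda>x. x \<bullet> \<nu> - \<gamma> (x - (x \<bullet> \<nu>) *\<^sub>R \<nu>)) Gg Hg" "\<And>x. 1 \<le> norm (Gg x)"
    "continuous_on UNIV (\<lambda>x. \<Sum>i\<in>Basis. Hg x i \<bullet> i)"
    by (rule graph_function[OF \<nu> \<gamma>]) (rule that)
  have g: "D2on UNIV g Gg Hg" "\<And>x. 1 \<le> norm (Gg x)" "continuous_on UNIV (\<lambda>x. \<Sum>i\<in>Basis. Hg x i \<bullet> i)"
    using gr unfolding g_def[abs_def] .
  have loc': "\<Omega> \<inter> ball z r0 = {x \<in> ball z r0. g x > 0}" using loc by (simp add: g_def)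
  have cg: "continuous_on S g" "continuous_on S Gg" for S
    using continuous_on_subset[OF D2on_continuous[OF g(1)]] continuous_on_subset[OF D2on_continuous_gradient[OF g(1)]] by auto
  have comp: "compact (closure \<Omega>)" using \<Omega> by simp
  have bd: "\<exists>B>0. \<forall>x\<in>closure \<Omega>. \<bar>k x\<bar> \<le> B" if "continuous_on (closure \<Omega>) k" for k :: "'a \<Rightarrow> real"
  proof -
    have "bounded (k ` closure \<Omega>)" using compact_continuous_image[OF that comp] by (rule compact_imp_bounded)
    then show ?thesis unfolding bounded_pos by auto
  qed
  obtain B1 where B1: "B1 > 0" "\<And>x. x \<in> closure \<Omega> \<Longrightarrow> \<bar>g x\<bar> \<le> B1" using bd[OF cg(1)] by blast
  obtain B2 where B2: "B2 > 0" "\<And>x. x \<in> closure \<Omega> \<Longrightarrow> \<bar>norm (Gg x)\<bar> \<le> B2"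
    using bd[OF continuous_on_norm[OF cg(2)]] by blast
  obtain B3 where B3: "B3 > 0" "\<And>x. x \<in> closure \<Omega> \<Longrightarrow> \<bar>\<Sum>i\<in>Basis. Hg x i \<bullet> i\<bar> \<le> B3"
    using bd[OF continuous_on_subset[OF g(3) subset_UNIV]] by blast
  define r where "r = r0 / 2"
  have r: "r > 0" "r < r0" using r0 by (auto simp: r_def)
  define \<zeta> where "\<zeta> x = max 0 ((norm (x - z))\<^sup>2 - r\<^sup>2)" for x
  obtain B4 where B4: "B4 > 0" "\<And>x. x \<in> closure \<Omega> \<Longrightarrow> \<bar>(\<zeta> x)\<^sup>2 * (norm (x - z))\<^sup>2\<bar> \<le> B4"
  proof -
    have "continuous_on (closure \<Omega>) (\<lambda>x. (\<zeta> x)\<^sup>2 * (norm (x - z))\<^sup>2)"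
      unfolding \<zeta>_def by (intro continuous_intros)
    from bd[OF this] show ?thesis using that by blast
  qed
  have Dz: "D2on UNIV (\<lambda>x. (norm (x - z))\<^sup>2 - r\<^sup>2) (\<lambda>x. 2 *\<^sub>R (x - z) - 0) (\<lambda>x k. 2 *\<^sub>R k - 0)"
    by (rule D2on_diff[OF D2on_sq D2on_const])
  have d: "((\<lambda>s::real. (max 0 s) ^ 4) has_real_derivative (4 * (max 0 s) ^ 3)) (at s)"
    "((\<lambda>s::real. 4 * (max 0 s) ^ 3) has_real_derivative (12 * (max 0 s) ^ 2)) (at s)" for s
    using pos_power_derivative[of 2 s] DERIV_cmult[OF pos_power_derivative[of 1 s], of 4] by (simp_all add: eval_nat_numeral)
  have DZ: "D2on UNIV (\<lambda>x. (\<zeta> x) ^ 4) (\<lambda>x. (4 * (\<zeta> x) ^ 3) *\<^sub>R (2 *\<^sub>R (x - z) - 0))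
    (\<lambda>x k. (12 * (\<zeta> x)\<^sup>2) *\<^sub>R (((2 *\<^sub>R (x - z) - 0) \<bullet> k) *\<^sub>R (2 *\<^sub>R (x - z) - 0)) + (4 * (\<zeta> x) ^ 3) *\<^sub>R (2 *\<^sub>R k - 0))"
    using D2on_compose[OF Dz d] by (simp add: \<zeta>_def)
  define Q where "Q x = g x * g x + (\<zeta> x) ^ 4" for x
  define G where "G x = (g x *\<^sub>R Gg x + g x *\<^sub>R Gg x) + (4 * (\<zeta> x) ^ 3) *\<^sub>R (2 *\<^sub>R (x - z) - 0)" for x
  define H where "H x k = (((Gg x \<bullet> k) *\<^sub>R Gg x + (Gg x \<bullet> k) *\<^sub>R Gg x) + (g x *\<^sub>R Hg x k + g x *\<^sub>R Hg x k))
    + ((12 * (\<zeta> x)\<^sup>2) *\<^sub>R (((2 *\<^sub>R (x - z) - 0) \<bullet> k) *\<^sub>R (2 *\<^sub>R (x - z) - 0)) + (4 * (\<zeta> x) ^ 3) *\<^sub>R (2 *\<^sub>R k - 0))" for x k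
  have DQ: "D2on UNIV Q G H"
    unfolding Q_def G_def H_def by (rule D2on_add[OF D2on_mult[OF g(1) g(1)] DZ])
  have \<zeta>0: "0 \<le> \<zeta> x" for x by (simp add: \<zeta>_def)
  define L where "L x = (\<Sum>i\<in>Basis. Hg x i \<bullet> i)" for x
  have trH: "(\<Sum>i\<in>Basis. H x i \<bullet> i) = 2 * (norm (Gg x))\<^sup>2 + 2 * (g x * L x)
     + (12 * (\<zeta> x)\<^sup>2 * (4 * (norm (x - z))\<^sup>2) + 4 * (\<zeta> x) ^ 3 * (2 * DIM('a)))" for x
  proof -
    have "(\<Sum>i\<in>Basis. H x i \<bullet> i) = ((\<Sum>i\<in>Basis. ((Gg x \<bullet> i) *\<^sub>R Gg x) \<bullet> i) + (\<Sum>i\<in>Basis. ((Gg x \<bullet> i) *\<^sub>R Gg x) \<bullet> i)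
        + (g x * L x + g x * L x))
        + (12 * (\<zeta> x)\<^sup>2 * (\<Sum>i\<in>Basis. (((2 *\<^sub>R (x - z)) \<bullet> i) *\<^sub>R (2 *\<^sub>R (x - z))) \<bullet> i) + 4 * (\<zeta> x) ^ 3 * (\<Sum>i\<in>Basis. (2 *\<^sub>R i) \<bullet> (i::'a)))"
      unfolding H_def L_def diff_zero
      by (simp only: inner_add_left sum.distrib inner_scaleR_left sum_distrib_left)
    then show ?thesis unfolding trace_outer trace_scale_id by (simp add: dot_square_norm)
  qed
  have trlow: "2 - 2 * B3 * \<bar>g x\<bar> \<le> (\<Sum>i\<in>Basis. H x i \<bullet> i)" if "x \<in> closure \<Omega>" for x
  proof -
    have "1 \<le> (norm (Gg x))\<^sup>2" using g(2)[of x] by (simp add: one_le_power)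
    moreover have "- (g x * L x) \<le> B3 * \<bar>g x\<bar>"
    proof -
      have "- (g x * L x) \<le> \<bar>g x\<bar> * \<bar>L x\<bar>" by (simp add: abs_mult[symmetric])
      also have "\<dots> \<le> \<bar>g x\<bar> * B3" using B3(2)[OF that] by (intro mult_left_mono) (auto simp: L_def)
      finally show ?thesis by (simp add: mult.commute)
    qed
    moreover have "0 \<le> 12 * (\<zeta> x)\<^sup>2 * (4 * (norm (x - z))\<^sup>2)" "0 \<le> 4 * (\<zeta> x) ^ 3 * (2 * DIM('a))" using \<zeta>0 by auto
    ultimately show ?thesis unfolding trH by linarith
  qed
  \<comment> \<open>\<open>Q x < q0\<close> forces |g x| < 1 / (2 * B3), and then the lower bound 2
    - 2 * B3 * |g x| of the trace is at least 1.\<close>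
  define q0 where "q0 = (1 / (2 * B3))\<^sup>2"
  \<comment> \<open>The first two summands bound the squared gradient, after (a + b)^2 \<le> 2 a^2 +
    2 b^2; the last one bounds the trace from below on the whole closure.\<close>
  define C where "C = 8 * B2\<^sup>2 + 128 * B4 + 2 * B3 * B1"
  show ?thesis
  proof (rule that[OF r(1) DQ])
    show "0 \<le> Q x" for x using \<zeta>0 by (simp add: Q_def)
    show "Q x = 0" if "x \<in> frontier \<Omega>" "x \<in> ball z r" for x
    proof -
      have "g x = 0" using that r by (intro frontier_graph_zero[OF \<Omega>(1) cg(1) loc']) auto
      moreover have "(norm (x - z))\<^sup>2 \<le> r\<^sup>2" using that by (intro power_mono) (auto simp: dist_norm norm_minus_commute)
      ultimately show ?thesis by (simp add: Q_def \<zeta>_def)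
    qed
    show "C > 0" "q0 > 0" using B1 B2 B3 B4 by (auto simp: C_def q0_def intro!: add_pos_pos)
    fix x assume x: "x \<in> closure \<Omega>"
    have "(norm (G x))\<^sup>2 \<le> 2 * (norm (2 *\<^sub>R (g x *\<^sub>R Gg x)))\<^sup>2 + 2 * (norm ((8 * (\<zeta> x) ^ 3) *\<^sub>R (x - z)))\<^sup>2"
    proof -
      have e: "G x = 2 *\<^sub>R (g x *\<^sub>R Gg x) + (8 * (\<zeta> x) ^ 3) *\<^sub>R (x - z)" by (simp add: G_def scaleR_2[symmetric])
      have "norm (G x) \<le> norm (2 *\<^sub>R (g x *\<^sub>R Gg x)) + norm ((8 * (\<zeta> x) ^ 3) *\<^sub>R (x - z))"
        unfolding e by (rule norm_triangle_ineq)
      then have "(norm (G x))\<^sup>2 \<le> (norm (2 *\<^sub>R (g x *\<^sub>R Gg x)) + norm ((8 * (\<zeta> x) ^ 3) *\<^sub>R (x - z)))\<^sup>2"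
        by (intro power_mono) auto
      also have "\<dots> \<le> 2 * (norm (2 *\<^sub>R (g x *\<^sub>R Gg x)))\<^sup>2 + 2 * (norm ((8 * (\<zeta> x) ^ 3) *\<^sub>R (x - z)))\<^sup>2"
        using sum_squares_bound[of "norm (2 *\<^sub>R (g x *\<^sub>R Gg x))" "norm ((8 * (\<zeta> x) ^ 3) *\<^sub>R (x - z))"]
        by (simp only: power2_sum)
      finally show ?thesis .
    qed
    also have "(norm (2 *\<^sub>R (g x *\<^sub>R Gg x)))\<^sup>2 = 4 * (norm (Gg x))\<^sup>2 * (g x * g x)"
      by (simp add: power_mult_distrib power2_eq_square)
    also have "(norm ((8 * (\<zeta> x) ^ 3) *\<^sub>R (x - z)))\<^sup>2 = 64 * ((\<zeta> x)\<^sup>2 * (norm (x - z))\<^sup>2) * (\<zeta> x) ^ 4"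
      using \<zeta>0[of x] by (simp add: power_mult_distrib abs_mult power_abs eval_nat_numeral)
    also have "2 * (4 * (norm (Gg x))\<^sup>2 * (g x * g x)) + 2 * (64 * ((\<zeta> x)\<^sup>2 * (norm (x - z))\<^sup>2) * (\<zeta> x) ^ 4)
      \<le> 2 * (4 * B2\<^sup>2 * (g x * g x)) + 2 * (64 * B4 * (\<zeta> x) ^ 4)"
    proof -
      have "(norm (Gg x))\<^sup>2 \<le> B2\<^sup>2" using B2(2)[OF x] by (intro power_mono) auto
      then have "(norm (Gg x))\<^sup>2 * (g x * g x) \<le> B2\<^sup>2 * (g x * g x)" by (intro mult_right_mono) auto
      moreover have "((\<zeta> x)\<^sup>2 * (norm (x - z))\<^sup>2) * (\<zeta> x) ^ 4 \<le> B4 * (\<zeta> x) ^ 4" using B4(2)[OF x] \<zeta>0[of x] by (intro mult_right_mono) auto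
      ultimately show ?thesis by linarith
    qed
    also have "\<dots> \<le> C * Q x"
    proof -
      have "8 * B2\<^sup>2 * (g x * g x) \<le> C * (g x * g x)" "128 * B4 * (\<zeta> x) ^ 4 \<le> C * (\<zeta> x) ^ 4"
        using B1 B2 B3 B4 \<zeta>0[of x] by (auto simp: C_def intro!: mult_right_mono add_nonneg_nonneg)
      then show ?thesis by (simp add: Q_def distrib_left)
    qed
    finally show "(norm (G x))\<^sup>2 \<le> C * Q x" .
    have "2 * B3 * \<bar>g x\<bar> \<le> 2 * B3 * B1" using B1(2)[OF x] B3 by (intro mult_left_mono) auto
    moreover have "2 * B3 * B1 \<le> C" using B2 B4 by (simp add: C_def)
    ultimately show "- C \<le> (\<Sum>i\<in>Basis. H x i \<bullet> i)" using trlow[OF x] by linarith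
    assume "Q x < q0"
    moreover have "0 \<le> (\<zeta> x) ^ 4" by simp
    ultimately have "g x * g x < (1 / (2 * B3))\<^sup>2" unfolding Q_def q0_def by linarith
    then have "\<bar>g x\<bar>\<^sup>2 < (1 / (2 * B3))\<^sup>2" by (simp add: power2_eq_square)
    then have "\<bar>g x\<bar> < 1 / (2 * B3)" by (rule power_less_imp_less_base) (use B3 in simp)
    then have "2 * B3 * \<bar>g x\<bar> < 1" using B3 by (simp add: field_simps)
    then show "1 \<le> (\<Sum>i\<in>Basis. H x i \<bullet> i)" using trlow[OF x] by linarith
  qed
qed

text \<open>For small \<open>t\<close> the exponent \<alpha> \<le> 1 reduces the claim to
  boundedness of exp (- c / t) / t^2, which follows from exp y \<ge> y^2 / 2 with y = c / t.\<close>

lemma exp_recip_bound: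
  fixes \<alpha> c t :: real
  assumes "0 \<le> \<alpha>" "\<alpha> \<le> 1" "0 < c" "0 < t"
  shows "exp (- \<alpha> * ln t - c / t) / t \<le> max 1 (2 / c\<^sup>2)"
proof (cases "t \<ge> 1")
  case True
  then have "0 \<le> \<alpha> * ln t" using assms by (intro mult_nonneg_nonneg) auto
  moreover have "0 \<le> c / t" using assms by simp
  ultimately have "exp (- \<alpha> * ln t - c / t) \<le> 1" by simp
  then have "exp (- \<alpha> * ln t - c / t) / t \<le> 1 / 1" using True by (intro frac_le) auto
  then show ?thesis by simp
next
  case False
  have "- \<alpha> * ln t \<le> - ln t"
    using mult_right_mono_neg[OF assms(2), of "ln t"] False assms by simp
  then have "exp (- \<alpha> * ln t - c / t) \<le> exp (- ln t - c / t)" by simp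
  also have "\<dots> = (1 / t) * exp (- (c / t))" using assms by (simp add: exp_diff exp_minus divide_inverse)
  finally have "exp (- \<alpha> * ln t - c / t) / t \<le> (1 / t) * exp (- (c / t)) / t" using assms by (intro divide_right_mono) auto
  also have "\<dots> = 1 / (t\<^sup>2 * exp (c / t))" using assms by (simp add: exp_minus power2_eq_square divide_inverse)
  also have "\<dots> \<le> 1 / (t\<^sup>2 * ((c / t)\<^sup>2 / 2))"
  proof (rule divide_left_mono)
    have ct: "0 \<le> c / t" using assms by simp
    have "(c / t)\<^sup>2 / 2 \<le> exp (c / t)" using exp_lower_Taylor_quadratic[OF ct] ct by linarith
    then show "t\<^sup>2 * ((c / t)\<^sup>2 / 2) \<le> t\<^sup>2 * exp (c / t)" using assms by (intro mult_left_mono) auto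
    show "0 < t\<^sup>2 * exp (c / t) * (t\<^sup>2 * ((c / t)\<^sup>2 / 2))" using assms by auto
  qed simp
  also have "\<dots> = 2 / c\<^sup>2" using assms by (simp add: power_divide)
  finally show ?thesis by simp
qed

text \<open>With \<open>Q\<close> of the order of the squared distance to a piece of the boundary,
  \<open>t powr (-\<alpha>) * exp (- k Q / t)\<close> is a supersolution for both diffusivities, up to a bounded error,
  once \<open>k\<close> is small and \<open>\<alpha>\<close> is small compared with \<open>k\<close>.\<close>

lemma corner_barrier:
  fixes Q :: "'a::euclidean_space \<Rightarrow> real"
  assumes D: "D2on UNIV Q G H" and Q0: "\<And>x. 0 \<le> Q x" and C: "C > 0" "q0 > 0"
    and GQ: "\<And>x. x \<in> K \<Longrightarrow> (norm (G x))\<^sup>2 \<le> C * Q x"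
    and tr: "\<And>x. x \<in> K \<Longrightarrow> - C \<le> (\<Sum>i\<in>Basis. H x i \<bullet> i)"
    and tr1: "\<And>x. x \<in> K \<Longrightarrow> Q x < q0 \<Longrightarrow> 1 \<le> (\<Sum>i\<in>Basis. H x i \<bullet> i)"
    and b: "0 < bm" "bm < bp"
  obtains \<alpha> k C1 g' H' where "\<alpha> > 0" "k > 0" "C1 > 0"
    "D2on (UNIV \<times> {0<..}) (\<lambda>p. exp (- \<alpha> * ln (snd p) - k * Q (fst p) / snd p)) g' H'"
    "\<And>p b. p \<in> K \<times> {0<..} \<Longrightarrow> bm \<le> b \<Longrightarrow> b \<le> bp \<Longrightarrow> lap (H' p) \<le> b * snd (g' p) + C1"
proof -
  \<comment> \<open>This makes k^2 |grad Q|^2 at most bm k Q, so the squared gradient of the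
    exponent is absorbed by the term k Q / t^2 of its time derivative for every admissible
    \<open>b\<close>.\<close>
  define k where "k = bm / C"
  have k: "k > 0" "k * C = bm" using b C by (auto simp: k_def)
  \<comment> \<open>Where the trace is at least 1, the diffusion gains k / t and the factor t powr
    (- \<alpha>) loses at most bp \<alpha> / t, which is no more than k / t. The bound by 1 is for
    \<open>exp_recip_bound\<close>.\<close>
  define \<alpha> where "\<alpha> = min 1 (k / bp)"
  have \<alpha>: "\<alpha> > 0" "\<alpha> \<le> 1" "bp * \<alpha> \<le> k"
  proof -
    show "\<alpha> > 0" "\<alpha> \<le> 1" using k b by (auto simp: \<alpha>_def)
    have "bp * \<alpha> \<le> bp * (k / bp)" using b by (intro mult_left_mono) (auto simp: \<alpha>_def)
    then show "bp * \<alpha> \<le> k" using b by simp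
  qed
  \<comment> \<open>Where \<open>Q\<close> is at least \<open>q0\<close> the sign is lost, but the
    factor exp (- k q0 / t) controls the remaining 1 / t.\<close>
  define C1 where "C1 = (bp * \<alpha> + k * C) * max 1 (2 / (k * q0)\<^sup>2)"
  have C1: "C1 > 0" unfolding C1_def using b \<alpha> k(1) C by (intro mult_pos_pos add_pos_pos) auto
  let ?V = "UNIV \<times> {0<..} :: ('a \<times> real) set"
  have r1: "D2on ?V (\<lambda>p. - \<alpha> * ln (snd p)) (\<lambda>p. (0, - \<alpha> / snd p)) (\<lambda>p k. (0, (\<alpha> / (snd p)\<^sup>2) * snd k))"
    by (intro D2on_snd) (auto intro!: derivative_eq_intros simp: power2_eq_square)
  have r2: "D2on ?V (\<lambda>p. - k / snd p) (\<lambda>p. (0, k / (snd p)\<^sup>2)) (\<lambda>p j. (0, (- 2 * k / (snd p)^3) * snd j))"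
    by (intro D2on_snd) (auto intro!: derivative_eq_intros simp: field_simps power2_eq_square power3_eq_cube)
  have qf: "D2on ?V (\<lambda>p. Q (fst p)) (\<lambda>p. (G (fst p), 0)) (\<lambda>p k. (H (fst p) (fst k), 0))"
    by (rule D2on_subset[OF D2on_fst[OF D]]) auto
  define gE where "gE p = (0, - \<alpha> / snd p) + ((- k / snd p) *\<^sub>R (G (fst p), 0) + Q (fst p) *\<^sub>R (0, k / (snd p)\<^sup>2))" for p
  define HE where "HE p j = (0, (\<alpha> / (snd p)\<^sup>2) * snd j) + (((((0, k / (snd p)\<^sup>2) \<bullet> j) *\<^sub>R (G (fst p), 0)
     + ((G (fst p), 0) \<bullet> j) *\<^sub>R (0, k / (snd p)\<^sup>2))) + ((- k / snd p) *\<^sub>R (H (fst p) (fst j), 0) + Q (fst p) *\<^sub>R (0, (- 2 * k / (snd p)^3) * snd j)))"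
    for p :: "'a \<times> real" and j :: "'a \<times> real"
  define E where "E p = - \<alpha> * ln (snd p) + - k / snd p * Q (fst p)" for p :: "'a \<times> real"
  have DE: "D2on ?V E gE HE"
    unfolding E_def gE_def HE_def by (rule D2on_add[OF r1 D2on_mult[OF r2 qf]])
  note Dh = D2on_compose[OF DE, of exp exp exp, OF DERIV_exp DERIV_exp]
  have lapHE: "lap (HE p) = (- k / snd p) * (\<Sum>i\<in>Basis. H (fst p) i \<bullet> i)" for p
    unfolding HE_def lap_add lap_scaleR lap_snd lap_outer lap_fst by simp
  have main: "lap (\<lambda>j. exp (E p) *\<^sub>R ((gE p \<bullet> j) *\<^sub>R gE p) + exp (E p) *\<^sub>R HE p j) \<le> b * snd (exp (E p) *\<^sub>R gE p) + C1"
    if p: "p \<in> K \<times> {0<..}" and b': "bm \<le> b" "b \<le> bp" for p b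
  proof -
    obtain x t where xt: "p = (x, t)" by (cases p)
    have x: "x \<in> K" and t: "t > 0" using p by (auto simp: xt)
    define L where "L = (\<Sum>i\<in>Basis. H x i \<bullet> i)"
    have "lap (\<lambda>j. exp (E p) *\<^sub>R ((gE p \<bullet> j) *\<^sub>R gE p) + exp (E p) *\<^sub>R HE p j) - b * snd (exp (E p) *\<^sub>R gE p)
      = exp (E p) * (fst (gE p) \<bullet> fst (gE p) + lap (HE p) - b * snd (gE p))"
      by (simp only: lap_add lap_scaleR lap_outer) (simp add: algebra_simps)
    also have "fst (gE p) \<bullet> fst (gE p) + lap (HE p) - b * snd (gE p)
      = k\<^sup>2 * (norm (G x))\<^sup>2 / t\<^sup>2 - b * (k * Q x) / t\<^sup>2 + (b * \<alpha> - k * L) / t"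
    proof -
      have "fst (gE p) \<bullet> fst (gE p) = k\<^sup>2 * (norm (G x))\<^sup>2 / t\<^sup>2"
        unfolding power2_norm_eq_inner by (simp add: xt gE_def power2_eq_square)
      moreover have "lap (HE p) = - (k * L) / t" by (simp add: lapHE xt L_def)
      moreover have "b * snd (gE p) = b * (k * Q x) / t\<^sup>2 - b * \<alpha> / t"
        by (simp add: xt gE_def algebra_simps)
      ultimately show ?thesis by (simp add: diff_divide_distrib)
    qed
    also have "\<dots> \<le> (b * \<alpha> - k * L) / t"
    proof -
      have "k\<^sup>2 * (norm (G x))\<^sup>2 \<le> k\<^sup>2 * (C * Q x)" using GQ[OF x] by (intro mult_left_mono) auto
      also have "\<dots> = bm * (k * Q x)" by (simp add: k(2)[symmetric] power2_eq_square mult.commute mult.left_commute)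
      also have "\<dots> \<le> b * (k * Q x)" using b' k Q0[of x] by (intro mult_right_mono) auto
      finally have "k\<^sup>2 * (norm (G x))\<^sup>2 / t\<^sup>2 \<le> b * (k * Q x) / t\<^sup>2" by (intro divide_right_mono) auto
      then show ?thesis by linarith
    qed
    finally have 1: "lap (\<lambda>j. exp (E p) *\<^sub>R ((gE p \<bullet> j) *\<^sub>R gE p) + exp (E p) *\<^sub>R HE p j) - b * snd (exp (E p) *\<^sub>R gE p)
       \<le> exp (E p) * ((b * \<alpha> - k * L) / t)" by simp
    have b\<alpha>: "b * \<alpha> \<le> bp * \<alpha>" using b' \<alpha> by (intro mult_right_mono) auto
    have "exp (E p) * ((b * \<alpha> - k * L) / t) \<le> C1"
    proof (cases "Q x < q0")
      case True
      then have "k * 1 \<le> k * L" using tr1[OF x True] k by (intro mult_left_mono) (auto simp: L_def)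
      then have "b * \<alpha> - k * L \<le> 0" using \<alpha>(3) b\<alpha> by linarith
      then have "exp (E p) * ((b * \<alpha> - k * L) / t) \<le> 0" using t by (simp add: mult_nonneg_nonpos divide_nonpos_pos)
      then show ?thesis using C1 by linarith
    next
      case False
      have "- (k * L) \<le> k * C" using mult_left_mono[OF tr[OF x], of k] k by (simp add: L_def)
      then have "(b * \<alpha> - k * L) / t \<le> (bp * \<alpha> + k * C) / t" using b\<alpha> t by (intro divide_right_mono) auto
      then have "exp (E p) * ((b * \<alpha> - k * L) / t) \<le> exp (E p) * ((bp * \<alpha> + k * C) / t)" by (intro mult_left_mono) auto
      also have "\<dots> = (bp * \<alpha> + k * C) * (exp (E p) / t)" by simp
      also have "\<dots> \<le> C1" unfolding C1_def
      proof (rule mult_left_mono)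
        have "k * q0 / t \<le> k * Q x / t" using False k t by (intro divide_right_mono mult_left_mono) auto
        then have "E p \<le> - \<alpha> * ln t - k * q0 / t" by (simp add: E_def xt)
        then have "exp (E p) / t \<le> exp (- \<alpha> * ln t - k * q0 / t) / t" using t by (intro divide_right_mono) auto
        also have "\<dots> \<le> max 1 (2 / (k * q0)\<^sup>2)" using exp_recip_bound[of \<alpha> "k * q0" t] \<alpha> k C t by simp
        finally show "exp (E p) / t \<le> max 1 (2 / (k * q0)\<^sup>2)" .
        show "0 \<le> bp * \<alpha> + k * C" using b \<alpha> k by simp
      qed
      finally show ?thesis .
    qed
    then show ?thesis using 1 by simp
  qed
  have E': "(\<lambda>p. exp (- \<alpha> * ln (snd p) - k * Q (fst p) / snd p)) = (\<lambda>p. exp (E p))"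
    by (simp add: E_def fun_eq_iff)
  show ?thesis
    by (rule that[OF \<alpha>(1) k(1) C1, unfolded E', OF Dh main])
qed

lemma D2on_time_shift:
  fixes h :: "'a::euclidean_space \<times> real \<Rightarrow> real"
  assumes "D2on (UNIV \<times> {0<..}) h g H"
  shows "D2on (UNIV \<times> {\<tau><..}) (\<lambda>p. h (p - (0, \<tau>))) (\<lambda>p. g (p - (0, \<tau>))) (\<lambda>p. H (p - (0, \<tau>)))"
  unfolding D2on_def
proof (intro ballI conjI)
  fix p :: "'a \<times> real" assume "p \<in> UNIV \<times> {\<tau><..}"
  then have p: "p - (0, \<tau>) \<in> UNIV \<times> {0<..}" by auto
  have s: "((\<lambda>p. p - (0, \<tau>)) has_derivative (\<lambda>k. k)) (at p)" by (auto intro!: derivative_eq_intros)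
  note d = assms[unfolded D2on_def, rule_format, OF p]
  show "((\<lambda>p. h (p - (0, \<tau>))) has_derivative (\<bullet>) (g (p - (0, \<tau>)))) (at p)"
    by (rule has_derivative_compose[OF s d[THEN conjunct1]])
  show "((\<lambda>p. g (p - (0, \<tau>))) has_derivative H (p - (0, \<tau>))) (at p)"
    by (rule has_derivative_compose[OF s d[THEN conjunct2]])
qed

text \<open>The order of choices matters: first \<delta>, making the total barrier small at (x, t);
  then the compact set on which no barrier is large; only then the starting time \<open>s0\<close>,
  which may depend on \<delta>.\<close>

theorem interior_comparison:
  fixes u v :: "'a::euclidean_space \<times> real \<Rightarrow> real"
  assumes \<Omega>: "open \<Omega>" "bounded \<Omega>" "smooth_boundary \<Omega>" and bm: "0 < bm" "bm < bp"
    and u: "usc_on (closure \<Omega> \<times> {0..T}) u" "\<And>p. p \<in> closure \<Omega> \<times> {0..T} \<Longrightarrow> \<bar>u p\<bar> \<le> M"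
      "vsub (bflux bm bp) (\<Omega> \<times> {0<..<T}) u"
    and v: "usc_on (closure \<Omega> \<times> {0..T}) (\<lambda>p. - v p)" "\<And>p. p \<in> closure \<Omega> \<times> {0..T} \<Longrightarrow> \<bar>v p\<bar> \<le> M"
      "vsub (\<lambda>s. - bflux bm bp (- s)) (\<Omega> \<times> {0<..<T}) (\<lambda>p. - v p)"
    and bdry: "\<And>p. p \<in> parabolic_boundary \<Omega> T \<Longrightarrow> u p \<le> v p"
    and x: "x \<in> \<Omega>" and t: "0 < t" "t < T"
  shows "u (x, t) \<le> v (x, t)"
proof (rule field_le_epsilon)
  fix \<epsilon> :: real assume \<epsilon>: "\<epsilon> > 0"
  define \<eta> where "\<eta> = \<epsilon> / 2"
  have \<eta>: "\<eta> > 0" using \<epsilon> by (simp add: \<eta>_def)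
  let ?D = "closure \<Omega> \<times> {0..T}"
  have xc: "x \<in> closure \<Omega>" using x closure_subset by blast
  have "\<bar>u (x, t)\<bar> \<le> M" using xc t by (intro u(2)) auto
  then have M: "M \<ge> 0" by linarith
  \<comment> \<open>All barrier data of one boundary point in a single predicate, so that functions
    of \<open>z\<close> can be chosen at once.\<close>
  define P where "P z r Q \<alpha> k C1 g H \<longleftrightarrow> r > 0 \<and> continuous_on UNIV Q \<and> (\<forall>x. 0 \<le> Q x) \<and> (\<forall>x\<in>frontier \<Omega> \<inter> ball z r. Q x = 0)
      \<and> \<alpha> > 0 \<and> k > 0 \<and> C1 > 0 \<and> D2on (UNIV \<times> {0<..}) (\<lambda>p. exp (- \<alpha> * ln (snd p) - k * Q (fst p) / snd p)) g H
      \<and> (\<forall>p\<in>closure \<Omega> \<times> {0<..}. \<forall>b. bm \<le> b \<longrightarrow> b \<le> bp \<longrightarrow> lap (H p) \<le> b * snd (g p) + C1)"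
    for z r Q \<alpha> k C1 g H
  have "\<exists>r Q \<alpha> k C1 g H. P z r Q \<alpha> k C1 g H"
    if z: "z \<in> frontier \<Omega>" for z
  proof -
    obtain r Q G H C q0 where Q: "r > 0" "D2on UNIV Q G H" "\<And>x. 0 \<le> Q x"
      "\<And>x. x \<in> frontier \<Omega> \<Longrightarrow> x \<in> ball z r \<Longrightarrow> Q x = 0" "C > 0" "q0 > 0"
      "\<And>x. x \<in> closure \<Omega> \<Longrightarrow> (norm (G x))\<^sup>2 \<le> C * Q x"
      "\<And>x. x \<in> closure \<Omega> \<Longrightarrow> - C \<le> (\<Sum>i\<in>Basis. H x i \<bullet> i)"
      "\<And>x. x \<in> closure \<Omega> \<Longrightarrow> Q x < q0 \<Longrightarrow> 1 \<le> (\<Sum>i\<in>Basis. H x i \<bullet> i)"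
      by (rule corner_function[OF \<Omega> z]) (rule that)
    obtain \<alpha> k C1 g' H' where h: "\<alpha> > 0" "k > 0" "C1 > 0"
      "D2on (UNIV \<times> {0<..}) (\<lambda>p. exp (- \<alpha> * ln (snd p) - k * Q (fst p) / snd p)) g' H'"
      "\<And>p b. p \<in> closure \<Omega> \<times> {0<..} \<Longrightarrow> bm \<le> b \<Longrightarrow> b \<le> bp \<Longrightarrow> lap (H' p) \<le> b * snd (g' p) + C1"
      by (rule corner_barrier[OF Q(2,3,5,6,7,8,9) bm]) (assumption | rule that)+
    have "P z r Q \<alpha> k C1 g' H'"
      unfolding P_def using Q(1,3,4) D2on_continuous[OF Q(2)] h by auto
    then show ?thesis by blast
  qed
  then obtain r Q \<alpha> k C1 g H where "\<And>z. z \<in> frontier \<Omega> \<Longrightarrow> P z (r z) (Q z) (\<alpha> z) (k z) (C1 z) (g z) (H z)"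
    by metis
  note A = this[unfolded P_def]
  have cfr: "compact (frontier \<Omega>)" using \<Omega>(2) by (rule compact_frontier_bounded)
  have "frontier \<Omega> \<subseteq> (\<Union>z\<in>frontier \<Omega>. ball z (r z))"
  proof
    fix z assume z: "z \<in> frontier \<Omega>"
    then have "z \<in> ball z (r z)" using A[OF z] by simp
    then show "z \<in> (\<Union>z\<in>frontier \<Omega>. ball z (r z))" using z by blast
  qed
  then obtain Z where Z: "Z \<subseteq> frontier \<Omega>" "finite Z" "frontier \<Omega> \<subseteq> (\<Union>z\<in>Z. ball z (r z))"
    using compactE_image[OF cfr, of "frontier \<Omega>" "\<lambda>z. ball z (r z)"] by auto
  note AZ = A[OF subsetD[OF Z(1)]]
  have Zp: "r z > 0" "\<alpha> z > 0" "k z > 0" "C1 z > 0" "\<And>x. 0 \<le> Q z x" "continuous_on UNIV (Q z)"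
    "\<And>x. x \<in> frontier \<Omega> \<Longrightarrow> x \<in> ball z (r z) \<Longrightarrow> Q z x = 0"
    "D2on (UNIV \<times> {0<..}) (\<lambda>p. exp (- \<alpha> z * ln (snd p) - k z * Q z (fst p) / snd p)) (g z) (H z)"
    "\<And>p b. p \<in> closure \<Omega> \<times> {0<..} \<Longrightarrow> bm \<le> b \<Longrightarrow> b \<le> bp \<Longrightarrow> lap (H z p) \<le> b * snd (g z p) + C1 z"
    if "z \<in> Z" for z
    using AZ[OF that] by blast+
  \<comment> \<open>The least factor with which the barrier reaches 2 M, a bound for the difference,
    at its own time \<delta> wherever \<open>Q z\<close> is at most \<delta>.\<close>
  define a where "a \<delta> z = 2 * M * exp (\<alpha> z * ln \<delta> + k z)" for \<delta> z
  have a0: "a \<delta> z \<ge> 0" for \<delta> z using M by (simp add: a_def)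
  \<comment> \<open>An upper bound at (x, t) for the barriers and their error correction, since the
    own time of the barriers there will be at least t / 2.\<close>
  define S where "S \<delta> = (\<Sum>z\<in>Z. a \<delta> z * (exp (- \<alpha> z * ln (t / 2)) + C1 z / bm * T))" for \<delta>
  have "(S \<longlongrightarrow> (\<Sum>z\<in>Z. 0 * (exp (- \<alpha> z * ln (t / 2)) + C1 z / bm * T))) (at_right 0)"
    unfolding S_def
  proof (intro tendsto_sum tendsto_mult_right)
    fix z assume z: "z \<in> Z"
    have "filterlim (\<lambda>\<delta>. \<alpha> z * ln \<delta>) at_bot (at_right 0)"
      using Zp(2)[OF z] by (intro filterlim_tendsto_pos_mult_at_bot[OF tendsto_const _ ln_at_0])
    then have "((\<lambda>\<delta>. exp (\<alpha> z * ln \<delta>)) \<longlongrightarrow> 0) (at_right 0)" by (rule filterlim_compose[OF exp_at_bot])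
    then have "((\<lambda>\<delta>. 2 * M * (exp (\<alpha> z * ln \<delta>) * exp (k z))) \<longlongrightarrow> 2 * M * (0 * exp (k z))) (at_right 0)"
      by (intro tendsto_intros)
    then show "((\<lambda>\<delta>. a \<delta> z) \<longlongrightarrow> 0) (at_right 0)" by (simp add: a_def exp_add)
  qed
  then have "(S \<longlongrightarrow> 0) (at_right 0)" by simp
  then have "\<forall>\<^sub>F \<delta> in at_right 0. S \<delta> < \<eta>" using \<eta> by (rule order_tendstoD(2))
  moreover have "\<forall>\<^sub>F \<delta>::real in at_right 0. 0 < \<delta>" by (simp add: eventually_at_right_less)
  ultimately have "\<forall>\<^sub>F \<delta> in at_right 0. S \<delta> < \<eta> \<and> 0 < \<delta>" by (rule eventually_conj)
  from eventually_happens'[OF trivial_limit_at_right_real this]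
  obtain \<delta> where \<delta>: "S \<delta> < \<eta>" "\<delta> > 0" by blast
  define K where "K = {y\<in>closure \<Omega>. \<forall>z\<in>Z. \<delta> \<le> Q z y}"
  have cK: "compact K"
  proof -
    have "K = closure \<Omega> \<inter> (\<Inter>z\<in>Z. {y. \<delta> \<le> Q z y})" by (auto simp: K_def)
    moreover have "closed (\<Inter>z\<in>Z. {y. \<delta> \<le> Q z y})"
      by (intro closed_INT ballI closed_Collect_le continuous_on_const Zp(6))
    ultimately show ?thesis using \<Omega>(2) by (simp add: compact_Int_closed)
  qed
  have K\<Omega>: "K \<subseteq> \<Omega>"
  proof
    fix y assume y: "y \<in> K"
    have "y \<notin> frontier \<Omega>"
    proof
      assume f: "y \<in> frontier \<Omega>"
      then obtain z where z: "z \<in> Z" "y \<in> ball z (r z)" using Z(3) by blast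
      have "\<delta> \<le> Q z y" using y z(1) by (auto simp: K_def)
      moreover have "Q z y = 0" by (rule Zp(7)[OF z(1) f z(2)])
      ultimately show False using \<delta> by simp
    qed
    then show "y \<in> \<Omega>" using y \<Omega>(1) by (auto simp: K_def frontier_def interior_open)
  qed
  have uv: "usc_on ?D (\<lambda>p. u p + - v p)" by (rule usc_on_add[OF u(1) v(1)])
  have KD: "K \<times> {0..T} \<subseteq> ?D" using K\<Omega> closure_subset[of \<Omega>] by auto
  \<comment> \<open>The points over \<open>K\<close> where the difference is still as large as
    \<eta>. This set is compact and misses time 0, hence stays at times at least some positive
    \<open>e0\<close>; before \<open>e0\<close> the difference is below \<eta> on
    \<open>K\<close>.\<close>
  define Bd where "Bd = {p\<in>K \<times> {0..T}. \<eta> \<le> u p + - v p}"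
  have cB: "compact Bd" unfolding Bd_def
    by (intro usc_on_superlevel_compact compact_Times cK usc_on_subset[OF uv KD]) auto
  have Bpos: "0 < snd p" if "p \<in> Bd" for p
  proof (rule ccontr)
    assume "\<not> 0 < snd p"
    then have "p \<in> parabolic_boundary \<Omega> T" using that K\<Omega> by (cases p) (auto simp: Bd_def parabolic_boundary_def)
    then have "u p \<le> v p" by (rule bdry)
    then show False using that \<eta> by (auto simp: Bd_def)
  qed
  obtain e0 where e0: "e0 > 0" "\<And>p. p \<in> Bd \<Longrightarrow> e0 \<le> snd p"
  proof (cases "Bd = {}")
    case False
    have "continuous_on Bd snd" by (intro continuous_intros)
    from continuous_attains_inf[OF cB False this] obtain p0 where
      "p0 \<in> Bd" "\<forall>p\<in>Bd. snd p0 \<le> snd p" by blast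
    then show ?thesis using that[of "snd p0"] Bpos by blast
  qed (use that[of 1] in auto)
  \<comment> \<open>Below \<open>e0\<close> for the previous reason, and at most t / 2 so that the
    own time of the barriers at (x, t) is at least t / 2.\<close>
  define s0 where "s0 = min (e0 / 2) (t / 2)"
  have s0: "0 < s0" "s0 < e0" "s0 \<le> t / 2" "s0 < T" using e0 t by (auto simp: s0_def)
  \<comment> \<open>The shift between actual time and own time of the barriers: at \<open>s0\<close>
    their own time is \<delta>. It may be negative.\<close>
  define \<tau> where "\<tau> = s0 - \<delta>"
  define h where "h z p = exp (- \<alpha> z * ln (snd p) - k z * Q z (fst p) / snd p)" for z p
  \<comment> \<open>The slope of a term linear in time that pays for the bounded errors
    \<open>C1 z\<close>; dividing by \<open>bm\<close>, the smaller diffusivity, makes it sufficient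
    for both.\<close>
  define CC where "CC = (\<Sum>z\<in>Z. a \<delta> z * C1 z) / bm"
  have CC0: "CC \<ge> 0" unfolding CC_def by (intro divide_nonneg_pos sum_nonneg mult_nonneg_nonneg a0 bm less_imp_le[OF Zp(4)])
  define \<psi> where "\<psi> p = (\<Sum>z\<in>Z. a \<delta> z * h z (p - (0, \<tau>))) + (CC * (snd p - s0) + \<eta>)" for p
  have Dh: "D2on (UNIV \<times> {\<tau><..}) (\<lambda>p. a \<delta> z * h z (p - (0, \<tau>))) (\<lambda>p. a \<delta> z *\<^sub>R g z (p - (0, \<tau>)))
    (\<lambda>p j. a \<delta> z *\<^sub>R H z (p - (0, \<tau>)) j)" if "z \<in> Z" for z
    unfolding h_def by (intro D2on_cmult D2on_time_shift Zp(8) that)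
  have Dl: "D2on (UNIV \<times> {\<tau><..}) (\<lambda>p::'a \<times> real. CC * (snd p - s0) + \<eta>) (\<lambda>p. (0, CC)) (\<lambda>p j. (0, 0 * snd j))"
    by (intro D2on_snd[where r'' = "\<lambda>_. 0"]) (auto intro!: derivative_eq_intros)
  have D\<psi>: "D2on (UNIV \<times> {\<tau><..}) \<psi> (\<lambda>p. (\<Sum>z\<in>Z. a \<delta> z *\<^sub>R g z (p - (0, \<tau>))) + (0, CC))
    (\<lambda>p j. (\<Sum>z\<in>Z. a \<delta> z *\<^sub>R H z (p - (0, \<tau>)) j) + (0, 0 * snd j))"
    unfolding \<psi>_def by (intro D2on_add D2on_sum Z(2) Dh Dl)
  have sub: "\<Omega> \<times> {s0<..<T} \<subseteq> UNIV \<times> {\<tau><..}" "closure \<Omega> \<times> {s0..T} \<subseteq> UNIV \<times> {\<tau><..}" using \<delta> by (auto simp: \<tau>_def)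
  have sup: "lap (\<lambda>j. (\<Sum>z\<in>Z. a \<delta> z *\<^sub>R H z (p - (0, \<tau>)) j) + (0, 0 * snd j)) \<le> b * snd ((\<Sum>z\<in>Z. a \<delta> z *\<^sub>R g z (p - (0, \<tau>))) + (0, CC))"
    if p: "p \<in> \<Omega> \<times> {s0<..<T}" and b: "bm \<le> b" "b \<le> bp" for p b
  proof -
    have p': "p - (0, \<tau>) \<in> closure \<Omega> \<times> {0<..}" using p \<delta> closure_subset[of \<Omega>] by (cases p) (auto simp: \<tau>_def)
    have ls: "lap (\<lambda>j. \<Sum>z\<in>Z'. a \<delta> z *\<^sub>R H z (p - (0, \<tau>)) j) = (\<Sum>z\<in>Z'. a \<delta> z * lap (H z (p - (0, \<tau>))))" if "finite Z'" for Z'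
      using that by (induction Z' rule: finite_induct) (simp_all add: lap_add lap_scaleR, simp add: lap_def)
    have "lap (\<lambda>j. (\<Sum>z\<in>Z. a \<delta> z *\<^sub>R H z (p - (0, \<tau>)) j) + (0, 0 * snd j)) = (\<Sum>z\<in>Z. a \<delta> z * lap (H z (p - (0, \<tau>))))"
      by (simp only: lap_add lap_snd ls[OF Z(2)] add_0_right)
    also have "\<dots> \<le> (\<Sum>z\<in>Z. a \<delta> z * (b * snd (g z (p - (0, \<tau>))) + C1 z))"
      by (intro sum_mono mult_left_mono Zp(9) p' b a0)
    also have "\<dots> = b * (\<Sum>z\<in>Z. a \<delta> z * snd (g z (p - (0, \<tau>)))) + bm * CC"
    proof -
      have "bm * CC = (\<Sum>z\<in>Z. a \<delta> z * C1 z)" using bm by (simp add: CC_def)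
      then show ?thesis by (simp add: distrib_left sum.distrib sum_distrib_left mult.left_commute)
    qed
    also have "\<dots> \<le> b * (\<Sum>z\<in>Z. a \<delta> z * snd (g z (p - (0, \<tau>)))) + b * CC"
      using b CC0 by (intro add_left_mono mult_right_mono) auto
    also have "\<dots> = b * snd ((\<Sum>z\<in>Z. a \<delta> z *\<^sub>R g z (p - (0, \<tau>))) + (0, CC))"
      by (simp add: snd_sum distrib_left)
    finally show ?thesis .
  qed
  have h0: "h z p \<ge> 0" for z p by (simp add: h_def)
  have sum0: "0 \<le> (\<Sum>z\<in>Z. a \<delta> z * h z p)" for p by (intro sum_nonneg mult_nonneg_nonneg a0 h0)
  have "u (x, t) - v (x, t) \<le> \<psi> (x, t)"
  proof (rule core_comparison[OF \<Omega>(1,2) bm(1) _ u v _ _ D2on_subset[OF D\<psi> sub(1)] _ sup sup])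
    show "continuous_on (closure \<Omega> \<times> {s0..T}) \<psi>"
      by (rule continuous_on_subset[OF D2on_continuous[OF D\<psi>] sub(2)])
    show "u (y, s0) - v (y, s0) \<le> \<psi> (y, s0)" if y: "y \<in> closure \<Omega>" for y
    proof (cases "y \<in> K")
      case True
      have "(y, s0) \<notin> Bd" using e0(2)[of "(y, s0)"] s0 by auto
      then have "u (y, s0) - v (y, s0) < \<eta>" using True s0 by (auto simp: Bd_def)
      then show ?thesis using sum0[of "(y, s0) - (0, \<tau>)"] by (simp add: \<psi>_def)
    next
      case False
      then obtain z where z: "z \<in> Z" "Q z y < \<delta>" using y by (auto simp: K_def not_le)
      have "k z * Q z y / \<delta> \<le> k z"
        using Zp(3)[OF z(1)] z(2) \<delta>(2) by (simp add: divide_le_eq mult_left_mono)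
      then have "exp (- \<alpha> z * ln \<delta> - k z) \<le> h z (y, \<delta>)" by (simp add: h_def)
      then have "a \<delta> z * exp (- \<alpha> z * ln \<delta> - k z) \<le> a \<delta> z * h z (y, \<delta>)" using a0 by (rule mult_left_mono)
      moreover have "a \<delta> z * exp (- \<alpha> z * ln \<delta> - k z) = 2 * M"
        by (simp add: a_def exp_add[symmetric])
      moreover have "a \<delta> z * h z (y, \<delta>) \<le> (\<Sum>z\<in>Z. a \<delta> z * h z (y, \<delta>))"
        using z Z(2) by (intro member_le_sum mult_nonneg_nonneg a0 h0)
      moreover have "(y, s0) - (0, \<tau>) = (y, \<delta>)" by (simp add: \<tau>_def)
      ultimately have "2 * M \<le> \<psi> (y, s0)" using \<eta> by (simp add: \<psi>_def)
      moreover have "\<bar>u (y, s0)\<bar> \<le> M" "\<bar>v (y, s0)\<bar> \<le> M" using y s0 by (auto intro!: u(2) v(2))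
      ultimately show ?thesis by linarith
    qed
    show "u (y, s) - v (y, s) \<le> \<psi> (y, s)" if "y \<in> frontier \<Omega>" "s0 \<le> s" "s < T" for y s
    proof -
      have "u (y, s) \<le> v (y, s)" using that s0 by (intro bdry) (auto simp: parabolic_boundary_def)
      moreover have "0 \<le> CC * (s - s0)" using CC0 that by simp
      ultimately show ?thesis using sum0[of "(y, s) - (0, \<tau>)"] \<eta> by (simp add: \<psi>_def)
    qed
  qed (use bm s0 xc t in auto)
  also have "\<psi> (x, t) \<le> S \<delta> + \<eta>"
  proof -
    have "a \<delta> z * h z ((x, t) - (0, \<tau>)) + a \<delta> z * C1 z / bm * T \<le> a \<delta> z * (exp (- \<alpha> z * ln (t / 2)) + C1 z / bm * T)" if z: "z \<in> Z" for z
    proof -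
      have tt: "t / 2 \<le> t - \<tau>" using s0 \<delta> by (simp add: \<tau>_def)
      then have "ln (t / 2) \<le> ln (t - \<tau>)" using t by simp
      then have "\<alpha> z * ln (t / 2) \<le> \<alpha> z * ln (t - \<tau>)" using Zp(2)[OF z] by (intro mult_left_mono) auto
      moreover have "t - \<tau> > 0" using tt t by linarith
      then have "0 \<le> k z * Q z x / (t - \<tau>)"
        by (intro divide_nonneg_pos mult_nonneg_nonneg Zp(5)[OF z] less_imp_le[OF Zp(3)[OF z]])
      ultimately have "h z ((x, t) - (0, \<tau>)) \<le> exp (- \<alpha> z * ln (t / 2))" by (simp add: h_def)
      then have "a \<delta> z * h z ((x, t) - (0, \<tau>)) \<le> a \<delta> z * exp (- \<alpha> z * ln (t / 2))" using a0 by (rule mult_left_mono)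
      then show ?thesis by (simp add: distrib_left)
    qed
    then have "(\<Sum>z\<in>Z. a \<delta> z * h z ((x, t) - (0, \<tau>)) + a \<delta> z * C1 z / bm * T) \<le> S \<delta>"
      unfolding S_def by (rule sum_mono)
    moreover have "(\<Sum>z\<in>Z. a \<delta> z * C1 z / bm * T) = CC * T"
      by (simp add: CC_def sum_divide_distrib sum_distrib_right)
    moreover have "CC * (t - s0) \<le> CC * T" using CC0 s0 t by (intro mult_left_mono) auto
    ultimately show ?thesis by (simp add: \<psi>_def sum.distrib)
  qed
  also have "S \<delta> + \<eta> \<le> \<epsilon>" using \<delta>(1) by (simp add: \<eta>_def)
  finally show "u (x, t) \<le> v (x, t) + \<epsilon>" by simp
qed

section \<open>Barriers at the parabolic boundary\<close>

text \<open>The second-order expansion of the boundary graph at \<open>z\<close> yields a ball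
  outside the domain that touches its closure only at \<open>z\<close>. The difference of Gaussians
  around the centre of that ball is superharmonic outside it.\<close>

lemma exterior_barrier:
  fixes \<Omega> :: "'a::euclidean_space set"
  assumes \<Omega>: "open \<Omega>" "smooth_boundary \<Omega>" and z: "z \<in> frontier \<Omega>"
  obtains w G H where "D2on UNIV w G H" "w z = 0" "\<And>x. x \<in> closure \<Omega> \<Longrightarrow> x \<noteq> z \<Longrightarrow> 0 < w x"
    "\<And>x. x \<in> closure \<Omega> \<Longrightarrow> (\<Sum>i\<in>Basis. H x i \<bullet> i) \<le> 0"
proof -
  from \<Omega>(2) z obtain r0 \<nu> \<gamma> where r0: "r0 > 0" and \<nu>: "norm \<nu> = 1" and \<gamma>: "smooth_on UNIV \<gamma>"
    and loc: "\<Omega> \<inter> ball z r0 = {x \<in> ball z r0. x \<bullet> \<nu> > \<gamma> (x - (x \<bullet> \<nu>) *\<^sub>R \<nu>)}"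
    unfolding smooth_boundary_def by blast
  define g where "g x = x \<bullet> \<nu> - \<gamma> (x - (x \<bullet> \<nu>) *\<^sub>R \<nu>)" for x
  obtain Gg Hg where gr: "D2on UNIV (\<lambda>x. x \<bullet> \<nu> - \<gamma> (x - (x \<bullet> \<nu>) *\<^sub>R \<nu>)) Gg Hg" "\<And>x. 1 \<le> norm (Gg x)"
    "continuous_on UNIV (\<lambda>x. \<Sum>i\<in>Basis. Hg x i \<bullet> i)"
    by (rule graph_function[OF \<nu> \<gamma>]) (rule that)
  have g: "D2on UNIV g Gg Hg" using gr(1) unfolding g_def[abs_def] .
  have cg: "continuous_on UNIV g" by (rule D2on_continuous[OF g])
  have loc': "\<Omega> \<inter> ball z r0 = {x \<in> ball z r0. g x > 0}" using loc by (simp add: g_def)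
  have gz: "g z = 0" using r0 by (intro frontier_graph_zero[OF \<Omega>(1) cg loc' z]) simp
  have gpos: "0 \<le> g x" if x: "x \<in> closure \<Omega>" "x \<in> ball z r0" for x
  proof (cases "x \<in> frontier \<Omega>")
    case True
    then show ?thesis using frontier_graph_zero[OF \<Omega>(1) cg loc' True x(2)] by simp
  next
    case False
    then have "x \<in> \<Omega>" using x \<Omega>(1) by (simp add: frontier_def interior_open)
    then have "x \<in> {x \<in> ball z r0. g x > 0}" using x unfolding loc'[symmetric] by blast
    then show ?thesis by simp
  qed
  define n where "n = Gg z"
  have n: "norm n \<ge> 1" using gr(2) by (simp add: n_def)
  have lH: "linear (Hg z)" by (rule D2on_linear[OF g]) simp
  obtain KH where KH: "KH > 0" "\<And>k. norm (Hg z k) \<le> KH * norm k" using linear_bounded_pos[OF lH] by blast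
  \<comment> \<open>\<open>KH\<close> bounds the Hessian part of the expansion and 1 is its
    remainder; near \<open>z\<close> the closure then lies above the paraboloid n \<bullet> (x - z)
    = - C |x - z|^2.\<close>
  define C where "C = KH + 1"
  have C: "C > 0" using KH by (simp add: C_def)
  from Peano[OF open_UNIV UNIV_I g zero_less_one, of z]
  obtain d0 where d0: "d0 > 0" "\<And>x. dist x z < d0 \<Longrightarrow> \<bar>g x - quad (g z) (Gg z) (Hg z) z x\<bar> \<le> 1 * (norm (x - z))\<^sup>2"
    unfolding eventually_nhds_metric by blast
  define d where "d = min d0 r0"
  have d: "d > 0" using d0 r0 by (simp add: d_def)
  have key: "- C * (norm (x - z))\<^sup>2 \<le> n \<bullet> (x - z)" if x: "x \<in> closure \<Omega>" "dist x z < d" for x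
  proof -
    have "0 \<le> g x" using x by (intro gpos) (auto simp: d_def dist_commute)
    moreover have "g x \<le> quad 0 n (Hg z) z x + (norm (x - z))\<^sup>2"
      using d0(2)[of x] x by (simp add: d_def gz n_def)
    moreover have "Hg z (x - z) \<bullet> (x - z) \<le> KH * (norm (x - z))\<^sup>2"
    proof -
      have "Hg z (x - z) \<bullet> (x - z) \<le> norm (Hg z (x - z)) * norm (x - z)" by (rule norm_cauchy_schwarz)
      also have "\<dots> \<le> (KH * norm (x - z)) * norm (x - z)" using KH by (intro mult_right_mono) auto
      finally show ?thesis by (simp add: power2_eq_square)
    qed
    moreover have "0 \<le> KH * (norm (x - z))\<^sup>2" using KH by simp
    moreover have "quad 0 n (Hg z) z x = n \<bullet> (x - z) + Hg z (x - z) \<bullet> (x - z) / 2" by (simp add: quad_def)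
    moreover have "- C * (norm (x - z))\<^sup>2 = - (KH * (norm (x - z))\<^sup>2) - (norm (x - z))\<^sup>2" by (simp add: C_def algebra_simps)
    ultimately show ?thesis by linarith
  qed
  \<comment> \<open>The first bound makes the ball small compared with the curvature of that
    paraboloid, for points near \<open>z\<close>; the second makes its diameter smaller than
    \<open>d\<close>, for all others.\<close>
  define \<rho> where "\<rho> = min (1 / (4 * C)) (d / (4 * norm n))"
  have \<rho>: "\<rho> > 0" "2 * \<rho> * C < 1" "2 * (\<rho> * norm n) < d"
  proof -
    have n0: "norm n > 0" using n by linarith
    show "\<rho> > 0" using C d n0 by (simp add: \<rho>_def)
    have "\<rho> * C \<le> 1 / (4 * C) * C" using C by (intro mult_right_mono) (auto simp: \<rho>_def)
    then show "2 * \<rho> * C < 1" using C by simp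
    have "\<rho> * norm n \<le> d / (4 * norm n) * norm n" by (intro mult_right_mono) (auto simp: \<rho>_def)
    also have "\<dots> = d / 4" using n0 by simp
    finally show "2 * (\<rho> * norm n) < d" using d by linarith
  qed
  define c where "c = z - \<rho> *\<^sub>R n"
  define R where "R = \<rho> * norm n"
  have R: "R > 0" unfolding R_def using \<rho>(1) n by (intro mult_pos_pos) linarith+
  have zc: "norm (z - c) = R" using \<rho> by (simp add: c_def R_def)
  have ext: "R\<^sup>2 < (norm (x - c))\<^sup>2" if x: "x \<in> closure \<Omega>" "x \<noteq> z" for x
  proof (cases "dist x z < d")
    case True
    have "x - c = (x - z) + \<rho> *\<^sub>R n" by (simp add: c_def)
    then have "(norm (x - c))\<^sup>2 = ((x - z) + \<rho> *\<^sub>R n) \<bullet> ((x - z) + \<rho> *\<^sub>R n)" by (simp only: power2_norm_eq_inner)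
    also have "\<dots> = (x - z) \<bullet> (x - z) + 2 * \<rho> * (n \<bullet> (x - z)) + \<rho>\<^sup>2 * (n \<bullet> n)"
      by (simp add: inner_add_left inner_add_right inner_commute[of "x - z" n] power2_eq_square distrib_left)
    also have "\<dots> = (norm (x - z))\<^sup>2 + 2 * \<rho> * (n \<bullet> (x - z)) + R\<^sup>2"
      by (simp add: R_def power_mult_distrib power2_norm_eq_inner)
    finally have "(norm (x - c))\<^sup>2 = (norm (x - z))\<^sup>2 + 2 * \<rho> * (n \<bullet> (x - z)) + R\<^sup>2" .
    moreover have "2 * \<rho> * (- C * (norm (x - z))\<^sup>2) \<le> 2 * \<rho> * (n \<bullet> (x - z))"
      using key[OF x(1) True] \<rho> by (intro mult_left_mono) auto
    moreover have "0 < (1 - 2 * \<rho> * C) * (norm (x - z))\<^sup>2" using \<rho> x by simp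
    ultimately show ?thesis by (simp add: algebra_simps)
  next
    case False
    have "norm (x - z) \<le> norm (x - c) + norm (z - c)" using norm_triangle_ineq4[of "x - c" "z - c"] by simp
    then have "R < norm (x - c)" using False \<rho>(3) zc by (simp add: dist_norm R_def)
    then show ?thesis using R by (intro power_strict_mono) auto
  qed
  \<comment> \<open>The Laplacian of exp (- k |x - c|^2) has the sign of 4 k |x - c|^2 - 2 N; with
    this \<open>k\<close> the expression is 0 on the sphere of radius \<open>R\<close> and positive
    outside.\<close>
  define k where "k = DIM('a) / (2 * R\<^sup>2)"
  have k: "k > 0" "4 * k * R\<^sup>2 = 2 * DIM('a)" using R by (auto simp: k_def)
  define q where "q x = (norm (x - c))\<^sup>2" for x
  have Dq: "D2on UNIV q (\<lambda>x. 2 *\<^sub>R (x - c)) (\<lambda>x k. 2 *\<^sub>R k)" unfolding q_def by (rule D2on_sq)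
  have De: "D2on UNIV (\<lambda>x. exp (- k * q x)) (\<lambda>x. (- k * exp (- k * q x)) *\<^sub>R (2 *\<^sub>R (x - c)))
    (\<lambda>x j. (k\<^sup>2 * exp (- k * q x)) *\<^sub>R (((2 *\<^sub>R (x - c)) \<bullet> j) *\<^sub>R (2 *\<^sub>R (x - c))) + (- k * exp (- k * q x)) *\<^sub>R (2 *\<^sub>R j))"
    by (rule D2on_compose[OF Dq, of "\<lambda>s. exp (- k * s)" "\<lambda>s. - k * exp (- k * s)" "\<lambda>s. k\<^sup>2 * exp (- k * s)"])
      (auto intro!: derivative_eq_intros simp: power2_eq_square)
  note Dw = D2on_diff[OF D2on_const[of UNIV "exp (- k * R\<^sup>2)"] De]
  show ?thesis
  proof (rule that[OF Dw])
    show "exp (- k * R\<^sup>2) - exp (- k * q z) = 0" by (simp add: q_def zc)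
    show "0 < exp (- k * R\<^sup>2) - exp (- k * q x)" if "x \<in> closure \<Omega>" "x \<noteq> z" for x
      using ext[OF that] k by (simp add: q_def)
    fix x assume x: "x \<in> closure \<Omega>"
    have Rq: "R\<^sup>2 \<le> q x" using ext[OF x] zc by (cases "x = z") (auto simp: q_def)
    have "(\<Sum>i\<in>Basis. (0 - ((k\<^sup>2 * exp (- k * q x)) *\<^sub>R (((2 *\<^sub>R (x - c)) \<bullet> i) *\<^sub>R (2 *\<^sub>R (x - c))) + (- k * exp (- k * q x)) *\<^sub>R (2 *\<^sub>R i))) \<bullet> i)
      = - ((k\<^sup>2 * exp (- k * q x)) * (\<Sum>i\<in>Basis. (((2 *\<^sub>R (x - c)) \<bullet> i) *\<^sub>R (2 *\<^sub>R (x - c))) \<bullet> i)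
         + (- k * exp (- k * q x)) * (\<Sum>i\<in>Basis. (2 *\<^sub>R i) \<bullet> (i::'a)))"
      by (simp only: diff_0 inner_minus_left inner_add_left inner_scaleR_left sum_negf sum.distrib sum_distrib_left)
    also have "\<dots> = - (k * exp (- k * q x) * (4 * k * q x - 2 * DIM('a)))"
    proof -
      have "(2 *\<^sub>R (x - c)) \<bullet> (2 *\<^sub>R (x - c)) = 4 * q x"
        unfolding q_def power2_norm_eq_inner inner_scaleR_left inner_scaleR_right by simp
      then show ?thesis
        unfolding trace_outer trace_scale_id by (simp add: power2_eq_square right_diff_distrib)
    qed
    also have "\<dots> \<le> 0"
    proof -
      have "4 * k * R\<^sup>2 \<le> 4 * k * q x" using Rq k by (intro mult_left_mono) auto
      then show ?thesis using k by simp
    qed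
    finally show "(\<Sum>i\<in>Basis. (0 - ((k\<^sup>2 * exp (- k * q x)) *\<^sub>R (((2 *\<^sub>R (x - c)) \<bullet> i) *\<^sub>R (2 *\<^sub>R (x - c))) + (- k * exp (- k * q x)) *\<^sub>R (2 *\<^sub>R i))) \<bullet> i) \<le> 0" .
  qed
qed

text \<open>Outside a small ball around \<open>z\<close> the barrier has a positive minimum, so a
  large multiple of it dominates the oscillation of \<open>u0\<close>; inside the ball continuity
  suffices.\<close>

lemma modulus_by_barrier:
  fixes u0 \<omega> :: "'a::metric_space \<Rightarrow> real"
  assumes K: "compact K" and u0: "continuous_on K u0" and w: "continuous_on K \<omega>" "\<And>x. x \<in> K \<Longrightarrow> x \<noteq> z \<Longrightarrow> 0 < \<omega> x"
    and z: "z \<in> K" "\<omega> z = 0" and e: "e > 0"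
  shows "\<exists>k\<ge>0. \<forall>x\<in>K. \<bar>u0 x - u0 z\<bar> \<le> e + k * \<omega> x"
proof -
  obtain d where d: "d > 0" "\<forall>x\<in>K. dist x z < d \<longrightarrow> dist (u0 x) (u0 z) < e"
    using u0 z e unfolding continuous_on_iff by blast
  have w0: "0 \<le> \<omega> x" if "x \<in> K" for x using w(2)[OF that] z by (cases "x = z") auto
  define K' where "K' = K - ball z d"
  have K': "compact K'" unfolding K'_def using K by (rule compact_diff) simp
  show ?thesis
  proof (cases "K' = {}")
    case True
    then have "\<forall>x\<in>K. \<bar>u0 x - u0 z\<bar> \<le> e + 0 * \<omega> x"
      using d by (fastforce simp: K'_def dist_real_def dist_commute)
    then show ?thesis by blast
  next
    case False
    have sub: "K' \<subseteq> K" by (auto simp: K'_def)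
    obtain x1 where x1: "x1 \<in> K'" "\<And>x. x \<in> K' \<Longrightarrow> \<omega> x1 \<le> \<omega> x"
      using continuous_attains_inf[OF K' False continuous_on_subset[OF w(1) sub]] by blast
    have "continuous_on K' (\<lambda>x. \<bar>u0 x - u0 z\<bar>)" by (intro continuous_intros continuous_on_subset[OF u0 sub])
    from continuous_attains_sup[OF K' False this] obtain x2 where x2: "x2 \<in> K'" "\<And>x. x \<in> K' \<Longrightarrow> \<bar>u0 x - u0 z\<bar> \<le> \<bar>u0 x2 - u0 z\<bar>" by blast
    have "x1 \<in> K" "x1 \<noteq> z" using x1(1) d(1) by (auto simp: K'_def)
    then have pos: "\<omega> x1 > 0" by (rule w(2))
    define k where "k = \<bar>u0 x2 - u0 z\<bar> / \<omega> x1"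
    have k: "k \<ge> 0" using pos by (simp add: k_def)
    have "\<bar>u0 x - u0 z\<bar> \<le> e + k * \<omega> x" if x: "x \<in> K" for x
    proof (cases "x \<in> K'")
      case True
      have "\<bar>u0 x - u0 z\<bar> \<le> k * \<omega> x1" using x2(2)[OF True] pos by (simp add: k_def)
      also have "\<dots> \<le> k * \<omega> x" using x1(2)[OF True] k by (rule mult_left_mono)
      finally show ?thesis using e by simp
    next
      case False
      then have "\<bar>u0 x - u0 z\<bar> < e" using d x by (auto simp: K'_def dist_real_def dist_commute)
      moreover have "0 \<le> k * \<omega> x" using k w0[OF x] by simp
      ultimately show ?thesis by linarith
    qed
    then show ?thesis using k by blast
  qed
qed

section \<open>Semicontinuous envelopes\<close>

text \<open>The upper semicontinuous envelope relative to \<open>S\<close>. Its lower counterpart is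
  written as minus the envelope of \<open>- u\<close>, so no second notion is required.\<close>

definition envelope :: "'a::metric_space set \<Rightarrow> ('a \<Rightarrow> real) \<Rightarrow> 'a \<Rightarrow> real"
  where "envelope S u p = Inf {m. \<exists>r>0. \<forall>q\<in>S. dist q p < r \<longrightarrow> u q \<le> m}"

lemma envelope_props:
  assumes u: "\<And>q. q \<in> S \<Longrightarrow> \<bar>u q\<bar> \<le> M"
  shows envelope_ge: "p \<in> S \<Longrightarrow> u p \<le> envelope S u p"
    and envelope_le: "p \<in> S \<Longrightarrow> r > 0 \<Longrightarrow> (\<And>q. q \<in> S \<Longrightarrow> dist q p < r \<Longrightarrow> u q \<le> m) \<Longrightarrow> envelope S u p \<le> m"
    and envelope_lessD: "p \<in> S \<Longrightarrow> envelope S u p < c \<Longrightarrow> \<exists>m<c. \<exists>r>0. \<forall>q\<in>S. dist q p < r \<longrightarrow> u q \<le> m"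
proof -
  let ?X = "\<lambda>p. {m. \<exists>r>0. \<forall>q\<in>S. dist q p < r \<longrightarrow> u q \<le> m}"
  have ne: "M \<in> ?X p" for p
  proof -
    have "\<forall>q\<in>S. dist q p < 1 \<longrightarrow> u q \<le> M" using u by (simp add: abs_le_iff)
    then show ?thesis using zero_less_one by blast
  qed
  have lb: "u p \<le> m" if "p \<in> S" "m \<in> ?X p" for p m using that by force
  then have bdd: "bdd_below (?X p)" if "p \<in> S" for p using that by (intro bdd_belowI[of _ "u p"]) blast
  show "p \<in> S \<Longrightarrow> u p \<le> envelope S u p" unfolding envelope_def using ne lb by (intro cInf_greatest) blast+
  show "p \<in> S \<Longrightarrow> r > 0 \<Longrightarrow> (\<And>q. q \<in> S \<Longrightarrow> dist q p < r \<Longrightarrow> u q \<le> m) \<Longrightarrow> envelope S u p \<le> m"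
    unfolding envelope_def using bdd by (intro cInf_lower) auto
  show "p \<in> S \<Longrightarrow> envelope S u p < c \<Longrightarrow> \<exists>m<c. \<exists>r>0. \<forall>q\<in>S. dist q p < r \<longrightarrow> u q \<le> m"
    unfolding envelope_def using cInf_lessD[of "?X p" c] ne by blast
qed

lemma envelope_usc:
  assumes u: "\<And>q. q \<in> S \<Longrightarrow> \<bar>u q\<bar> \<le> M"
  shows "usc_on S (envelope S u)"
proof (rule usc_onI)
  fix p c assume p: "p \<in> S" "envelope S u p < c"
  obtain m r where m: "m < c" "r > 0" "\<forall>q\<in>S. dist q p < r \<longrightarrow> u q \<le> m"
    using envelope_lessD[OF u p] by blast
  have "envelope S u q < c" if q: "q \<in> S" "dist q p < r / 2" for q
  proof -
    have "envelope S u q \<le> m"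
    proof (rule envelope_le[OF u q(1), where r = "r / 2"])
      fix x assume x: "x \<in> S" "dist x q < r / 2"
      have "dist x p \<le> dist x q + dist q p" by (rule dist_triangle)
      then have "dist x p < r" using x q by linarith
      then show "u x \<le> m" using m x by blast
    qed (use m in auto)
    then show ?thesis using m by linarith
  qed
  then show "\<exists>e>0. \<forall>q\<in>S. dist q p < e \<longrightarrow> envelope S u q < c" using m by (intro exI[of _ "r / 2"]) auto
qed

lemma envelope_le_continuous:
  fixes u \<beta> :: "'a::metric_space \<Rightarrow> real"
  assumes u: "\<And>q. q \<in> S \<Longrightarrow> \<bar>u q\<bar> \<le> M" and \<beta>: "continuous_on S \<beta>" and le: "\<And>q. q \<in> S \<Longrightarrow> u q \<le> \<beta> q" and p: "p \<in> S"
  shows "envelope S u p \<le> \<beta> p"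
proof (rule field_le_epsilon)
  fix e :: real assume e: "e > 0"
  obtain d where d: "d > 0" "\<forall>q\<in>S. dist q p < d \<longrightarrow> dist (\<beta> q) (\<beta> p) < e"
    using \<beta> p e unfolding continuous_on_iff by blast
  show "envelope S u p \<le> \<beta> p + e"
  proof (rule envelope_le[OF u p d(1)])
    fix q assume q: "q \<in> S" "dist q p < d"
    then have "dist (\<beta> q) (\<beta> p) < e" using d by blast
    then show "u q \<le> \<beta> p + e" using le[OF q(1)] by (simp add: dist_real_def)
  qed
qed

lemma continuous_on_usc_lsc:
  fixes u :: "'a::metric_space \<Rightarrow> real"
  assumes "usc_on S u" "usc_on S (\<lambda>p. - u p)"
  shows "continuous_on S u"
  unfolding continuous_on_def
proof (intro ballI order_tendstoI)
  fix p c assume p: "p \<in> S"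
  { assume "u p < c" then show "\<forall>\<^sub>F q in at p within S. u q < c" using assms(1) p by (simp add: usc_on_def) }
  { assume "c < u p" then have "\<forall>\<^sub>F q in at p within S. - u q < - c" using assms(2)[unfolded usc_on_def, rule_format, OF p, of "- c"] by simp
    then show "\<forall>\<^sub>F q in at p within S. c < u q" by simp }
qed

lemma continuous_on_UNIV_isCont: "continuous_on UNIV f \<Longrightarrow> isCont f p"
  using continuous_on_eq_continuous_at[OF open_UNIV] by blast

text \<open>A strict violation at a touching point survives a small term e |q - p|^2 and persists
  nearby. That term gives room e r^2 on the sphere, which both Perron arguments exploit.\<close>

lemma strict_perturbation:
  fixes p :: "'a::euclidean_space \<times> real" and A :: "'a \<times> real \<Rightarrow> 'a \<times> real"
  assumes A: "linear A" and F: "continuous_on UNIV F" and lt: "lap A < F (snd a)" and W: "open W" "p \<in> W"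
    and P: "\<forall>\<^sub>F q in nhds p. P q"
  obtains e r g H where "e > 0" "r > 0" "cball p r \<subseteq> W" "\<And>q. q \<in> cball p r \<Longrightarrow> P q"
    "D2on UNIV (\<lambda>q. quad c a A p q + e * (norm (q - p))\<^sup>2) g H" "\<And>q. q \<in> ball p r \<Longrightarrow> lap (H q) < F (snd (g q))"
proof -
  \<comment> \<open>The perturbation adds 2 e N to the trace, which uses up half of the gap.\<close>
  define e where "e = (F (snd a) - lap A) / (4 * DIM('a))"
  have e: "e > 0" using lt by (simp add: e_def)
  define B where "B = (\<lambda>k. A k + (2 * e) *\<^sub>R k)"
  have B: "linear B" unfolding B_def by (rule linear_pert[OF A])
  have lapB: "lap B < F (snd a)" 
  proof -
    have "lap B = lap A + 2 * e * DIM('a)" unfolding B_def by (rule lap_pert)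
    also have "2 * e * DIM('a) = (F (snd a) - lap A) / 2" by (simp add: e_def)
    finally show ?thesis using lt by (simp add: field_simps)
  qed
  define g where "g q = a + (1/2) *\<^sub>R (B (q - p) + adjoint B (q - p))" for q
  have D: "D2on UNIV (quad c a B p) g (\<lambda>q k. (1/2) *\<^sub>R (B k + adjoint B k))"
    unfolding g_def by (rule D2on_quad[OF B])
  have "continuous_on UNIV g" by (rule D2on_continuous_gradient[OF D])
  then have "continuous_on UNIV (\<lambda>q. F (snd (g q)))"
    by (intro continuous_on_compose2[OF F, of UNIV "\<lambda>q. snd (g q)"] continuous_on_snd) auto
  then have "isCont (\<lambda>q. F (snd (g q))) p" by (rule continuous_on_UNIV_isCont)
  then have lim: "((\<lambda>q. F (snd (g q))) \<longlongrightarrow> F (snd (g p))) (nhds p)"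
    unfolding isCont_def by (rule tendsto_at_iff_tendsto_nhds[THEN iffD1])
  have gp: "g p = a" using linear_0[OF B] linear_0[OF adjoint_linear[OF B]] by (simp add: g_def)
  have "\<forall>\<^sub>F q in nhds p. lap B < F (snd (g q))"
    by (rule order_tendstoD(1)[OF lim]) (simp only: gp lapB)
  then have "\<forall>\<^sub>F q in nhds p. lap B < F (snd (g q)) \<and> P q \<and> q \<in> W"
    using P eventually_nhds_in_open[OF W] by eventually_elim auto
  then obtain d where "d > 0" "\<forall>q. dist q p < d \<longrightarrow> lap B < F (snd (g q)) \<and> P q \<and> q \<in> W"
    unfolding eventually_nhds_metric by blast
  then have d: "d > 0" "\<And>q. dist q p < d \<Longrightarrow> lap B < F (snd (g q)) \<and> P q \<and> q \<in> W" by blast+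
  have E: "(\<lambda>q. quad c a A p q + e * (norm (q - p))\<^sup>2) = quad c a B p"
    by (simp add: fun_eq_iff quad_pert B_def)
  show ?thesis
  proof (rule that[OF e, of "d / 2"])
    show "0 < d / 2" using d by simp
    have near: "dist q p < d" if "q \<in> cball p (d / 2)" for q
      using d(1) that by (simp add: dist_commute)
    show "cball p (d / 2) \<subseteq> W" using d(2)[OF near] by blast
    show "P q" if "q \<in> cball p (d / 2)" for q using d(2)[OF near[OF that]] by blast
    show "D2on UNIV (\<lambda>q. quad c a A p q + e * (norm (q - p))\<^sup>2) g (\<lambda>q k. (1/2) *\<^sub>R (B k + adjoint B k))"
      unfolding E by (rule D)
    show "lap (\<lambda>k. (1/2) *\<^sub>R (B k + adjoint B k)) < F (snd (g q))" if "q \<in> ball p (d / 2)" for q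
      unfolding lap_adjoint[OF B] using d(2)[of q] d(1) that by (simp add: dist_commute)
  qed
qed

section \<open>Perron's method\<close>

text \<open>Unlike \<open>parabolic_boundary\<close>, the boundary condition here includes the corners.\<close>

definition admissible :: "real \<Rightarrow> real \<Rightarrow> 'a::euclidean_space set \<Rightarrow> ('a \<Rightarrow> real) \<Rightarrow> ('a \<times> real \<Rightarrow> real) \<Rightarrow> bool"
  where "admissible bm bp \<Omega> u0 v \<longleftrightarrow> usc_on (closure \<Omega> \<times> {0..}) v \<and> vsub (bflux bm bp) (\<Omega> \<times> {0<..}) v \<and>
    (\<forall>x\<in>closure \<Omega>. v (x, 0) \<le> u0 x) \<and> (\<forall>x\<in>frontier \<Omega>. \<forall>t\<ge>0. v (x, t) \<le> 0)"

lemma admissible_le_supersolution: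
  fixes \<Omega> :: "'a::euclidean_space set"
  assumes \<Omega>: "open \<Omega>" "bounded \<Omega>" and bm: "0 < bm" "bm < bp" and v: "admissible bm bp \<Omega> u0 v"
    and \<beta>: "D2on UNIV \<beta> g H" "\<And>p. p \<in> \<Omega> \<times> {0<..} \<Longrightarrow> lap (H p) \<le> bflux bm bp (snd (g p))"
    and b: "\<And>x. x \<in> closure \<Omega> \<Longrightarrow> u0 x \<le> \<beta> (x, 0)" "\<And>x t. x \<in> frontier \<Omega> \<Longrightarrow> 0 \<le> t \<Longrightarrow> 0 \<le> \<beta> (x, t)"
    and p: "p \<in> closure \<Omega> \<times> {0..}"
  shows "v p \<le> \<beta> p"
proof -
  obtain x t where xt: "p = (x, t)" "x \<in> closure \<Omega>" "0 \<le> t" using p by auto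
  have v': "usc_on (closure \<Omega> \<times> {0..}) v" "vsub (bflux bm bp) (\<Omega> \<times> {0<..}) v"
    "\<And>x. x \<in> closure \<Omega> \<Longrightarrow> v (x, 0) \<le> u0 x" "\<And>x t. x \<in> frontier \<Omega> \<Longrightarrow> 0 \<le> t \<Longrightarrow> v (x, t) \<le> 0"
    using v by (auto simp: admissible_def)
  have "v (x, t) \<le> \<beta> (x, t)"
  \<comment> \<open>The final time t + 1 is chosen because the comparison reaches only times
    strictly before the end.\<close>
  proof (rule classical_comparison[OF \<Omega> bflux_continuous bflux_strict_mono[OF bm]])
    show "vsub (bflux bm bp) (\<Omega> \<times> {0<..<t + 1}) v" by (rule vsub_mono[OF v'(2)]) auto
    show "usc_on (closure \<Omega> \<times> {0..t + 1}) v" by (rule usc_on_subset[OF v'(1)]) auto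
    show "D2on (\<Omega> \<times> {0<..<t + 1}) \<beta> g H" by (rule D2on_subset[OF \<beta>(1)]) simp
    show "continuous_on (closure \<Omega> \<times> {0..t + 1}) \<beta>" by (rule continuous_on_subset[OF D2on_continuous[OF \<beta>(1)]]) simp
    show "lap (H p) \<le> bflux bm bp (snd (g p))" if "p \<in> \<Omega> \<times> {0<..<t + 1}" for p using that by (intro \<beta>(2)) auto
    show "v (x, 0) \<le> \<beta> (x, 0)" if "x \<in> closure \<Omega>" for x
      by (rule order_trans[OF v'(3)[OF that] b(1)[OF that]])
    show "v (x, t) \<le> \<beta> (x, t)" if "x \<in> frontier \<Omega>" "0 \<le> t" for x t using v'(4) b(2) that order_trans by blast
  qed (use xt in auto)
  then show ?thesis by (simp add: xt)
qed

lemma subsolution_admissible: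
  fixes \<Omega> :: "'a::euclidean_space set"
  assumes \<Omega>: "open \<Omega>"
    and \<beta>: "D2on UNIV \<beta> g H" "\<And>p. p \<in> \<Omega> \<times> {0<..} \<Longrightarrow> bflux bm bp (snd (g p)) \<le> lap (H p)"
    and b: "\<And>x. x \<in> closure \<Omega> \<Longrightarrow> \<beta> (x, 0) \<le> u0 x" "\<And>x t. x \<in> frontier \<Omega> \<Longrightarrow> 0 \<le> t \<Longrightarrow> \<beta> (x, t) \<le> 0"
  shows "admissible bm bp \<Omega> u0 \<beta>"
  unfolding admissible_def
proof (intro conjI ballI allI impI b)
  show "usc_on (closure \<Omega> \<times> {0..}) \<beta>"
    by (intro usc_on_continuous continuous_on_subset[OF D2on_continuous[OF \<beta>(1)]]) simp
  show "vsub (bflux bm bp) (\<Omega> \<times> {0<..}) \<beta>"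
    using \<Omega> by (intro classical_vsub[OF _ D2on_subset[OF \<beta>(1)] \<beta>(2)]) (auto intro: open_Times)
qed

text \<open>The same \<open>\<omega>\<close> pinches admissible functions at \<open>z\<close> from both sides.\<close>

lemma two_sided_barrier:
  fixes \<Omega> :: "'a::euclidean_space set"
  assumes \<Omega>: "open \<Omega>" "bounded \<Omega>" and bm: "0 < bm" "bm < bp"
    and u0: "continuous_on (closure \<Omega>) u0" "\<And>x. x \<in> frontier \<Omega> \<Longrightarrow> u0 x = 0"
    and z: "z \<in> closure \<Omega>" and \<omega>: "D2on UNIV \<omega> G H" "\<omega> z = 0" "\<And>x. x \<in> closure \<Omega> \<Longrightarrow> x \<noteq> z \<Longrightarrow> 0 < \<omega> x"
    and C: "C \<ge> 0" "\<And>x. x \<in> closure \<Omega> \<Longrightarrow> (\<Sum>i\<in>Basis. H x i \<bullet> i) \<le> bm * C" and e: "e > 0"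
  obtains k where "k \<ge> 0"
    "\<And>v p. admissible bm bp \<Omega> u0 v \<Longrightarrow> p \<in> closure \<Omega> \<times> {0..} \<Longrightarrow> v p \<le> u0 z + e + k * (\<omega> (fst p) + C * snd p)"
    "admissible bm bp \<Omega> u0 (\<lambda>p. u0 z - e - k * (\<omega> (fst p) + C * snd p))"
    "continuous_on UNIV (\<lambda>p. \<omega> (fst p) + C * snd p)"
proof -
  have K: "compact (closure \<Omega>)" using \<Omega> by simp
  have c\<omega>: "continuous_on (closure \<Omega>) \<omega>" by (rule continuous_on_subset[OF D2on_continuous[OF \<omega>(1)]]) simp
  obtain k where k: "k \<ge> 0" "\<And>x. x \<in> closure \<Omega> \<Longrightarrow> \<bar>u0 x - u0 z\<bar> \<le> e + k * \<omega> x"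
    using modulus_by_barrier[OF K u0(1) c\<omega> \<omega>(3) z \<omega>(2) e] by blast
  define \<Theta> where "\<Theta> p = \<omega> (fst p) + C * snd p" for p :: "'a \<times> real"
  have D1: "D2on UNIV (\<lambda>p::'a \<times> real. \<omega> (fst p)) (\<lambda>p. (G (fst p), 0)) (\<lambda>p j. (H (fst p) (fst j), 0))"
    using D2on_fst[OF \<omega>(1)] by simp
  have D2: "D2on UNIV (\<lambda>p::'a \<times> real. C * snd p) (\<lambda>p. (0, C)) (\<lambda>p j. (0, 0 * snd j))"
    using D2on_snd[of UNIV "\<lambda>s. C * s" "\<lambda>_. C" "\<lambda>_. 0", where 'a='a]
    unfolding UNIV_Times_UNIV by (rule meta_mp) (auto intro!: derivative_eq_intros)
  have D\<Theta>: "D2on UNIV \<Theta> (\<lambda>p. (G (fst p), 0) + (0, C)) (\<lambda>p j. (H (fst p) (fst j), 0) + (0, 0 * snd j))"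
    unfolding \<Theta>_def by (rule D2on_add[OF D1 D2])
  have lap\<Theta>: "lap (\<lambda>j. (H x (fst j), 0) + (0, 0 * snd j)) \<le> bm * C" if "x \<in> closure \<Omega>" for x
    using C(2)[OF that] by (simp only: lap_add lap_snd lap_fst add_0_right)
  have sub: "x \<in> closure \<Omega>" if "x \<in> \<Omega> \<or> x \<in> frontier \<Omega>" for x using that closure_subset by (auto simp: frontier_def)
  note Dk = D2on_cmult[OF D\<Theta>, of k]
  have up: "v p \<le> u0 z + e + k * \<Theta> p" if v: "admissible bm bp \<Omega> u0 v" and p: "p \<in> closure \<Omega> \<times> {0..}" for v p
  proof (rule admissible_le_supersolution[OF \<Omega> bm v D2on_add[OF D2on_const[of _ "u0 z + e"] Dk] _ _ _ p])
    fix p assume "p \<in> \<Omega> \<times> {0<..}"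
    then have x: "fst p \<in> closure \<Omega>" using sub by auto
    have "lap (\<lambda>j. 0 + k *\<^sub>R ((H (fst p) (fst j), 0) + (0, 0 * snd j))) = k * lap (\<lambda>j. (H (fst p) (fst j), 0) + (0, 0 * snd j))"
      by (simp only: lap_scaleR add_0_left)
    also have "\<dots> \<le> k * (bm * C)" using lap\<Theta>[OF x] k(1) by (rule mult_left_mono)
    also have "\<dots> = bm * (k * C)" by simp
    also have "\<dots> \<le> bflux bm bp (k * C)" by (simp add: bflux_def)
    finally show "lap (\<lambda>j. 0 + k *\<^sub>R ((H (fst p) (fst j), 0) + (0, 0 * snd j)))
       \<le> bflux bm bp (snd (0 + k *\<^sub>R ((G (fst p), 0) + (0, C))))" by simp
  next
    show "u0 x \<le> u0 z + e + k * \<Theta> (x, 0)" if "x \<in> closure \<Omega>" for x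
      using k(2)[OF that] by (simp add: \<Theta>_def)
    show "0 \<le> u0 z + e + k * \<Theta> (x, t)" if "x \<in> frontier \<Omega>" "0 \<le> t" for x t
    proof -
      have "0 \<le> k * (C * t)" using k C that by simp
      then show ?thesis using k(2)[OF sub] u0(2) that by (fastforce simp: \<Theta>_def distrib_left)
    qed
  qed
  have low: "admissible bm bp \<Omega> u0 (\<lambda>p. u0 z - e - k * \<Theta> p)"
  proof (rule subsolution_admissible[OF \<Omega>(1) D2on_diff[OF D2on_const[of _ "u0 z - e"] Dk]])
    fix p assume "p \<in> \<Omega> \<times> {0<..}"
    then have x: "fst p \<in> closure \<Omega>" using sub by auto
    have kC: "0 \<le> k * C" using k C by simp
    \<comment> \<open>The time derivative is - k C \<le> 0, where the larger of the two fluxes is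
      the one with \<open>bm\<close>. From above, the flux at k C is at least bm k C. So one trace
      bound by bm C serves both sides.\<close>
    have "bflux bm bp (snd (0 - k *\<^sub>R ((G (fst p), 0) + (0, C)))) = - (bm * (k * C))"
      using kC bm mult_right_mono[of bm bp "k * C"] by (simp add: bflux_def max_def)
    also have "bm * (k * C) = k * (bm * C)" by simp
    also have "- (k * (bm * C)) \<le> - (k * lap (\<lambda>j. (H (fst p) (fst j), 0) + (0, 0 * snd j)))"
      using mult_left_mono[OF lap\<Theta>[OF x] k(1)] by simp
    also have "\<dots> = lap (\<lambda>j. 0 - k *\<^sub>R ((H (fst p) (fst j), 0) + (0, 0 * snd j)))"
      by (simp only: diff_0 lap_minus lap_scaleR)
    finally show "bflux bm bp (snd (0 - k *\<^sub>R ((G (fst p), 0) + (0, C))))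
       \<le> lap (\<lambda>j. 0 - k *\<^sub>R ((H (fst p) (fst j), 0) + (0, 0 * snd j)))" .
  next
    show "u0 z - e - k * \<Theta> (x, 0) \<le> u0 x" if "x \<in> closure \<Omega>" for x
      using k(2)[OF that] by (simp add: \<Theta>_def)
    show "u0 z - e - k * \<Theta> (x, t) \<le> 0" if "x \<in> frontier \<Omega>" "0 \<le> t" for x t
    proof -
      have "0 \<le> k * (C * t)" using k C that by simp
      then show ?thesis using k(2)[OF sub] u0(2) that by (fastforce simp: \<Theta>_def distrib_left)
    qed
  qed
  show ?thesis
    by (rule that[OF k(1)]) (use up low D2on_continuous[OF D\<Theta>] in \<open>simp_all add: \<Theta>_def\<close>)
qed

text \<open>A quadratic touching the envelope and violating the inequality becomes a strict
  supersolution with room on a sphere. The maximum principle carries this room inside for each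
  member of the family, hence for the supremum, and contradicts the contact at the centre.\<close>

lemma vsub_envelope_Sup:
  fixes u :: "'a::euclidean_space \<times> real \<Rightarrow> real"
  assumes F: "continuous_on UNIV F" and W: "open W" "W \<subseteq> D" and u: "\<And>q. q \<in> D \<Longrightarrow> \<bar>u q\<bar> \<le> M"
    and S: "\<And>v. v \<in> S \<Longrightarrow> usc_on D v" "\<And>v. v \<in> S \<Longrightarrow> vsub F W v" "\<And>v p. v \<in> S \<Longrightarrow> p \<in> D \<Longrightarrow> v p \<le> u p"
    and Sup: "\<And>p c. p \<in> D \<Longrightarrow> (\<And>v. v \<in> S \<Longrightarrow> v p \<le> c) \<Longrightarrow> u p \<le> c"
  shows "vsub F W (envelope D u)"
  unfolding vsub_def
proof (intro ballI allI impI)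
  fix p a and A :: "'a \<times> real \<Rightarrow> 'a \<times> real"
  let ?u = "envelope D u"
  assume p: "p \<in> W" and A: "linear A" and t: "\<forall>\<^sub>F q in nhds p. ?u q \<le> quad (?u p) a A p q"
  show "F (snd a) \<le> lap A"
  proof (rule ccontr)
    assume "\<not> F (snd a) \<le> lap A"
    then have lt: "lap A < F (snd a)" by simp
    obtain e r g H where er: "e > 0" "r > 0" "cball p r \<subseteq> W" "\<And>q. q \<in> cball p r \<Longrightarrow> ?u q \<le> quad (?u p) a A p q"
      "D2on UNIV (\<lambda>q. quad (?u p) a A p q + e * (norm (q - p))\<^sup>2) g H" "\<And>q. q \<in> ball p r \<Longrightarrow> lap (H q) < F (snd (g q))"
      by (rule strict_perturbation[OF A F lt W(1) p t]) (rule that)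
    define \<phi> where "\<phi> q = quad (?u p) a A p q + e * (norm (q - p))\<^sup>2" for q
    have D\<phi>: "D2on UNIV \<phi> g H" unfolding \<phi>_def[abs_def] by (rule er(5))
    have c\<phi>: "continuous_on X \<phi>" for X using continuous_on_subset[OF D2on_continuous[OF D\<phi>]] by simp
    have \<phi>p: "\<phi> p = ?u p" by (simp add: \<phi>_def quad_def linear_0[OF A])
    have pD: "p \<in> D" using p W by auto
    \<comment> \<open>On the sphere \<phi> exceeds the touching quadratic, and with it every member
      of \<open>S\<close>, by e r^2; since the maximum of v - \<phi> is attained there, the gap
      holds throughout the ball.\<close>
    have le: "u q \<le> \<phi> q - e * r\<^sup>2" if q: "q \<in> cball p r" for q
    proof (rule Sup)
      show "q \<in> D" using q er(3) W by auto
      fix v assume v: "v \<in> S"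
      have sD: "cball p r \<subseteq> D" using er(3) W by blast
      have "\<exists>y\<in>cball p r - ball p r. v q - \<phi> q \<le> v y - \<phi> y"
      proof (rule max_off_strict[OF F compact_cball open_ball ball_subset_cball _ _ D2on_subset[OF D\<phi> subset_UNIV] er(6) q])
        show "vsub F (ball p r) v" by (rule vsub_mono[OF S(2)[OF v]]) (use er(3) in auto)
        show "usc_on (cball p r) (\<lambda>p. v p - \<phi> p)"
          by (intro usc_on_diff usc_on_subset[OF S(1)[OF v] sD] c\<phi>)
      qed
      then obtain y where y: "y \<in> cball p r" "y \<notin> ball p r" "v q - \<phi> q \<le> v y - \<phi> y" by blast
      have yD: "y \<in> D" using y(1) sD by blast
      have "v y \<le> u y" by (rule S(3)[OF v yD])
      also have "u y \<le> ?u y" by (rule envelope_ge[OF u yD])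
      also have "\<dots> \<le> quad (?u p) a A p y" by (rule er(4)[OF y(1)])
      also have "\<dots> = \<phi> y - e * r\<^sup>2" 
      proof -
        have "norm (y - p) = r" using y by (simp add: dist_norm norm_minus_commute)
        then show ?thesis by (simp add: \<phi>_def)
      qed
      finally show "v q \<le> \<phi> q - e * r\<^sup>2" using y(3) by linarith
    qed
    have er2: "0 < e * r\<^sup>2" using er by simp
    have "isCont \<phi> p" by (rule continuous_on_UNIV_isCont[OF c\<phi>])
    then obtain d where d: "d > 0" "\<And>q. dist q p < d \<Longrightarrow> dist (\<phi> q) (\<phi> p) < e * r\<^sup>2 / 2"
      unfolding continuous_at_eps_delta using half_gt_zero[OF er2] by blast
    have "?u p \<le> \<phi> p - e * r\<^sup>2 / 2"
    proof (rule envelope_le[OF u pD])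
      show "min d r > 0" using d er by simp
      fix q assume q: "q \<in> D" "dist q p < min d r"
      have "u q \<le> \<phi> q - e * r\<^sup>2" by (rule le) (use q in \<open>simp add: dist_commute\<close>)
      moreover have "\<bar>\<phi> q - \<phi> p\<bar> < e * r\<^sup>2 / 2" using d(2)[of q] q by (simp add: dist_real_def)
      ultimately show "u q \<le> \<phi> p - e * r\<^sup>2 / 2" by linarith
    qed
    then show False using er2 \<phi>p by simp
  qed
qed

lemma usc_on_locally:
  fixes w :: "'a::metric_space \<Rightarrow> real"
  assumes "\<And>p. p \<in> S \<Longrightarrow> \<exists>u T. open T \<and> p \<in> T \<and> usc_on (S \<inter> T) u \<and> (\<forall>q\<in>S \<inter> T. w q = u q)"
  shows "usc_on S w"
proof (rule usc_onI)
  fix p c assume p: "p \<in> S" "w p < c"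
  obtain u T where T: "open T" "p \<in> T" "usc_on (S \<inter> T) u" "\<forall>q\<in>S \<inter> T. w q = u q" using assms[OF p(1)] by blast
  obtain e1 where e1: "e1 > 0" "\<forall>q\<in>S \<inter> T. dist q p < e1 \<longrightarrow> u q < c"
    using usc_onD[OF T(3), of p c] T p by auto
  obtain e2 where e2: "e2 > 0" "\<And>q. dist q p < e2 \<Longrightarrow> q \<in> T" using T unfolding open_dist by blast
  have "\<forall>q\<in>S. dist q p < min e1 e2 \<longrightarrow> w q < c" using e1 e2 T by simp
  then show "\<exists>e>0. \<forall>q\<in>S. dist q p < e \<longrightarrow> w q < c" using e1 e2 by (intro exI[of _ "min e1 e2"]) auto
qed

lemma usc_on_max:
  fixes u v :: "'a::metric_space \<Rightarrow> real"
  assumes "usc_on S u" "usc_on S v"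
  shows "usc_on S (\<lambda>p. max (u p) (v p))"
proof (rule usc_onI)
  fix p c assume p: "p \<in> S" "max (u p) (v p) < c"
  obtain e1 where e1: "e1 > 0" "\<forall>q\<in>S. dist q p < e1 \<longrightarrow> u q < c" using usc_onD[OF assms(1) p(1)] p(2) by auto
  obtain e2 where e2: "e2 > 0" "\<forall>q\<in>S. dist q p < e2 \<longrightarrow> v q < c" using usc_onD[OF assms(2) p(1)] p(2) by auto
  show "\<exists>e>0. \<forall>q\<in>S. dist q p < e \<longrightarrow> max (u q) (v q) < c" using e1 e2 by (intro exI[of _ "min e1 e2"]) auto
qed

text \<open>Perron's bump: where the lower envelope of a maximal subsolution \<open>u\<close> fails to be a
  supersolution, a small strict subsolution glued in would push \<open>u\<close> up.\<close>

lemma vsub_lower_envelope: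
  fixes u :: "'a::euclidean_space \<times> real \<Rightarrow> real"
  assumes F: "continuous_on UNIV F" and W: "open W" "W \<subseteq> D" and u: "\<And>q. q \<in> D \<Longrightarrow> \<bar>u q\<bar> \<le> M"
    and us: "usc_on D u" "vsub F W u"
    and max: "\<And>v. usc_on D v \<Longrightarrow> vsub F W v \<Longrightarrow> (\<And>q. q \<in> D - W \<Longrightarrow> v q = u q) \<Longrightarrow> (\<And>q. q \<in> D \<Longrightarrow> v q \<le> u q)"
  shows "vsub (\<lambda>s. - F (- s)) W (envelope D (\<lambda>p. - u p))"
  unfolding vsub_def
proof (intro ballI allI impI)
  fix p a and A :: "'a \<times> real \<Rightarrow> 'a \<times> real"
  let ?n = "envelope D (\<lambda>p. - u p)"
  assume p: "p \<in> W" and A: "linear A" and t: "\<forall>\<^sub>F q in nhds p. ?n q \<le> quad (?n p) a A p q"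
  have u': "\<And>q. q \<in> D \<Longrightarrow> \<bar>- u q\<bar> \<le> M" using u by simp
  have F': "continuous_on UNIV (\<lambda>s. - F (- s))" by (intro continuous_intros continuous_on_compose2[OF F]) auto
  show "- F (- snd a) \<le> lap A"
  proof (rule ccontr)
    assume "\<not> - F (- snd a) \<le> lap A"
    then have lt: "lap A < - F (- snd a)" by simp
    obtain e r g H where er: "e > 0" "r > 0" "cball p r \<subseteq> W" "\<And>q. q \<in> cball p r \<Longrightarrow> ?n q \<le> quad (?n p) a A p q"
      "D2on UNIV (\<lambda>q. quad (?n p) a A p q + e * (norm (q - p))\<^sup>2) g H" "\<And>q. q \<in> ball p r \<Longrightarrow> lap (H q) < - F (- snd (g q))"
      by (rule strict_perturbation[OF A F' lt W(1) p t]) (rule that)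
    define \<phi> where "\<phi> q = - (quad (?n p) a A p q + e * (norm (q - p))\<^sup>2)" for q
    have D\<phi>: "D2on UNIV \<phi> (\<lambda>q. - g q) (\<lambda>q k. - H q k)" unfolding \<phi>_def by (rule D2on_minus[OF er(5)])
    have c\<phi>: "continuous_on X \<phi>" for X using continuous_on_subset[OF D2on_continuous[OF D\<phi>]] by simp
    have \<phi>p: "\<phi> p = - ?n p" by (simp add: \<phi>_def quad_def linear_0[OF A])
    have pD: "p \<in> D" using p W by auto
    have bW: "ball p r \<subseteq> W" using er(3) ball_subset_cball by blast
    \<comment> \<open>The lift of the glued function. Beyond r / 2 the perturbation outweighs it, so
      the raised \<phi> is already below \<open>u\<close> there and the gluing creates no
      edge.\<close>
    define \<kappa> where "\<kappa> = e * (r / 2)\<^sup>2"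
    have \<kappa>: "\<kappa> > 0" using er by (simp add: \<kappa>_def)
    define v where "v q = (if q \<in> ball p r then max (u q) (\<phi> q + \<kappa>) else u q)" for q
    have vu: "v q = u q" if q: "q \<in> D" "dist q p > r / 2" for q
    proof (cases "q \<in> ball p r")
      case True
      have "(r / 2)\<^sup>2 \<le> (norm (q - p))\<^sup>2" using q er by (intro power_mono) (auto simp: dist_norm)
      then have "\<kappa> \<le> e * (norm (q - p))\<^sup>2" using er unfolding \<kappa>_def by (intro mult_left_mono) auto
      moreover have "?n q \<le> quad (?n p) a A p q" using True by (intro er(4)) auto
      moreover have "- u q \<le> ?n q" by (rule envelope_ge[OF u' q(1)])
      ultimately have "\<phi> q + \<kappa> \<le> u q" unfolding \<phi>_def by linarith
      then show ?thesis by (simp add: v_def)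
    qed (simp add: v_def)
    have ge: "u q \<le> v q" for q by (simp add: v_def)
    have usc: "usc_on D v"
    proof (rule usc_on_locally)
      fix q assume q: "q \<in> D"
      show "\<exists>w T. open T \<and> q \<in> T \<and> usc_on (D \<inter> T) w \<and> (\<forall>x\<in>D \<inter> T. v x = w x)"
      proof (cases "q \<in> ball p r")
        case True
        have "usc_on (D \<inter> ball p r) (\<lambda>q. max (u q) (\<phi> q + \<kappa>))"
          by (intro usc_on_max usc_on_subset[OF us(1)] usc_on_continuous continuous_intros c\<phi>) auto
        then show ?thesis using True
          by (intro exI[of _ "\<lambda>q. max (u q) (\<phi> q + \<kappa>)"] exI[of _ "ball p r"]) (auto simp: v_def)
      next
        case False
        have "open (- cball p (r / 2))" by (simp add: open_Compl)
        moreover have "q \<in> - cball p (r / 2)" using False er by auto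
        moreover have "usc_on (D \<inter> - cball p (r / 2)) u" by (rule usc_on_subset[OF us(1)]) auto
        moreover have "\<forall>x\<in>D \<inter> - cball p (r / 2). v x = u x" by (intro ballI vu) (auto simp: dist_commute)
        ultimately show ?thesis by blast
      qed
    qed
    have vs: "vsub F W v"
      unfolding vsub_def
    proof (intro ballI allI impI)
      fix y a' and A' :: "'a \<times> real \<Rightarrow> 'a \<times> real"
      assume y: "y \<in> W" and A': "linear A'" and t': "\<forall>\<^sub>F q in nhds y. v q \<le> quad (v y) a' A' y q"
      show "F (snd a') \<le> lap A'"
      \<comment> \<open>Where v = u, a test for the larger function \<open>v\<close> is also a test
        for \<open>u\<close>; elsewhere \<open>v\<close> is the raised \<phi>, a classical
        subsolution.\<close>
      proof (cases "v y = u y")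
        case True
        have "\<forall>\<^sub>F q in nhds y. u q \<le> quad (u y) a' A' y q"
          using t' unfolding True by eventually_elim (use ge order_trans in blast)
        then show ?thesis using us(2) y A' unfolding vsub_def by blast
      next
        case False
        then have yb: "y \<in> ball p r" "v y = \<phi> y + \<kappa>" by (auto simp: v_def max_def split: if_splits)
        have "vsub F (ball p r) \<phi>"
        proof (rule classical_vsub[OF open_ball D2on_subset[OF D\<phi> subset_UNIV]])
          show "F (snd (- g q)) \<le> lap (\<lambda>k. - H q k)" if "q \<in> ball p r" for q
            using er(6)[OF that] by (simp add: lap_minus)
        qed
        then have "vsub F (ball p r) (\<lambda>q. \<phi> q + \<kappa>)" by (simp add: vsub_add_const)
        moreover have "\<forall>\<^sub>F q in nhds y. \<phi> q + \<kappa> \<le> quad (\<phi> y + \<kappa>) a' A' y q"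
          using t' eventually_nhds_in_open[OF open_ball yb(1)] unfolding yb(2)
          by eventually_elim (simp add: v_def)
        ultimately show ?thesis using yb(1) A' unfolding vsub_def by blast
      qed
    qed
    have le: "v q \<le> u q" if "q \<in> D" for q
    proof (rule max[OF usc vs _ that])
      fix q assume "q \<in> D - W"
      then show "v q = u q" using bW by (auto simp: v_def)
    qed
    have "isCont \<phi> p" by (rule continuous_on_UNIV_isCont[OF c\<phi>])
    then obtain d where d: "d > 0" "\<And>q. dist q p < d \<Longrightarrow> dist (\<phi> q) (\<phi> p) < \<kappa> / 2"
      unfolding continuous_at_eps_delta using half_gt_zero[OF \<kappa>] by blast
    have "?n p \<le> ?n p - \<kappa> / 2"
    proof (rule envelope_le[OF u' pD])
      show "min d r > 0" using d er by simp
      fix q assume q: "q \<in> D" "dist q p < min d r"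
      have "\<phi> q + \<kappa> \<le> v q" using q by (simp add: v_def dist_commute)
      then have "\<phi> q + \<kappa> \<le> u q" using le[OF q(1)] by linarith
      moreover have "\<bar>\<phi> q - \<phi> p\<bar> < \<kappa> / 2" using d(2)[of q] q by (simp add: dist_real_def)
      ultimately show "- u q \<le> ?n p - \<kappa> / 2" using \<phi>p by linarith
    qed
    then show False using \<kappa> by simp
  qed
qed

text \<open>Admissibility is designed so that the envelope of the supremum is admissible again,
  hence equal to the supremum. The lower envelope is a supersolution by maximality, and
  \<open>interior_comparison\<close> puts \<open>u\<close> below it; the two coincide and
  \<open>u\<close> is continuous.\<close>

lemma perron_solution:
  fixes \<Omega> :: "'a::euclidean_space set"
  assumes \<Omega>: "bounded_smooth_domain \<Omega>" and bm: "0 < bm" "bm < bp"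
    and u0: "continuous_on (closure \<Omega>) u0" "\<And>x. x \<in> frontier \<Omega> \<Longrightarrow> u0 x = 0"
  obtains u M where "continuous_on (closure \<Omega> \<times> {0..}) u" "\<And>p. p \<in> closure \<Omega> \<times> {0..} \<Longrightarrow> \<bar>u p\<bar> \<le> M"
    "vsub (bflux bm bp) (\<Omega> \<times> {0<..}) u" "vsub (\<lambda>s. - bflux bm bp (- s)) (\<Omega> \<times> {0<..}) (\<lambda>p. - u p)"
    "\<And>x. x \<in> closure \<Omega> \<Longrightarrow> u (x, 0) = u0 x" "\<And>x t. x \<in> frontier \<Omega> \<Longrightarrow> 0 \<le> t \<Longrightarrow> u (x, t) = 0"
proof -
  have \<Omega>': "open \<Omega>" "bounded \<Omega>" "smooth_boundary \<Omega>" "\<Omega> \<noteq> {}" using \<Omega> by (auto simp: bounded_smooth_domain_def)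
  let ?D = "closure \<Omega> \<times> {0..} :: ('a \<times> real) set" and ?W = "\<Omega> \<times> {0<..} :: ('a \<times> real) set"
  let ?S = "{v. admissible bm bp \<Omega> u0 v}"
  have W: "open ?W" "?W \<subseteq> ?D" using \<Omega>' closure_subset[of \<Omega>] by (auto intro: open_Times)
  have fr: "x \<in> closure \<Omega>" "x \<notin> \<Omega>" if "x \<in> frontier \<Omega>" for x using that \<Omega>'(1) by (auto simp: frontier_def interior_open)
  have "compact (closure \<Omega>)" using \<Omega>' by simp
  then have "bounded (u0 ` closure \<Omega>)" by (intro compact_imp_bounded compact_continuous_image u0)
  then obtain M where M: "M > 0" "\<And>x. x \<in> closure \<Omega> \<Longrightarrow> \<bar>u0 x\<bar> \<le> M" unfolding bounded_pos by auto
  have flux0: "bflux bm bp 0 = 0" by (simp add: bflux_def)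
  have lap0: "lap (\<lambda>k::'a \<times> real. 0 :: 'a \<times> real) = 0" by (simp add: lap_def)
  have low: "admissible bm bp \<Omega> u0 (\<lambda>p. - M)"
  proof (rule subsolution_admissible[OF \<Omega>'(1) D2on_const])
    show "- M \<le> u0 x" if "x \<in> closure \<Omega>" for x using M(2)[OF that] by linarith
  qed (use M flux0 lap0 in auto)
  have high: "v p \<le> M" if v: "admissible bm bp \<Omega> u0 v" and p: "p \<in> ?D" for v p
  proof (rule admissible_le_supersolution[OF \<Omega>'(1,2) bm v D2on_const _ _ _ p])
    show "u0 x \<le> M" if "x \<in> closure \<Omega>" for x using M(2)[OF that] by linarith
  qed (use M flux0 lap0 in auto)
  define u where "u p = (SUP v\<in>?S. v p)" for p
  have bdd: "bdd_above ((\<lambda>v. v p) ` ?S)" if "p \<in> ?D" for p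
    using high[OF _ that] by (auto intro!: bdd_aboveI[of _ M])
  have Sle: "v p \<le> u p" if "v \<in> ?S" "p \<in> ?D" for v p
    unfolding u_def by (rule cSUP_upper[OF that(1) bdd[OF that(2)]])
  have Sup: "u p \<le> c" if "p \<in> ?D" "\<And>v. v \<in> ?S \<Longrightarrow> v p \<le> c" for p c
    unfolding u_def using low that(2) by (intro cSUP_least) blast+
  have uM: "\<bar>u p\<bar> \<le> M" if p: "p \<in> ?D" for p
  proof -
    have "- M \<le> u p" using Sle[of "\<lambda>p. - M" p] low p by simp
    moreover have "u p \<le> M" by (rule Sup[OF p]) (use high[OF _ p] in simp)
    ultimately show ?thesis by linarith
  qed
  have pinch: "\<exists>\<beta> l. continuous_on ?D \<beta> \<and> continuous_on ?D l \<and> (\<forall>p\<in>?D. u p \<le> \<beta> p) \<and> (\<forall>p\<in>?D. l p \<le> u p)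
      \<and> \<beta> (z, t) = u0 z + e \<and> l (z, t) = u0 z - e"
    if b: "z \<in> closure \<Omega>" "0 \<le> t" "t = 0 \<or> z \<in> frontier \<Omega>" and e: "e > 0" for z t e
  proof -
    \<comment> \<open>The term \<open>C * snd p\<close> must vanish at (z, t). Over a boundary
      point, corners included, the barrier is superharmonic and C = 0. Otherwise t = 0 and the
      squared distance serves; its trace 2 N determines \<open>C\<close>.\<close>
    obtain \<omega> G H C where w: "D2on UNIV \<omega> G H" "\<omega> z = 0" "\<And>x. x \<in> closure \<Omega> \<Longrightarrow> x \<noteq> z \<Longrightarrow> 0 < \<omega> x"
      "C \<ge> 0" "\<And>x. x \<in> closure \<Omega> \<Longrightarrow> (\<Sum>i\<in>Basis. H x i \<bullet> i) \<le> bm * C" "C * t = 0"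
    proof (cases "z \<in> frontier \<Omega>")
      case True
      obtain w G H where w: "D2on UNIV w G H" "w z = 0" "\<And>x. x \<in> closure \<Omega> \<Longrightarrow> x \<noteq> z \<Longrightarrow> 0 < w x"
          "\<And>x. x \<in> closure \<Omega> \<Longrightarrow> (\<Sum>i\<in>Basis. H x i \<bullet> i) \<le> 0"
        by (rule exterior_barrier[OF \<Omega>'(1,3) True]) (assumption | rule that)+
      show ?thesis by (rule that[OF w(1-3), of 0]) (use w(4) in simp_all)
    next
      case False
      then have "t = 0" using b by simp
      have "D2on UNIV (\<lambda>x. (norm (x - z))\<^sup>2) (\<lambda>x. 2 *\<^sub>R (x - z)) (\<lambda>x k. 2 *\<^sub>R k)" by (rule D2on_sq)
      then show ?thesis
      proof (rule that)
        show "(\<Sum>i\<in>Basis. (2 *\<^sub>R i) \<bullet> (i::'a)) \<le> bm * (2 * DIM('a) / bm)"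
          unfolding trace_scale_id using bm by simp
      qed (use \<open>t = 0\<close> bm in auto)
    qed
    obtain k where k: "k \<ge> 0"
      "\<And>v p. admissible bm bp \<Omega> u0 v \<Longrightarrow> p \<in> ?D \<Longrightarrow> v p \<le> u0 z + e + k * (\<omega> (fst p) + C * snd p)"
      "admissible bm bp \<Omega> u0 (\<lambda>p. u0 z - e - k * (\<omega> (fst p) + C * snd p))"
      "continuous_on UNIV (\<lambda>p. \<omega> (fst p) + C * snd p)"
      by (rule two_sided_barrier[OF \<Omega>'(1,2) bm u0 b(1) w(1,2,3,4,5) e]) (assumption | rule that)+
    have c: "continuous_on ?D (\<lambda>p. \<omega> (fst p) + C * snd p)" by (rule continuous_on_subset[OF k(4)]) simp
    have "\<forall>p\<in>?D. u p \<le> u0 z + e + k * (\<omega> (fst p) + C * snd p)" using Sup k(2) by blast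
    moreover have "\<forall>p\<in>?D. u0 z - e - k * (\<omega> (fst p) + C * snd p) \<le> u p" using Sle[OF _] k(3) by blast
    moreover have "continuous_on ?D (\<lambda>p. u0 z + e + k * (\<omega> (fst p) + C * snd p))"
      "continuous_on ?D (\<lambda>p. u0 z - e - k * (\<omega> (fst p) + C * snd p))"
      by (intro continuous_on_add continuous_on_diff continuous_on_mult continuous_on_const c)+
    ultimately show ?thesis
      by (intro exI[of _ "\<lambda>p. u0 z + e + k * (\<omega> (fst p) + C * snd p)"] exI[of _ "\<lambda>p. u0 z - e - k * (\<omega> (fst p) + C * snd p)"])
        (simp add: w(2,6))
  qed
  let ?E = "envelope ?D u"
  let ?N = "envelope ?D (\<lambda>p. - u p)"
  have nuM: "\<bar>- u p\<bar> \<le> M" if "p \<in> ?D" for p using uM[OF that] by simp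
  have bE: "?E (z, t) \<le> u0 z" and bN: "?N (z, t) \<le> - u0 z"
    if b: "z \<in> closure \<Omega>" "0 \<le> t" "t = 0 \<or> z \<in> frontier \<Omega>" for z t
  proof -
    have p: "(z, t) \<in> ?D" using b by simp
    show "?E (z, t) \<le> u0 z"
    proof (rule field_le_epsilon)
      fix e :: real assume "e > 0"
      from pinch[OF b this] obtain \<beta> where \<beta>: "continuous_on ?D \<beta>" "\<forall>p\<in>?D. u p \<le> \<beta> p" "\<beta> (z, t) = u0 z + e" by blast
      have "?E (z, t) \<le> \<beta> (z, t)"
        by (rule envelope_le_continuous[OF uM _ _ p]) (use \<beta> in auto)
      then show "?E (z, t) \<le> u0 z + e" using \<beta> by simp
    qed
    show "?N (z, t) \<le> - u0 z"
    proof (rule field_le_epsilon)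
      fix e :: real assume "e > 0"
      from pinch[OF b this] obtain l where l: "continuous_on ?D l" "\<forall>p\<in>?D. l p \<le> u p" "l (z, t) = u0 z - e" by blast
      have "?N (z, t) \<le> - l (z, t)"
        by (rule envelope_le_continuous[OF nuM _ _ p]) (use l in \<open>auto intro: continuous_on_minus\<close>)
      then show "?N (z, t) \<le> - u0 z + e" using l by simp
    qed
  qed
  have Sprops: "usc_on ?D v" "vsub (bflux bm bp) ?W v" if "v \<in> ?S" for v using that by (auto simp: admissible_def)
  have "vsub (bflux bm bp) ?W ?E"
    by (rule vsub_envelope_Sup[where S = ?S and u = u and M = M])
      (use bflux_continuous W uM Sprops Sle Sup in \<open>blast+\<close>)
  \<comment> \<open>The barriers lie above every admissible function and are continuous, so the
    envelope still respects the boundary and initial values; this places it in the family.\<close>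
  then have E: "?E \<in> ?S"
    using envelope_usc[of ?D u M, OF uM] bE fr u0(2) by (fastforce simp: admissible_def)
  have Eu: "?E p = u p" if "p \<in> ?D" for p
    using Sle[OF E that] envelope_ge[where u = u, OF uM that] by linarith
  have uscu: "usc_on ?D u" using Sprops(1)[OF E] usc_on_cong[of ?D ?E u] Eu by blast
  have vsu: "vsub (bflux bm bp) ?W u"
    by (rule vsub_local_cong[OF W(1) _ Sprops(2)[OF E]]) (use Eu W(2) in blast)
  have bu: "u (z, t) \<le> u0 z" if "z \<in> closure \<Omega>" "0 \<le> t" "t = 0 \<or> z \<in> frontier \<Omega>" for z t
    using bE[OF that] Eu[of "(z, t)"] that by simp
  have vsN: "vsub (\<lambda>s. - bflux bm bp (- s)) ?W ?N"
  proof (rule vsub_lower_envelope[OF bflux_continuous W uM uscu vsu])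
    fix v p assume v: "usc_on ?D v" "vsub (bflux bm bp) ?W v" "\<And>q. q \<in> ?D - ?W \<Longrightarrow> v q = u q" and p: "p \<in> ?D"
    have "v (z, t) \<le> u0 z" if b: "z \<in> closure \<Omega>" "0 \<le> t" "t = 0 \<or> z \<in> frontier \<Omega>" for z t
    proof -
      have "(z, t) \<in> ?D - ?W" using b fr by auto
      then show ?thesis using v(3) bu[OF b] by simp
    qed
    then have "v \<in> ?S" using v fr u0(2) by (fastforce simp: admissible_def)
    then show "v p \<le> u p" using p by (rule Sle)
  qed
  have Nge: "- u p \<le> ?N p" if "p \<in> ?D" for p by (rule envelope_ge[OF nuM that])
  have NM: "\<bar>?N p\<bar> \<le> M" if p: "p \<in> ?D" for p
  proof -
    have "?N p \<le> M" by (rule envelope_le[OF nuM p zero_less_one abs_le_D1[OF nuM]])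
    then show ?thesis using Nge[OF p] uM[OF p] by linarith
  qed
  \<comment> \<open>At initial and lateral points both envelopes are pinched to the data; inside,
    comparison of \<open>u\<close> with the supersolution \<open>- ?N\<close> supplies the missing
    inequality.\<close>
  have Nu: "?N p = - u p" if p: "p \<in> ?D" for p
  proof -
    obtain z t where zt: "p = (z, t)" "z \<in> closure \<Omega>" "0 \<le> t" using p by auto
    have "?N (z, t) \<le> - u (z, t)"
    proof (cases "t = 0 \<or> z \<in> frontier \<Omega>")
      case True
      then show ?thesis using bN[OF zt(2,3)] bu[OF zt(2,3)] by fastforce
    next
      case False
      have z: "z \<in> \<Omega>" using False zt \<Omega>'(1) by (auto simp: frontier_def interior_open)
      have sub: "closure \<Omega> \<times> {0..t + 1} \<subseteq> ?D" by auto
      have subW: "\<Omega> \<times> {0<..<t + 1} \<subseteq> ?W" by auto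
      have "u (z, t) \<le> - ?N (z, t)"
      proof (rule interior_comparison[OF \<Omega>'(1-3) bm, where T = "t + 1" and v = "\<lambda>p. - ?N p"])
        show "usc_on (closure \<Omega> \<times> {0..t + 1}) u" by (rule usc_on_subset[OF uscu sub])
        show "\<bar>u p\<bar> \<le> M" "\<bar>- ?N p\<bar> \<le> M" if "p \<in> closure \<Omega> \<times> {0..t + 1}" for p
          using uM[OF subsetD[OF sub that]] NM[OF subsetD[OF sub that]] by simp_all
        show "vsub (bflux bm bp) (\<Omega> \<times> {0<..<t + 1}) u" by (rule vsub_mono[OF vsu subW order_refl])
        show "usc_on (closure \<Omega> \<times> {0..t + 1}) (\<lambda>p. - (- ?N p))"
          using usc_on_subset[OF envelope_usc[OF nuM] sub] by simp
        show "vsub (\<lambda>s. - bflux bm bp (- s)) (\<Omega> \<times> {0<..<t + 1}) (\<lambda>p. - (- ?N p))"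
          using vsub_mono[OF vsN subW order_refl] by simp
        show "u p \<le> - ?N p" if "p \<in> parabolic_boundary \<Omega> (t + 1)" for p
        proof -
          obtain y s where ys: "p = (y, s)" by (cases p)
          have b: "y \<in> closure \<Omega>" "0 \<le> s" "s = 0 \<or> y \<in> frontier \<Omega>"
            using that closure_subset[of \<Omega>] fr by (auto simp: parabolic_boundary_def ys)
          show ?thesis using bu[OF b] bN[OF b] by (simp add: ys)
        qed
      qed (use z False zt in auto)
      then show ?thesis by simp
    qed
    then show ?thesis using Nge[OF p] by (simp add: zt(1))
  qed
  have "usc_on ?D ?N" by (rule envelope_usc) (rule nuM)
  then have "usc_on ?D (\<lambda>p. - u p)" by (rule usc_on_cong[THEN iffD1, rotated]) (rule Nu)
  then have cu: "continuous_on ?D u" by (rule continuous_on_usc_lsc[OF uscu])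
  have vsnu: "vsub (\<lambda>s. - bflux bm bp (- s)) ?W (\<lambda>p. - u p)"
    by (rule vsub_local_cong[OF W(1) Nu[OF subsetD[OF W(2)]] vsN])
  have beq: "u (z, t) = u0 z" if b: "z \<in> closure \<Omega>" "0 \<le> t" "t = 0 \<or> z \<in> frontier \<Omega>" for z t
    using bu[OF b] bN[OF b] Nu[of "(z, t)"] b by simp
  show ?thesis
  proof (rule that[OF cu uM vsu vsnu])
    show "u (x, 0) = u0 x" if "x \<in> closure \<Omega>" for x using beq[OF that, of 0] by simp
    show "u (x, t) = 0" if "x \<in> frontier \<Omega>" "0 \<le> t" for x t
      using beq[OF fr(1)[OF that(1)] that(2)] that u0(2) by simp
  qed
qed

text \<open>Inside the cylinder this is \<open>interior_comparison\<close>. At the remaining points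
  of the closure, in particular at the corners and at the final time, continuity of both functions
  carries the inequality over from the dense open cylinder.\<close>

lemma viscosity_comparison:
  fixes \<Omega> :: "'a::euclidean_space set"
  assumes \<Omega>: "bounded_smooth_domain \<Omega>" and bm: "0 < bm" "bm < bp" and T: "T > 0"
    and v: "viscosity_supersolution bm bp \<Omega> T v" and u: "viscosity_subsolution bm bp \<Omega> T u"
    and b: "\<And>p. p \<in> parabolic_boundary \<Omega> T \<Longrightarrow> u p \<le> v p"
  shows "p \<in> \<Omega> \<times> {0<..<T} \<union> parabolic_boundary \<Omega> T \<Longrightarrow> u p \<le> v p"
    and "p \<in> closure \<Omega> \<times> {0..T} \<Longrightarrow> continuous (at p within closure \<Omega> \<times> {0..T}) v \<Longrightarrow>
      continuous (at p within closure \<Omega> \<times> {0..T}) u \<Longrightarrow> u p \<le> v p"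
proof -
  have \<Omega>': "open \<Omega>" "bounded \<Omega>" "smooth_boundary \<Omega>" using \<Omega> by (auto simp: bounded_smooth_domain_def)
  have F: "bflux bm bp s = b_coeff bm bp s * s" for s by (rule bflux_eq[OF bm])
  note u' = viscosity_subsolution_iff[OF \<Omega>'(1) bflux_continuous F, THEN iffD1, OF u]
  note v' = viscosity_supersolution_iff[OF \<Omega>'(1) bflux_continuous F, THEN iffD1, OF v]
  obtain M1 where M1: "\<And>p. p \<in> closure \<Omega> \<times> {0..T} \<Longrightarrow> \<bar>u p\<bar> \<le> M1" using u' unfolding bounded_iff by (metis image_eqI real_norm_def)
  obtain M2 where M2: "\<And>p. p \<in> closure \<Omega> \<times> {0..T} \<Longrightarrow> \<bar>v p\<bar> \<le> M2" using v' unfolding bounded_iff by (metis image_eqI real_norm_def)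
  have int: "u p \<le> v p" if p: "p \<in> \<Omega> \<times> {0<..<T}" for p
  proof -
    obtain x t where xt: "p = (x, t)" "x \<in> \<Omega>" "0 < t" "t < T" using p by auto
    have "u (x, t) \<le> v (x, t)"
    proof (rule interior_comparison[OF \<Omega>' bm _ _ _ _ _ _ b xt(2-4), where M = "max M1 M2"])
      show "\<bar>u p\<bar> \<le> max M1 M2" "\<bar>v p\<bar> \<le> max M1 M2" if "p \<in> closure \<Omega> \<times> {0..T}" for p
        using M1[OF that] M2[OF that] by linarith+
    qed (use u' v' in simp_all)
    then show ?thesis by (simp add: xt)
  qed
  then show "p \<in> \<Omega> \<times> {0<..<T} \<union> parabolic_boundary \<Omega> T \<Longrightarrow> u p \<le> v p" using b by blast
  show "u p \<le> v p" if p: "p \<in> closure \<Omega> \<times> {0..T}" and c: "continuous (at p within closure \<Omega> \<times> {0..T}) v"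
      "continuous (at p within closure \<Omega> \<times> {0..T}) u"
  proof (cases "p \<in> \<Omega> \<times> {0<..<T}")
    case False
    \<comment> \<open>A point of the closure outside the open cylinder is a limit point of it, so
      the limit along the cylinder is taken over a nontrivial filter.\<close>
    have "closure (\<Omega> \<times> {0<..<T}) = closure \<Omega> \<times> {0..T}" using T by (simp add: closure_Times)
    then have "p islimpt (\<Omega> \<times> {0<..<T})" using p False by (auto simp: closure_def)
    then have nt: "at p within (\<Omega> \<times> {0<..<T}) \<noteq> bot" by (simp add: trivial_limit_within)
    have sub: "\<Omega> \<times> {0<..<T} \<subseteq> closure \<Omega> \<times> {0..T}" using closure_subset[of \<Omega>] by auto
    have "(v \<longlongrightarrow> v p) (at p within (\<Omega> \<times> {0<..<T}))" "(u \<longlongrightarrow> u p) (at p within (\<Omega> \<times> {0<..<T}))"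
      using c unfolding continuous_within by (auto intro: tendsto_within_subset[OF _ sub])
    then show ?thesis
      by (rule tendsto_le[OF nt]) (use int in \<open>auto simp: eventually_at_filter intro!: always_eventually\<close>)
  qed (rule int)
qed

theorem theorem2p3:
  fixes \<Omega> :: "'a::euclidean_space set" and bm bp :: real and u0 :: "'a \<Rightarrow> real"
  assumes "bounded_smooth_domain \<Omega>"
    and "0 < bm" and "bm < bp"
    and "continuous_on (closure \<Omega>) u0"
    and "\<forall>x\<in>frontier \<Omega>. u0 x = 0"
  shows "(\<exists>u. viscosity_solution bm bp \<Omega> u0 u \<and>
            (\<forall>v. viscosity_solution bm bp \<Omega> u0 v \<longrightarrow> (\<forall>p\<in>closure \<Omega> \<times> {0..}. v p = u p)) \<and>
            (\<forall>T>0. continuous_on (closure \<Omega> \<times> {0..T}) u)) \<and>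
         (\<forall>T>0. \<forall>u_sup u_sub.
            viscosity_supersolution bm bp \<Omega> T u_sup \<and> viscosity_subsolution bm bp \<Omega> T u_sub \<and>
            (\<forall>p\<in>parabolic_boundary \<Omega> T. u_sup p \<ge> u_sub p) \<longrightarrow>
              (\<forall>p\<in>\<Omega> \<times> {0<..<T} \<union> parabolic_boundary \<Omega> T. u_sup p \<ge> u_sub p) \<and>
              (\<forall>p\<in>closure \<Omega> \<times> {0..T}.
                 continuous (at p within closure \<Omega> \<times> {0..T}) u_sup \<and>
                 continuous (at p within closure \<Omega> \<times> {0..T}) u_sub \<longrightarrow> u_sup p \<ge> u_sub p))"
proof (intro conjI allI impI)
  note bm = assms(2,3)
  have \<Omega>: "open \<Omega>" using assms(1) by (simp add: bounded_smooth_domain_def)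
  have F: "bflux bm bp s = b_coeff bm bp s * s" for s by (rule bflux_eq[OF bm])
  obtain u M where u: "continuous_on (closure \<Omega> \<times> {0..}) u" "\<And>p. p \<in> closure \<Omega> \<times> {0..} \<Longrightarrow> \<bar>u p\<bar> \<le> M"
    "vsub (bflux bm bp) (\<Omega> \<times> {0<..}) u" "vsub (\<lambda>s. - bflux bm bp (- s)) (\<Omega> \<times> {0<..}) (\<lambda>p. - u p)"
    "\<And>x. x \<in> closure \<Omega> \<Longrightarrow> u (x, 0) = u0 x" "\<And>x t. x \<in> frontier \<Omega> \<Longrightarrow> 0 \<le> t \<Longrightarrow> u (x, t) = 0"
    by (rule perron_solution[OF assms(1) bm assms(4) assms(5)[rule_format]]) (assumption | rule that)+
  have cT: "continuous_on (closure \<Omega> \<times> {0..T}) u" for T by (rule continuous_on_subset[OF u(1)]) auto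
  have sol: "viscosity_solution bm bp \<Omega> u0 u"
    unfolding viscosity_solution_def
  proof (intro conjI allI impI u(1))
    fix T :: real assume T: "T > 0"
    have bd: "bounded (u ` (closure \<Omega> \<times> {0..T}))"
      by (rule boundedI[of _ M]) (use u(2) in auto)
    have sub: "\<Omega> \<times> {0<..<T} \<subseteq> \<Omega> \<times> {0<..}" by auto
    have "viscosity_subsolution bm bp \<Omega> T u"
      using bd vsub_mono[OF u(3) sub order_refl] usc_on_continuous[OF cT]
      by (subst viscosity_subsolution_iff[OF \<Omega> bflux_continuous F]) simp
    then show "ibvp_subsolution bm bp \<Omega> u0 T u"
      using u(5,6) closure_subset[of \<Omega>] by (auto simp: ibvp_subsolution_def)
    have "viscosity_supersolution bm bp \<Omega> T u"
      using bd vsub_mono[OF u(4) sub order_refl] usc_on_continuous[OF continuous_on_minus[OF cT]]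
      by (subst viscosity_supersolution_iff[OF \<Omega> bflux_continuous F]) simp
    then show "ibvp_supersolution bm bp \<Omega> u0 T u"
      using u(5,6) closure_subset[of \<Omega>] by (auto simp: ibvp_supersolution_def)
  qed
  have le: "v p \<le> w p" if v: "viscosity_solution bm bp \<Omega> u0 v" and w: "viscosity_solution bm bp \<Omega> u0 w"
    and p: "p \<in> closure \<Omega> \<times> {0..}" for v w p
  proof -
    \<comment> \<open>A horizon beyond the time of \<open>p\<close>. Solutions are continuous up to
      the corners, so the second part of \<open>viscosity_comparison\<close> reaches every point,
      although \<open>parabolic_boundary\<close> omits the corners.\<close>
    define T where "T = snd p + 1"
    have T: "T > 0" using p by (auto simp: T_def)
    have v': "ibvp_subsolution bm bp \<Omega> u0 T v" and w': "ibvp_supersolution bm bp \<Omega> u0 T w"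
      using v w T by (auto simp: viscosity_solution_def)
    have pT: "p \<in> closure \<Omega> \<times> {0..T}" using p by (auto simp: T_def)
    have c: "continuous (at p within closure \<Omega> \<times> {0..T}) f" if "viscosity_solution bm bp \<Omega> u0 f" for f
    proof -
      have "continuous_on (closure \<Omega> \<times> {0..T}) f"
        by (rule continuous_on_subset[of "closure \<Omega> \<times> {0..}"]) (use that in \<open>auto simp: viscosity_solution_def\<close>)
      then show ?thesis unfolding continuous_on_eq_continuous_within by (rule bspec[OF _ pT])
    qed
    show ?thesis
    proof (rule viscosity_comparison(2)[OF assms(1) bm T _ _ _ pT c[OF w] c[OF v]])
      show "viscosity_supersolution bm bp \<Omega> T w" using w' by (simp add: ibvp_supersolution_def)
      show "viscosity_subsolution bm bp \<Omega> T v" using v' by (simp add: ibvp_subsolution_def)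
      show "v q \<le> w q" if "q \<in> parabolic_boundary \<Omega> T" for q
      proof -
        obtain x t where q: "q = (x, t)" by (cases q)
        have "(x \<in> \<Omega> \<and> t = 0) \<or> (x \<in> frontier \<Omega> \<and> t \<in> {0<..<T})"
          using that by (auto simp: parabolic_boundary_def q)
        then show ?thesis
        proof
          assume "x \<in> \<Omega> \<and> t = 0"
          then have "v (x, t) \<le> u0 x" "u0 x \<le> w (x, t)"
            using v' w' by (auto simp: ibvp_supersolution_def ibvp_subsolution_def)
          then show ?thesis by (simp add: q)
        next
          assume "x \<in> frontier \<Omega> \<and> t \<in> {0<..<T}"
          then have "v (x, t) \<le> 0" "0 \<le> w (x, t)"
            using v' w' by (auto simp: ibvp_supersolution_def ibvp_subsolution_def)
          then show ?thesis by (simp add: q)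
        qed
      qed
    qed
  qed
  have "\<forall>v. viscosity_solution bm bp \<Omega> u0 v \<longrightarrow> (\<forall>p\<in>closure \<Omega> \<times> {0..}. v p = u p)"
    using le sol by (meson antisym)
  then show "\<exists>u. viscosity_solution bm bp \<Omega> u0 u \<and>
            (\<forall>v. viscosity_solution bm bp \<Omega> u0 v \<longrightarrow> (\<forall>p\<in>closure \<Omega> \<times> {0..}. v p = u p)) \<and>
            (\<forall>T>0. continuous_on (closure \<Omega> \<times> {0..T}) u)"
    using sol cT by blast
next
  fix T :: real and v u :: "'a \<times> real \<Rightarrow> real"
  assume T: "T > 0" and a: "viscosity_supersolution bm bp \<Omega> T v \<and> viscosity_subsolution bm bp \<Omega> T u \<and>
            (\<forall>p\<in>parabolic_boundary \<Omega> T. v p \<ge> u p)"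
  note cmp = viscosity_comparison[OF assms(1-3) T a[THEN conjunct1] a[THEN conjunct2, THEN conjunct1]
      a[THEN conjunct2, THEN conjunct2, rule_format]]
  show "\<forall>p\<in>\<Omega> \<times> {0<..<T} \<union> parabolic_boundary \<Omega> T. v p \<ge> u p"
    by (intro ballI cmp(1))
  show "\<forall>p\<in>closure \<Omega> \<times> {0..T}.
                 continuous (at p within closure \<Omega> \<times> {0..T}) v \<and>
                 continuous (at p within closure \<Omega> \<times> {0..T}) u \<longrightarrow> v p \<ge> u p"
    by (intro ballI impI cmp(2)) auto
qed

end
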